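(* Let $(\mathbb{X},\Gamma/{\sim})$ be a triple, let $C$ be its path category, and let $\mathfrak{P}$ be a screen of $(\mathbb{X},\Gamma/{\sim})$. Then the category $\overline{Q(C,\mathfrak{P})}$ is isomorphic to a path category (i.e. to the path category of some triple), and hence the pixelation $C[\Sigma_{\mathfrak{P}}^{-1}]$ is equivalent to a path category.
   Context: TRIPLES. A path in a nonempty set $\mathbb{X}$ is any function $\gamma:[0,1]\to\mathbb{X}$; $\mathrm{im}(\gamma)$ is its image. If $\gamma(1)=\gamma'(0)$, then $\gamma\cdot\gamma'$ is the path equal to $\gamma(2t)$ for $0\le t\le\frac12$ and to $\gamma'(2t-1)$ for $\frac12\le t\le1$. A triple $(\mathbb{X},\Gamma/{\sim})$ consists of a nonempty set $\mathbb{X}$, a set $\Gamma$ of paths in $\mathbb{X}$, and an equivalence relation $\sim$ on $\Gamma$ (equivalent paths have the same endpoints) such that: (a) $\gamma,\gamma'\in\Gamma$ with $\gamma(1)=\gamma'(0)$ implies $\gamma\cdot\gamma'\in\Gamma$; (b) if $\gamma\in\Gamma$ and $\phi:[0,1]\to[0,1]$ is weakly order preserving and sends intervals to intervals, then $\gamma\circ\phi\in\Gamma$; (c) all constant paths are in $\Gamma$; (d) a path equivalent to a constant path is constant; (e) if in (b) also $\phi(0)=0$, $\phi(1)=1$, then $\gamma\sim\gamma\circ\phi$; (f) if $\gamma,\gamma',\rho,\rho'\in\Gamma$ and $\rho\cdot\gamma\cdot\rho'$, $\rho\cdot\gamma'\cdot\rho'$ are defined and in $\Gamma$, then $\gamma\sim\gamma'$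 if and only if $\rho\cdot\gamma\cdot\rho'\sim\rho\cdot\gamma'\cdot\rho'$. The class of $\gamma$ is $[\gamma]$. SCREENS. A screen of $(\mathbb{X},\Gamma/{\sim})$ is a partition $\mathfrak{P}$ of $\mathbb{X}$, whose elements are called pixels, such that: (S1) if $\gamma,\gamma'\in\Gamma$ have the same start and the same end and $\mathrm{im}(\gamma)\subset\mathsf{X}\in\mathfrak{P}$, then $\gamma\sim\gamma'$ if and only if $\mathrm{im}(\gamma')\subset\mathsf{X}$; (S2) any two points $x,y$ of a pixel $\mathsf{X}$ are joined by a finite walk $\gamma_0\cdot\gamma_1^{-1}\cdot\gamma_2\cdots\gamma_{2n-1}^{-1}\cdot\gamma_{2n}$ from $x$ to $y$ (where $\gamma^{-1}$ is $\gamma$ run backwards) with all $\gamma_i\in\Gamma$ and $\mathrm{im}(\gamma_i)\subset\mathsf{X}$; (S3) if $\rho,\gamma\in\Gamma$, $\rho(0)=\gamma(0)$ and $\mathrm{im}(\rho)$ lies in a pixel, then there are $\rho',\gamma'\in\Gamma$ with $\mathrm{im}(\rho')$ in a pixel and $\gamma\cdot\rho'\sim\rho\cdot\gamma'$; dually, if $\rho',\gamma'\in\Gamma$, $\rho'(1)=\gamma'(1)$ and $\mathrm{im}(\rho')$ lies in a pixel, then there are $\rho,\gamma\in\Gamma$ with $\mathrm{im}(\rho)$ in a pixel and $\gamma\cdot\rho'\sim\rho\cdot\gamma'$; (S4) for every $\gamma\in\Gamma$ there are a finite partition $\{I_i\}_{i=1}^n$ of $[0,1]$ into subintervals (listed in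 increasing order) and pixels $(\mathsf{X}_1,\dots,\mathsf{X}_n)$ with $\gamma(I_i)\subset\mathsf{X}_i$, where for $i\ne j$ the equality $\mathsf{X}_i=\mathsf{X}_j$ is allowed only if $|i-j|>1$; (S5) if $\gamma,\gamma'\in\Gamma$ have the same start and the same end and admit the same partition $\{I_i\}$ and the same list of pixels as in (S4), then $\gamma\sim\gamma'$. PATH CATEGORY. The path category $C$ of $(\mathbb{X},\Gamma/{\sim})$ has objects the points of $\mathbb{X}$, $\mathrm{Hom}_C(x,y)=\{[\gamma]\mid\gamma\in\Gamma,\ \gamma(0)=x,\ \gamma(1)=y\}$, and composition $[\gamma']\circ[\gamma]=[\gamma\cdot\gamma']$; identities are classes of constant paths. PIXELATION. $\Sigma_{\mathfrak{P}}$ is the class of morphisms $[\rho]$ of $C$ with $\mathrm{im}(\rho)$ contained in some pixel of $\mathfrak{P}$; it admits a (two-sided) calculus of fractions, and the localization $C[\Sigma_{\mathfrak{P}}^{-1}]$ is called the pixelation of $C$. THE CATEGORY $\overline{Q(C,\mathfrak{P})}$. Choose a point $s_{\mathsf{X}}\in\mathsf{X}$ in each pixel. A pseudo arrow is a morphism $[\rho]^{-1}[\gamma]$ of $C[\Sigma_{\mathfrak{P}}^{-1}]$ with $[\rho]\in\Sigma_{\mathfrak{P}}$ such that $\gamma$ has a partition as in (S4) with exactly two elements. $Q(C,\mathfrak{P})$ is the quiver with vertex set $\mathfrak{P}$ whose arrows $\mathsf{X}\to\mathsf{Y}$ are the pseudo arrows $s_{\mathsf{X}}\to s_{\mathsf{Y}}$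 (there is at most one). Let $\Psi$ be the functor from the free category on $Q(C,\mathfrak{P})$ to $C[\Sigma_{\mathfrak{P}}^{-1}]$ with $\mathsf{X}\mapsto s_{\mathsf{X}}$ sending each arrow to its pseudo arrow. $\overline{Q(C,\mathfrak{P})}$ is the quotient of this free category (same objects) in which parallel morphisms $f,g$ are identified when $\Psi(f)=\Psi(g)$. *)

theory Defs
  imports "HOL-Analysis.Analysis" "HOL-Library.Disjoint_Sets"
begin

section \<open>Categories\<close>

record ('o, 'm) cat =
  Obj :: "'o set"
  Mor :: "'m set"
  Dom :: "'m \<Rightarrow> 'o"
  Cod :: "'m \<Rightarrow> 'o"
  Ident :: "'o \<Rightarrow> 'm"
  Comp :: "'m \<Rightarrow> 'm \<Rightarrow> 'm"  \<comment> \<open>\<open>Comp C g f\<close> is \<open>g \<circ> f\<close>, i.e. \<open>f\<close> first\<close>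

locale category =
  fixes C :: "('o, 'm) cat"
  assumes Dom_in: "f \<in> Mor C \<Longrightarrow> Dom C f \<in> Obj C"
    and Cod_in: "f \<in> Mor C \<Longrightarrow> Cod C f \<in> Obj C"
    and Ident_in: "x \<in> Obj C \<Longrightarrow> Ident C x \<in> Mor C"
    and Dom_Ident: "x \<in> Obj C \<Longrightarrow> Dom C (Ident C x) = x"
    and Cod_Ident: "x \<in> Obj C \<Longrightarrow> Cod C (Ident C x) = x"
    and Comp_in: "\<lbrakk>f \<in> Mor C; g \<in> Mor C; Cod C f = Dom C g\<rbrakk> \<Longrightarrow> Comp C g f \<in> Mor C"
    and Dom_Comp: "\<lbrakk>f \<in> Mor C; g \<in> Mor C; Cod C f = Dom C g\<rbrakk> \<Longrightarrow> Dom C (Comp C g f) = Dom C f"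
    and Cod_Comp: "\<lbrakk>f \<in> Mor C; g \<in> Mor C; Cod C f = Dom C g\<rbrakk> \<Longrightarrow> Cod C (Comp C g f) = Cod C g"
    and Comp_Ident_right: "f \<in> Mor C \<Longrightarrow> Comp C f (Ident C (Dom C f)) = f"
    and Comp_Ident_left: "f \<in> Mor C \<Longrightarrow> Comp C (Ident C (Cod C f)) f = f"
    and Comp_assoc: "\<lbrakk>f \<in> Mor C; g \<in> Mor C; h \<in> Mor C; Cod C f = Dom C g; Cod C g = Dom C h\<rbrakk>
        \<Longrightarrow> Comp C h (Comp C g f) = Comp C (Comp C h g) f"

definition Hom :: "('o, 'm) cat \<Rightarrow> 'o \<Rightarrow> 'o \<Rightarrow> 'm set" where
  "Hom C x y = {f \<in> Mor C. Dom C f = x \<and> Cod C f = y}"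

definition is_iso :: "('o, 'm) cat \<Rightarrow> 'm \<Rightarrow> bool" where
  "is_iso C f \<longleftrightarrow> f \<in> Mor C \<and>
     (\<exists>g \<in> Hom C (Cod C f) (Dom C f).
        Comp C g f = Ident C (Dom C f) \<and> Comp C f g = Ident C (Cod C f))"

definition is_functor ::
  "('o, 'm) cat \<Rightarrow> ('p, 'n) cat \<Rightarrow> ('o \<Rightarrow> 'p) \<Rightarrow> ('m \<Rightarrow> 'n) \<Rightarrow> bool" where
  "is_functor C D Fo Fm \<longleftrightarrow> category C \<and> category D \<and>
     (\<forall>x \<in> Obj C. Fo x \<in> Obj D) \<and>
     (\<forall>f \<in> Mor C. Fm f \<in> Hom D (Fo (Dom C f)) (Fo (Cod C f))) \<and>
     (\<forall>x \<in> Obj C. Fm (Ident C x) = Ident D (Fo x)) \<and>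
     (\<forall>f \<in> Mor C. \<forall>g \<in> Mor C. Cod C f = Dom C g \<longrightarrow> Fm (Comp C g f) = Comp D (Fm g) (Fm f))"

definition isomorphic_cats :: "('o, 'm) cat \<Rightarrow> ('p, 'n) cat \<Rightarrow> bool" where
  "isomorphic_cats C D \<longleftrightarrow> (\<exists>Fo Fm Go Gm.
     is_functor C D Fo Fm \<and> is_functor D C Go Gm \<and>
     (\<forall>x \<in> Obj C. Go (Fo x) = x) \<and> (\<forall>f \<in> Mor C. Gm (Fm f) = f) \<and>
     (\<forall>y \<in> Obj D. Fo (Go y) = y) \<and> (\<forall>g \<in> Mor D. Fm (Gm g) = g))"

definition naturally_isomorphic ::
  "('o, 'm) cat \<Rightarrow> ('p, 'n) cat \<Rightarrow> ('o \<Rightarrow> 'p) \<Rightarrow> ('m \<Rightarrow> 'n) \<Rightarrow> ('o \<Rightarrow> 'p) \<Rightarrow> ('m \<Rightarrow> 'n) \<Rightarrow> bool" where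
  "naturally_isomorphic C D Fo Fm Go Gm \<longleftrightarrow> (\<exists>\<eta>.
     (\<forall>x \<in> Obj C. \<eta> x \<in> Hom D (Fo x) (Go x) \<and> is_iso D (\<eta> x)) \<and>
     (\<forall>f \<in> Mor C. Comp D (\<eta> (Cod C f)) (Fm f) = Comp D (Gm f) (\<eta> (Dom C f))))"

definition equivalent_cats :: "('o, 'm) cat \<Rightarrow> ('p, 'n) cat \<Rightarrow> bool" where
  "equivalent_cats C D \<longleftrightarrow> (\<exists>Fo Fm Go Gm.
     is_functor C D Fo Fm \<and> is_functor D C Go Gm \<and>
     naturally_isomorphic C C (Go \<circ> Fo) (Gm \<circ> Fm) id id \<and>
     naturally_isomorphic D D (Fo \<circ> Go) (Fm \<circ> Gm) id id)"


subsection \<open>Quotients\<close>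

text \<open>
  The relation \<open>r\<close> is meant to be an equivalence relation on \<open>Mor C\<close> that relates only parallel
  morphisms and is compatible with composition; then all composites of representatives of two
  composable classes lie in a single class, which is the one returned by \<open>Comp\<close>. The structure
  \<open>C\<close> need not be a category itself: its composition may be unital and associative only up
  to \<open>r\<close>.
\<close>

definition quot_cat :: "('o, 'm) cat \<Rightarrow> ('m \<times> 'm) set \<Rightarrow> ('o, 'm set) cat" where
  "quot_cat C r =
     \<lparr>Obj = Obj C,
      Mor = Mor C // r,
      Dom = (\<lambda>c. Dom C (SOME f. f \<in> c)),
      Cod = (\<lambda>c. Cod C (SOME f. f \<in> c)),
      Ident = (\<lambda>x. r `` {Ident C x}),
      Comp = (\<lambda>d c. r `` {Comp C g f | f g. f \<in> c \<and> g \<in> d})\<rparr>"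

text \<open>The smallest congruence on the category \<open>C\<close> that contains \<open>r\<close>.\<close>

inductive_set gen_cong :: "('o, 'm) cat \<Rightarrow> ('m \<times> 'm) set \<Rightarrow> ('m \<times> 'm) set"
  for C :: "('o, 'm) cat" and r :: "('m \<times> 'm) set" where
  base: "(f, g) \<in> r \<Longrightarrow> (f, g) \<in> gen_cong C r"
| refl: "f \<in> Mor C \<Longrightarrow> (f, f) \<in> gen_cong C r"
| sym: "(f, g) \<in> gen_cong C r \<Longrightarrow> (g, f) \<in> gen_cong C r"
| trans: "(f, g) \<in> gen_cong C r \<Longrightarrow> (g, h) \<in> gen_cong C r \<Longrightarrow> (f, h) \<in> gen_cong C r"
| comp: "(f, f') \<in> gen_cong C r \<Longrightarrow> (g, g') \<in> gen_cong C r \<Longrightarrow> Cod C f = Dom C g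
    \<Longrightarrow> (Comp C g f, Comp C g' f') \<in> gen_cong C r"


subsection \<open>Quivers and free categories\<close>

record ('v, 'e) quiver =
  Verts :: "'v set"
  Arrs :: "'e set"
  Src :: "'e \<Rightarrow> 'v"
  Tgt :: "'e \<Rightarrow> 'v"

fun is_walk :: "('v, 'e) quiver \<Rightarrow> 'v \<Rightarrow> 'e list \<Rightarrow> 'v \<Rightarrow> bool" where
  "is_walk Q x [] y \<longleftrightarrow> x \<in> Verts Q \<and> x = y"
| "is_walk Q x (e # es) y \<longleftrightarrow>
     x \<in> Verts Q \<and> e \<in> Arrs Q \<and> Src Q e = x \<and> is_walk Q (Tgt Q e) es y"

text \<open>A morphism \<open>(x, es, y)\<close> lists its arrows in the order in which they are traversed.\<close>

definition free_cat :: "('v, 'e) quiver \<Rightarrow> ('v, 'v \<times> 'e list \<times> 'v) cat" where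
  "free_cat Q =
     \<lparr>Obj = Verts Q,
      Mor = {(x, es, y). is_walk Q x es y},
      Dom = (\<lambda>(x, es, y). x),
      Cod = (\<lambda>(x, es, y). y),
      Ident = (\<lambda>x. (x, [], x)),
      Comp = (\<lambda>(y', fs, z) (x, es, y). (x, es @ fs, z))\<rparr>"

text \<open>
  The action on morphisms of the functor from the free category on \<open>Q\<close> to \<open>D\<close> that extends
  \<open>Fo\<close> on vertices and \<open>Fa\<close> on arrows.
\<close>

fun free_extension ::
  "('v, 'e) quiver \<Rightarrow> ('o, 'm) cat \<Rightarrow> ('v \<Rightarrow> 'o) \<Rightarrow> ('e \<Rightarrow> 'm) \<Rightarrow> 'v \<times> 'e list \<times> 'v \<Rightarrow> 'm" where
  "free_extension Q D Fo Fa (x, [], y) = Ident D (Fo x)"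
| "free_extension Q D Fo Fa (x, e # es, y) =
     Comp D (free_extension Q D Fo Fa (Tgt Q e, es, y)) (Fa e)"


subsection \<open>Localization\<close>

text \<open>
  The localization of \<open>C\<close> at \<open>S\<close> in the construction of Gabriel and Zisman: the free category on
  the arrows of \<open>C\<close> and formal inverses of the arrows in \<open>S\<close>, modulo the relations that make the
  inclusion of \<open>C\<close> functorial and the formal inverses inverse to the elements of \<open>S\<close>.
\<close>

datatype 'm zig = Fwd 'm | Bwd 'm

definition zigzag_quiver :: "('o, 'm) cat \<Rightarrow> 'm set \<Rightarrow> ('o, 'm zig) quiver" where
  "zigzag_quiver C S =
     \<lparr>Verts = Obj C,
      Arrs = Fwd ` Mor C \<union> Bwd ` S,
      Src = case_zig (Dom C) (Cod C),
      Tgt = case_zig (Cod C) (Dom C)\<rparr>"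

definition zigzag_rels ::
  "('o, 'm) cat \<Rightarrow> 'm set \<Rightarrow> (('o \<times> 'm zig list \<times> 'o) \<times> ('o \<times> 'm zig list \<times> 'o)) set" where
  "zigzag_rels C S =
     {((x, [Fwd (Ident C x)], x), (x, [], x)) | x. x \<in> Obj C} \<union>
     {((Dom C f, [Fwd f, Fwd g], Cod C g), (Dom C f, [Fwd (Comp C g f)], Cod C g)) | f g.
        f \<in> Mor C \<and> g \<in> Mor C \<and> Cod C f = Dom C g} \<union>
     {((Dom C s, [Fwd s, Bwd s], Dom C s), (Dom C s, [], Dom C s)) | s. s \<in> S} \<union>
     {((Cod C s, [Bwd s, Fwd s], Cod C s), (Cod C s, [], Cod C s)) | s. s \<in> S}"

definition zigzag_cong ::
  "('o, 'm) cat \<Rightarrow> 'm set \<Rightarrow> (('o \<times> 'm zig list \<times> 'o) \<times> ('o \<times> 'm zig list \<times> 'o)) set" where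
  "zigzag_cong C S = gen_cong (free_cat (zigzag_quiver C S)) (zigzag_rels C S)"

definition localization ::
  "('o, 'm) cat \<Rightarrow> 'm set \<Rightarrow> ('o, ('o \<times> 'm zig list \<times> 'o) set) cat" where
  "localization C S = quot_cat (free_cat (zigzag_quiver C S)) (zigzag_cong C S)"

definition loc_mor :: "('o, 'm) cat \<Rightarrow> 'm set \<Rightarrow> 'm \<Rightarrow> ('o \<times> 'm zig list \<times> 'o) set" where
  "loc_mor C S f = zigzag_cong C S `` {(Dom C f, [Fwd f], Cod C f)}"

definition loc_inv :: "('o, 'm) cat \<Rightarrow> 'm set \<Rightarrow> 'm \<Rightarrow> ('o \<times> 'm zig list \<times> 'o) set" where
  "loc_inv C S s = zigzag_cong C S `` {(Cod C s, [Bwd s], Dom C s)}"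


section \<open>Triples and path categories\<close>

text \<open>
  A path in \<open>X\<close> is an element of \<open>{0..1} \<rightarrow>\<^sub>E X\<close>, so that paths are equal iff they agree on the
  unit interval. No continuity is involved.
\<close>

definition path_join :: "(real \<Rightarrow> 'a) \<Rightarrow> (real \<Rightarrow> 'a) \<Rightarrow> (real \<Rightarrow> 'a)"  (infixl "\<cdot>" 75) where
  "\<gamma> \<cdot> \<gamma>' = (\<lambda>t \<in> {0..1}. if t \<le> 1/2 then \<gamma> (2 * t) else \<gamma>' (2 * t - 1))"

definition const_path :: "'a \<Rightarrow> real \<Rightarrow> 'a" where
  "const_path x = (\<lambda>t \<in> {0..1}. x)"

abbreviation im :: "(real \<Rightarrow> 'a) \<Rightarrow> 'a set" where
  "im \<gamma> \<equiv> \<gamma> ` {0..1}"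

text \<open>Intervals may be open, half-open, closed or single points.\<close>

definition reparam :: "(real \<Rightarrow> real) \<Rightarrow> bool" where
  "reparam \<phi> \<longleftrightarrow> \<phi> \<in> {0..1} \<rightarrow> {0..1} \<and> mono_on {0..1} \<phi> \<and>
     (\<forall>I \<subseteq> {0..1}. is_interval I \<longrightarrow> is_interval (\<phi> ` I))"

text \<open>
  The bracketing of the triple joins in the last axiom is immaterial, because of the first axiom
  on reparametrization.
\<close>

locale triple =
  fixes X :: "'a set" and \<Gamma> :: "(real \<Rightarrow> 'a) set" and R :: "((real \<Rightarrow> 'a) \<times> (real \<Rightarrow> 'a)) set"
  assumes nonempty: "X \<noteq> {}"
    and paths: "\<Gamma> \<subseteq> {0..1} \<rightarrow>\<^sub>E X"
    and equiv: "equiv \<Gamma> R"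
    and endpoints: "(\<gamma>, \<gamma>') \<in> R \<Longrightarrow> \<gamma> 0 = \<gamma>' 0 \<and> \<gamma> 1 = \<gamma>' 1"
    and join: "\<lbrakk>\<gamma> \<in> \<Gamma>; \<gamma>' \<in> \<Gamma>; \<gamma> 1 = \<gamma>' 0\<rbrakk> \<Longrightarrow> \<gamma> \<cdot> \<gamma>' \<in> \<Gamma>"
    and reparam: "\<lbrakk>\<gamma> \<in> \<Gamma>; reparam \<phi>\<rbrakk> \<Longrightarrow> compose {0..1} \<gamma> \<phi> \<in> \<Gamma>"
    and const: "x \<in> X \<Longrightarrow> const_path x \<in> \<Gamma>"
    and equiv_const: "\<lbrakk>(\<gamma>, const_path x) \<in> R; x \<in> X\<rbrakk> \<Longrightarrow> \<exists>y \<in> X. \<gamma> = const_path y"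
    and equiv_reparam: "\<lbrakk>\<gamma> \<in> \<Gamma>; reparam \<phi>; \<phi> 0 = 0; \<phi> 1 = 1\<rbrakk>
        \<Longrightarrow> (\<gamma>, compose {0..1} \<gamma> \<phi>) \<in> R"
    and cancel: "\<lbrakk>\<gamma> \<in> \<Gamma>; \<gamma>' \<in> \<Gamma>; \<rho> \<in> \<Gamma>; \<rho>' \<in> \<Gamma>;
        \<rho> 1 = \<gamma> 0; \<gamma> 1 = \<rho>' 0; \<rho> 1 = \<gamma>' 0; \<gamma>' 1 = \<rho>' 0;
        \<rho> \<cdot> \<gamma> \<cdot> \<rho>' \<in> \<Gamma>; \<rho> \<cdot> \<gamma>' \<cdot> \<rho>' \<in> \<Gamma>\<rbrakk>
        \<Longrightarrow> (\<gamma>, \<gamma>') \<in> R \<longleftrightarrow> (\<rho> \<cdot> \<gamma> \<cdot> \<rho>', \<rho> \<cdot> \<gamma>' \<cdot> \<rho>') \<in> R"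

text \<open>Joining paths is unital and associative only up to equivalence.\<close>

definition path_structure :: "'a set \<Rightarrow> (real \<Rightarrow> 'a) set \<Rightarrow> ('a, real \<Rightarrow> 'a) cat" where
  "path_structure X \<Gamma> =
     \<lparr>Obj = X, Mor = \<Gamma>, Dom = (\<lambda>\<gamma>. \<gamma> 0), Cod = (\<lambda>\<gamma>. \<gamma> 1),
      Ident = const_path, Comp = (\<lambda>\<gamma>' \<gamma>. \<gamma> \<cdot> \<gamma>')\<rparr>"

definition path_cat :: "'a set \<Rightarrow> (real \<Rightarrow> 'a) set \<Rightarrow> ((real \<Rightarrow> 'a) \<times> (real \<Rightarrow> 'a)) set
    \<Rightarrow> ('a, (real \<Rightarrow> 'a) set) cat" where
  "path_cat X \<Gamma> R = quot_cat (path_structure X \<Gamma>) R"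


section \<open>Screens and pixelations\<close>

text \<open>
  \<open>Is\<close> is a finite partition of the unit interval into nonempty subintervals, listed in increasing
  order, and \<open>Xs\<close> is a corresponding list of pixels.
\<close>

definition pixel_partition ::
  "'a set set \<Rightarrow> (real \<Rightarrow> 'a) \<Rightarrow> real set list \<Rightarrow> 'a set list \<Rightarrow> bool" where
  "pixel_partition P \<gamma> Is Xs \<longleftrightarrow>
     (\<forall>I \<in> set Is. is_interval I \<and> I \<noteq> {}) \<and> \<Union>(set Is) = {0..1} \<and>
     sorted_wrt (\<lambda>I J. \<forall>s \<in> I. \<forall>t \<in> J. s < t) Is \<and>
     set Xs \<subseteq> P \<and> list_all2 (\<lambda>I Y. \<gamma> ` I \<subseteq> Y) Is Xs \<and>
     (\<forall>i < length Xs. \<forall>j < length Xs. i \<noteq> j \<longrightarrow> Xs ! i = Xs ! j \<longrightarrow> \<bar>int i - int j\<bar> > 1)"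

locale screen = triple X \<Gamma> R
  for X :: "'a set" and \<Gamma> :: "(real \<Rightarrow> 'a) set" and R :: "((real \<Rightarrow> 'a) \<times> (real \<Rightarrow> 'a)) set" +
  fixes P :: "'a set set"
  assumes partition: "partition_on X P"
    and S1: "\<lbrakk>\<gamma> \<in> \<Gamma>; \<gamma>' \<in> \<Gamma>; \<gamma> 0 = \<gamma>' 0; \<gamma> 1 = \<gamma>' 1; Y \<in> P; im \<gamma> \<subseteq> Y\<rbrakk>
        \<Longrightarrow> (\<gamma>, \<gamma>') \<in> R \<longleftrightarrow> im \<gamma>' \<subseteq> Y"
    and S2: "\<lbrakk>Y \<in> P; x \<in> Y; y \<in> Y\<rbrakk> \<Longrightarrow>
        \<exists>n \<gamma>. (\<forall>i \<le> 2 * n. \<gamma> i \<in> \<Gamma> \<and> im (\<gamma> i) \<subseteq> Y) \<and>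
          \<gamma> 0 0 = x \<and> \<gamma> (2 * n) 1 = y \<and>
          (\<forall>i < 2 * n. if even i then \<gamma> i 1 = \<gamma> (Suc i) 1 else \<gamma> i 0 = \<gamma> (Suc i) 0)"
    and S3: "\<lbrakk>\<rho> \<in> \<Gamma>; \<gamma> \<in> \<Gamma>; \<rho> 0 = \<gamma> 0; \<exists>Y \<in> P. im \<rho> \<subseteq> Y\<rbrakk> \<Longrightarrow>
        \<exists>\<rho>' \<in> \<Gamma>. \<exists>\<gamma>' \<in> \<Gamma>. (\<exists>Y \<in> P. im \<rho>' \<subseteq> Y) \<and>
          \<gamma> 1 = \<rho>' 0 \<and> \<rho> 1 = \<gamma>' 0 \<and> (\<gamma> \<cdot> \<rho>', \<rho> \<cdot> \<gamma>') \<in> R"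
    and S3_dual: "\<lbrakk>\<rho>' \<in> \<Gamma>; \<gamma>' \<in> \<Gamma>; \<rho>' 1 = \<gamma>' 1; \<exists>Y \<in> P. im \<rho>' \<subseteq> Y\<rbrakk> \<Longrightarrow>
        \<exists>\<rho> \<in> \<Gamma>. \<exists>\<gamma> \<in> \<Gamma>. (\<exists>Y \<in> P. im \<rho> \<subseteq> Y) \<and>
          \<gamma> 1 = \<rho>' 0 \<and> \<rho> 1 = \<gamma>' 0 \<and> (\<gamma> \<cdot> \<rho>', \<rho> \<cdot> \<gamma>') \<in> R"
    and S4: "\<gamma> \<in> \<Gamma> \<Longrightarrow> \<exists>Is Xs. pixel_partition P \<gamma> Is Xs"
    and S5: "\<lbrakk>\<gamma> \<in> \<Gamma>; \<gamma>' \<in> \<Gamma>; \<gamma> 0 = \<gamma>' 0; \<gamma> 1 = \<gamma>' 1;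
        pixel_partition P \<gamma> Is Xs; pixel_partition P \<gamma>' Is Xs\<rbrakk> \<Longrightarrow> (\<gamma>, \<gamma>') \<in> R"

definition pixel_mors :: "(real \<Rightarrow> 'a) set \<Rightarrow> ((real \<Rightarrow> 'a) \<times> (real \<Rightarrow> 'a)) set \<Rightarrow> 'a set set
    \<Rightarrow> (real \<Rightarrow> 'a) set set" where
  "pixel_mors \<Gamma> R P = {R `` {\<rho>} | \<rho>. \<rho> \<in> \<Gamma> \<and> (\<exists>Y \<in> P. im \<rho> \<subseteq> Y)}"

type_synonym 'a pixelation_mor = "('a \<times> (real \<Rightarrow> 'a) set zig list \<times> 'a) set"

definition pixelation ::
  "'a set \<Rightarrow> (real \<Rightarrow> 'a) set \<Rightarrow> ((real \<Rightarrow> 'a) \<times> (real \<Rightarrow> 'a)) set \<Rightarrow> 'a set set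
    \<Rightarrow> ('a, 'a pixelation_mor) cat" where
  "pixelation X \<Gamma> R P = localization (path_cat X \<Gamma> R) (pixel_mors \<Gamma> R P)"

definition pseudo_arrows ::
  "'a set \<Rightarrow> (real \<Rightarrow> 'a) set \<Rightarrow> ((real \<Rightarrow> 'a) \<times> (real \<Rightarrow> 'a)) set \<Rightarrow> 'a set set
    \<Rightarrow> 'a pixelation_mor set" where
  "pseudo_arrows X \<Gamma> R P =
     {Comp (pixelation X \<Gamma> R P)
        (loc_inv (path_cat X \<Gamma> R) (pixel_mors \<Gamma> R P) (R `` {\<rho>}))
        (loc_mor (path_cat X \<Gamma> R) (pixel_mors \<Gamma> R P) (R `` {\<gamma>})) | \<rho> \<gamma>.
      \<rho> \<in> \<Gamma> \<and> \<gamma> \<in> \<Gamma> \<and> \<rho> 1 = \<gamma> 1 \<and> R `` {\<rho>} \<in> pixel_mors \<Gamma> R P \<and>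
      (\<exists>Is Xs. pixel_partition P \<gamma> Is Xs \<and> length Is = 2)}"

text \<open>
  The function \<open>s\<close> chooses a point in each pixel. An arrow from \<open>Y\<close> to \<open>Z\<close> is a pseudo arrow
  from \<open>s Y\<close> to \<open>s Z\<close>, stored together with \<open>Y\<close> and \<open>Z\<close>.
\<close>

definition pixel_quiver ::
  "'a set \<Rightarrow> (real \<Rightarrow> 'a) set \<Rightarrow> ((real \<Rightarrow> 'a) \<times> (real \<Rightarrow> 'a)) set \<Rightarrow> 'a set set \<Rightarrow> ('a set \<Rightarrow> 'a)
    \<Rightarrow> ('a set, 'a set \<times> 'a pixelation_mor \<times> 'a set) quiver" where
  "pixel_quiver X \<Gamma> R P s =
     \<lparr>Verts = P,
      Arrs = {(Y, m, Z). Y \<in> P \<and> Z \<in> P \<and>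
                m \<in> pseudo_arrows X \<Gamma> R P \<and> m \<in> Hom (pixelation X \<Gamma> R P) (s Y) (s Z)},
      Src = (\<lambda>(Y, m, Z). Y),
      Tgt = (\<lambda>(Y, m, Z). Z)\<rparr>"

text \<open>The action of the functor \<open>\<Psi>\<close> on morphisms; on objects it is \<open>s\<close>.\<close>

definition Psi ::
  "'a set \<Rightarrow> (real \<Rightarrow> 'a) set \<Rightarrow> ((real \<Rightarrow> 'a) \<times> (real \<Rightarrow> 'a)) set \<Rightarrow> 'a set set \<Rightarrow> ('a set \<Rightarrow> 'a)
    \<Rightarrow> 'a set \<times> ('a set \<times> 'a pixelation_mor \<times> 'a set) list \<times> 'a set \<Rightarrow> 'a pixelation_mor" where
  "Psi X \<Gamma> R P s =
     free_extension (pixel_quiver X \<Gamma> R P s) (pixelation X \<Gamma> R P) s (\<lambda>(Y, m, Z). m)"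

definition Psi_kernel ::
  "'a set \<Rightarrow> (real \<Rightarrow> 'a) set \<Rightarrow> ((real \<Rightarrow> 'a) \<times> (real \<Rightarrow> 'a)) set \<Rightarrow> 'a set set \<Rightarrow> ('a set \<Rightarrow> 'a)
    \<Rightarrow> (('a set \<times> ('a set \<times> 'a pixelation_mor \<times> 'a set) list \<times> 'a set) \<times>
       ('a set \<times> ('a set \<times> 'a pixelation_mor \<times> 'a set) list \<times> 'a set)) set" where
  "Psi_kernel X \<Gamma> R P s =
     (let F = free_cat (pixel_quiver X \<Gamma> R P s) in
      {(f, g). f \<in> Mor F \<and> g \<in> Mor F \<and> Dom F f = Dom F g \<and> Cod F f = Cod F g \<and>
         Psi X \<Gamma> R P s f = Psi X \<Gamma> R P s g})"

definition Q_bar ::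
  "'a set \<Rightarrow> (real \<Rightarrow> 'a) set \<Rightarrow> ((real \<Rightarrow> 'a) \<times> (real \<Rightarrow> 'a)) set \<Rightarrow> 'a set set \<Rightarrow> ('a set \<Rightarrow> 'a)
    \<Rightarrow> ('a set, ('a set \<times> ('a set \<times> 'a pixelation_mor \<times> 'a set) list \<times> 'a set) set) cat" where
  "Q_bar X \<Gamma> R P s = quot_cat (free_cat (pixel_quiver X \<Gamma> R P s)) (Psi_kernel X \<Gamma> R P s)"

end

theory Submission
  imports Defs
begin

text \<open>
  Let \<open>D\<close> be the localization. The pixel morphisms \<open>\<Sigma>\<close> satisfy a calculus of fractions, they are
  thin, and a composite in \<open>\<Sigma>\<close> has its factors in \<open>\<Sigma>\<close>; moreover the path category is cancellative.
  Hence it embeds into \<open>D\<close>, any two points of a pixel are canonically isomorphic in \<open>D\<close>, and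
  conjugating with these isomorphisms turns every path \<open>\<gamma>\<close> into a morphism between chosen points.
  By (S5) this morphism depends only on the sequence of pixels, that is, on the composite
  of \<open>\<gamma>\<close> with the projection \<open>\<pi>\<close> to the set of pixels; it is monic and epic, and it has a
  left inverse only if \<open>\<gamma>\<close> stays in one pixel. So for a set \<open>G\<close> of paths closed under
  reparametrization, the functions into the set of pixels that are piecewise of the form \<open>\<pi> \<circ> \<gamma>\<close>
  with \<open>\<gamma> \<in> G\<close> evaluate to morphisms of \<open>D\<close>, and they form a triple when those with equal value
  are identified.

  Taking all paths for \<open>G\<close> gives the pixelation, and taking the paths in a pixel or with two pieces
  that give pseudo arrows gives \<open>Q_bar\<close>. These two triples differ in general: a two-piece path between
  two pixels need not give a pseudo arrow between their chosen points, so the inclusion of \<open>Q_bar\<close>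
  into the pixelation need not be full. There may also be two pseudo arrows between the same points,
  according to which of the two pieces is closed at the cut; they are then distinguished by
  different functions into the set of pixels.
\<close>

section \<open>Quotients of categories\<close>

text \<open>The localization is presented by zigzags, so equality of two of its morphisms yields
  only a chain of rewritings. Faithfulness of the path category in it therefore needs an invariant
  of zigzags. Relations on morphisms of the path category serve, because a formal inverse can act by
  the same relation as the pixel morphism that it inverts. From then on, left fractions turn
  questions about the localization into equations between paths, where the axiom
  \<open>cancel\<close> applies. Two paths that end and start in a common pixel need not meet, so
  nothing makes the join of their projections the projection of a path; hence the functions that are
  only piecewise projections. Their values are well defined because two subdivisions can be cut
  against each other. In the new triple, monic and epic values give \<open>cancel\<close>, and the
  statement on left inverses gives \<open>equiv_const\<close>.\<close>

locale precategory =
  fixes S :: "('o, 'm) cat"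
  assumes pre_Dom_in: "f \<in> Mor S \<Longrightarrow> Dom S f \<in> Obj S"
    and pre_Cod_in: "f \<in> Mor S \<Longrightarrow> Cod S f \<in> Obj S"
    and pre_Ident_in: "x \<in> Obj S \<Longrightarrow> Ident S x \<in> Mor S"
    and pre_Dom_Ident: "x \<in> Obj S \<Longrightarrow> Dom S (Ident S x) = x"
    and pre_Cod_Ident: "x \<in> Obj S \<Longrightarrow> Cod S (Ident S x) = x"
    and pre_Comp_in: "\<lbrakk>f \<in> Mor S; g \<in> Mor S; Cod S f = Dom S g\<rbrakk> \<Longrightarrow> Comp S g f \<in> Mor S"
    and pre_Dom_Comp: "\<lbrakk>f \<in> Mor S; g \<in> Mor S; Cod S f = Dom S g\<rbrakk> \<Longrightarrow> Dom S (Comp S g f) = Dom S f"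
    and pre_Cod_Comp: "\<lbrakk>f \<in> Mor S; g \<in> Mor S; Cod S f = Dom S g\<rbrakk> \<Longrightarrow> Cod S (Comp S g f) = Cod S g"

text \<open>Joins of paths are unital and associative only up to equivalence, so
  \<open>precategory\<close> omits these laws and they are imposed here modulo \<open>r\<close>.
  Path structures and free categories are both instances.\<close>

locale congruence = precategory S for S :: "('o, 'm) cat" +
  fixes r :: "('m \<times> 'm) set"
  assumes equiv_r: "equiv (Mor S) r"
    and par: "(f, g) \<in> r \<Longrightarrow> Dom S f = Dom S g \<and> Cod S f = Cod S g"
    and cong: "\<lbrakk>(f, f') \<in> r; (g, g') \<in> r; Cod S f = Dom S g\<rbrakk> \<Longrightarrow> (Comp S g f, Comp S g' f') \<in> r"
    and unit_right: "f \<in> Mor S \<Longrightarrow> (Comp S f (Ident S (Dom S f)), f) \<in> r"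
    and unit_left: "f \<in> Mor S \<Longrightarrow> (Comp S (Ident S (Cod S f)) f, f) \<in> r"
    and assoc: "\<lbrakk>f \<in> Mor S; g \<in> Mor S; h \<in> Mor S; Cod S f = Dom S g; Cod S g = Dom S h\<rbrakk>
        \<Longrightarrow> (Comp S h (Comp S g f), Comp S (Comp S h g) f) \<in> r"
begin

lemma cls_self: "f \<in> Mor S \<Longrightarrow> f \<in> r `` {f}"
  using equiv_r by (rule equiv_class_self)

lemma cls_eq: "f \<in> Mor S \<Longrightarrow> g \<in> Mor S \<Longrightarrow> r `` {f} = r `` {g} \<longleftrightarrow> (f, g) \<in> r"
  using eq_equiv_class_iff[OF equiv_r] by blast

lemma cls_eqI: "(f, g) \<in> r \<Longrightarrow> r `` {f} = r `` {g}"
  using equiv_class_eq[OF equiv_r] by blast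

lemma rel_Mor: "(f, g) \<in> r \<Longrightarrow> f \<in> Mor S \<and> g \<in> Mor S"
  using equiv_r by (auto simp: equiv_def refl_on_def)

lemma rel_trans: "(f, g) \<in> r \<Longrightarrow> (g, h) \<in> r \<Longrightarrow> (f, h) \<in> r"
  using equiv_r by (meson equiv_def transD)

lemma Obj_quot [simp]: "Obj (quot_cat S r) = Obj S"
  by (simp add: quot_cat_def)

lemma Mor_quotI: "f \<in> Mor S \<Longrightarrow> r `` {f} \<in> Mor (quot_cat S r)"
  by (simp add: quot_cat_def quotientI)

lemma Mor_quotE:
  assumes "c \<in> Mor (quot_cat S r)"
  obtains f where "f \<in> Mor S" "c = r `` {f}"
  using assms by (auto simp: quot_cat_def elim: quotientE)

lemma some_in_cls: "f \<in> Mor S \<Longrightarrow> (f, SOME g. g \<in> r `` {f}) \<in> r"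
  using someI[of "\<lambda>g. g \<in> r `` {f}" f] cls_self by auto

lemma Dom_quot [simp]: "f \<in> Mor S \<Longrightarrow> Dom (quot_cat S r) (r `` {f}) = Dom S f"
  using par[OF some_in_cls] by (simp add: quot_cat_def)

lemma Cod_quot [simp]: "f \<in> Mor S \<Longrightarrow> Cod (quot_cat S r) (r `` {f}) = Cod S f"
  using par[OF some_in_cls] by (simp add: quot_cat_def)

lemma Ident_quot [simp]: "Ident (quot_cat S r) x = r `` {Ident S x}"
  by (simp add: quot_cat_def)

lemma Comp_quot:
  assumes "f \<in> Mor S" "g \<in> Mor S" "Cod S f = Dom S g"
  shows "Comp (quot_cat S r) (r `` {g}) (r `` {f}) = r `` {Comp S g f}"
proof -
  have "(Comp S g f, Comp S g' f') \<in> r" if "(f, f') \<in> r" "(g, g') \<in> r" for f' g'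
    using cong that assms(3) by blast
  then have "{Comp S g' f' | f' g'. f' \<in> r `` {f} \<and> g' \<in> r `` {g}} \<subseteq> r `` {Comp S g f}"
    by blast
  moreover have "Comp S g f \<in> {Comp S g' f' | f' g'. f' \<in> r `` {f} \<and> g' \<in> r `` {g}}"
    using cls_self assms by blast
  ultimately have "r `` {Comp S g' f' | f' g'. f' \<in> r `` {f} \<and> g' \<in> r `` {g}} = r `` {Comp S g f}"
    by (blast intro: rel_trans)
  then show ?thesis
    by (simp add: quot_cat_def)
qed

lemma category_quot: "category (quot_cat S r)"
proof
  fix f assume "f \<in> Mor (quot_cat S r)"
  then obtain f' where f': "f' \<in> Mor S" "f = r `` {f'}" by (rule Mor_quotE)
  show "Dom (quot_cat S r) f \<in> Obj (quot_cat S r)" "Cod (quot_cat S r) f \<in> Obj (quot_cat S r)"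
    using f' pre_Dom_in pre_Cod_in by simp_all
  show "Comp (quot_cat S r) f (Ident (quot_cat S r) (Dom (quot_cat S r) f)) = f"
    using f' cls_eqI[OF unit_right] by (simp add: Comp_quot pre_Dom_in pre_Ident_in pre_Cod_Ident)
  show "Comp (quot_cat S r) (Ident (quot_cat S r) (Cod (quot_cat S r) f)) f = f"
    using f' cls_eqI[OF unit_left] by (simp add: Comp_quot pre_Cod_in pre_Ident_in pre_Dom_Ident)
next
  fix x assume "x \<in> Obj (quot_cat S r)"
  then show "Ident (quot_cat S r) x \<in> Mor (quot_cat S r)"
    "Dom (quot_cat S r) (Ident (quot_cat S r) x) = x"
    "Cod (quot_cat S r) (Ident (quot_cat S r) x) = x"
    by (simp_all add: Mor_quotI pre_Ident_in pre_Dom_Ident pre_Cod_Ident)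
next
  fix f g
  assume fg: "f \<in> Mor (quot_cat S r)" "g \<in> Mor (quot_cat S r)"
    "Cod (quot_cat S r) f = Dom (quot_cat S r) g"
  obtain f' where f': "f' \<in> Mor S" "f = r `` {f'}" using fg(1) by (rule Mor_quotE)
  obtain g' where g': "g' \<in> Mor S" "g = r `` {g'}" using fg(2) by (rule Mor_quotE)
  have c: "Cod S f' = Dom S g'" using fg f' g' by simp
  show "Comp (quot_cat S r) g f \<in> Mor (quot_cat S r)"
    "Dom (quot_cat S r) (Comp (quot_cat S r) g f) = Dom (quot_cat S r) f"
    "Cod (quot_cat S r) (Comp (quot_cat S r) g f) = Cod (quot_cat S r) g"
    using f' g' c by (simp_all add: Comp_quot Mor_quotI pre_Comp_in pre_Dom_Comp pre_Cod_Comp)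
  fix h
  assume h: "h \<in> Mor (quot_cat S r)" "Cod (quot_cat S r) g = Dom (quot_cat S r) h"
  obtain h' where h': "h' \<in> Mor S" "h = r `` {h'}" using h(1) by (rule Mor_quotE)
  have "Cod S g' = Dom S h'" using h g' h' by simp
  then show "Comp (quot_cat S r) h (Comp (quot_cat S r) g f)
      = Comp (quot_cat S r) (Comp (quot_cat S r) h g) f"
    using f' g' h' c cls_eqI[OF assoc]
    by (simp add: Comp_quot pre_Comp_in pre_Dom_Comp pre_Cod_Comp)
qed

end

text \<open>\<open>Fo\<close> is not assumed injective, which is why \<open>kernel\<close> compares
  endpoints as well as values. The target \<open>D\<close> will be the pixelation, and
  \<open>S\<close> either a structure of step functions or a free category.\<close>

locale evaluation = precategory S + D: category D
  for S :: "('o, 'm) cat" and D :: "('p, 'n) cat" +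
  fixes Fo :: "'o \<Rightarrow> 'p" and ev :: "'m \<Rightarrow> 'n"
  assumes Fo_in: "x \<in> Obj S \<Longrightarrow> Fo x \<in> Obj D"
    and ev_in: "f \<in> Mor S \<Longrightarrow> ev f \<in> Hom D (Fo (Dom S f)) (Fo (Cod S f))"
    and ev_Ident: "x \<in> Obj S \<Longrightarrow> ev (Ident S x) = Ident D (Fo x)"
    and ev_Comp: "\<lbrakk>f \<in> Mor S; g \<in> Mor S; Cod S f = Dom S g\<rbrakk>
        \<Longrightarrow> ev (Comp S g f) = Comp D (ev g) (ev f)"
begin

definition kernel :: "('m \<times> 'm) set" where
  "kernel = {(f, g). f \<in> Mor S \<and> g \<in> Mor S \<and> Dom S f = Dom S g \<and> Cod S f = Cod S g \<and> ev f = ev g}"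

lemma ev_Mor: "f \<in> Mor S \<Longrightarrow> ev f \<in> Mor D"
  and Dom_ev: "f \<in> Mor S \<Longrightarrow> Dom D (ev f) = Fo (Dom S f)"
  and Cod_ev: "f \<in> Mor S \<Longrightarrow> Cod D (ev f) = Fo (Cod S f)"
  using ev_in by (auto simp: Hom_def)

text \<open>The laws that \<open>S\<close> may lack hold in \<open>D\<close> after evaluation, so
  both sides of each have the same value.\<close>

lemma congruence_kernel: "congruence S kernel"
proof
  show "equiv (Mor S) kernel"
    by (rule equivI) (auto simp: kernel_def refl_on_def sym_def trans_def)
next
  show "(Comp S f (Ident S (Dom S f)), f) \<in> kernel" if f: "f \<in> Mor S" for f
    using f D.Comp_Ident_right[of "ev f"]
    by (simp add: kernel_def pre_Dom_in pre_Ident_in pre_Dom_Ident pre_Cod_Ident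
        pre_Comp_in pre_Dom_Comp pre_Cod_Comp ev_Comp ev_Ident ev_Mor Dom_ev)
  show "(Comp S (Ident S (Cod S f)) f, f) \<in> kernel" if f: "f \<in> Mor S" for f
    using f D.Comp_Ident_left[of "ev f"]
    by (simp add: kernel_def pre_Cod_in pre_Ident_in pre_Dom_Ident pre_Cod_Ident
        pre_Comp_in pre_Dom_Comp pre_Cod_Comp ev_Comp ev_Ident ev_Mor Cod_ev)
  show "(Comp S h (Comp S g f), Comp S (Comp S h g) f) \<in> kernel"
    if "f \<in> Mor S" "g \<in> Mor S" "h \<in> Mor S" "Cod S f = Dom S g" "Cod S g = Dom S h" for f g h
    using that by (simp add: kernel_def pre_Comp_in pre_Dom_Comp pre_Cod_Comp ev_Comp ev_Mor
        Dom_ev Cod_ev D.Comp_assoc)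
  show "(Comp S g f, Comp S g' f') \<in> kernel"
    if "(f, f') \<in> kernel" "(g, g') \<in> kernel" "Cod S f = Dom S g" for f f' g g'
    using that by (simp add: kernel_def pre_Comp_in pre_Dom_Comp pre_Cod_Comp ev_Comp)
qed (simp add: kernel_def)

sublocale K: congruence S kernel
  by (rule congruence_kernel)

definition ev_cls :: "'m set \<Rightarrow> 'n" where
  "ev_cls c = ev (SOME f. f \<in> c)"

lemma ev_cls [simp]: "f \<in> Mor S \<Longrightarrow> ev_cls (kernel `` {f}) = ev f"
  using K.some_in_cls[of f] by (auto simp: ev_cls_def kernel_def)

lemma kernel_iff: "f \<in> Mor S \<Longrightarrow> g \<in> Mor S \<Longrightarrow> kernel `` {f} = kernel `` {g} \<longleftrightarrow>
    Dom S f = Dom S g \<and> Cod S f = Cod S g \<and> ev f = ev g"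
  by (simp add: K.cls_eq) (simp add: kernel_def)

end

text \<open>A class is determined by its endpoints and its value in \<open>D\<close>, so it can be
  sent to the class of anything with the same data. \<open>Fm\<close> enters through an equation
  rather than an existential, so that the second conclusion computes it and two such functors can be
  shown inverse to each other.\<close>

lemma functor_between_kernel_quotients:
  assumes "evaluation S D Fo ev" "evaluation S' D Fo ev'" "Obj S = Obj S'"
    and img: "\<forall>f \<in> Mor S.
      \<exists>f'. f' \<in> Mor S' \<and> Dom S' f' = Dom S f \<and> Cod S' f' = Cod S f \<and> ev' f' = ev f"
    and Fm: "Fm = (\<lambda>c. evaluation.kernel S' ev' `` {SOME f'. f' \<in> Mor S' \<and>
      Dom S' f' = Dom (quot_cat S (evaluation.kernel S ev)) c \<and>
      Cod S' f' = Cod (quot_cat S (evaluation.kernel S ev)) c \<and>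
      ev' f' = evaluation.ev_cls ev c})"
  shows "is_functor (quot_cat S (evaluation.kernel S ev)) (quot_cat S' (evaluation.kernel S' ev')) id Fm"
    and "\<And>f f'. \<lbrakk>f \<in> Mor S; f' \<in> Mor S'; Dom S' f' = Dom S f; Cod S' f' = Cod S f; ev' f' = ev f\<rbrakk>
      \<Longrightarrow> Fm (evaluation.kernel S ev `` {f}) = evaluation.kernel S' ev' `` {f'}"
proof -
  interpret E: evaluation S D Fo ev by fact
  interpret E': evaluation S' D Fo ev' by fact
  let ?p = "\<lambda>f f'. f' \<in> Mor S' \<and> Dom S' f' = Dom S f \<and> Cod S' f' = Cod S f \<and> ev' f' = ev f"
  have Fm_eq: "Fm (E.kernel `` {f}) = E'.kernel `` {SOME f'. ?p f f'}" if "f \<in> Mor S" for f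
    using that unfolding Fm by simp
  show cls: "Fm (E.kernel `` {f}) = E'.kernel `` {f'}"
    if "f \<in> Mor S" "f' \<in> Mor S'" "Dom S' f' = Dom S f" "Cod S' f' = Cod S f" "ev' f' = ev f" for f f'
  proof -
    have "?p f (SOME f'. ?p f f')" using that by (intro someI[of "?p f" f']) simp
    then show ?thesis using that by (simp add: Fm_eq E'.kernel_iff)
  qed
  let ?C = "quot_cat S E.kernel" and ?D = "quot_cat S' E'.kernel"
  show "is_functor ?C ?D id Fm"
    unfolding is_functor_def
  proof (intro conjI ballI impI)
    show "category ?C" "category ?D" by (rule E.K.category_quot, rule E'.K.category_quot)
    show "\<And>x. x \<in> Obj ?C \<Longrightarrow> id x \<in> Obj ?D" using assms(3) by simp
    show "Fm (Ident ?C x) = Ident ?D (id x)" if "x \<in> Obj ?C" for x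
      using that assms(3) cls[of "Ident S x" "Ident S' x"]
      by (simp add: E.pre_Ident_in E'.pre_Ident_in E.pre_Dom_Ident E'.pre_Dom_Ident E.pre_Cod_Ident
          E'.pre_Cod_Ident E.ev_Ident E'.ev_Ident)
  next
    fix c assume "c \<in> Mor ?C"
    then obtain f where f: "f \<in> Mor S" "c = E.kernel `` {f}" by (rule E.K.Mor_quotE)
    obtain f' where f': "?p f f'" using img f by blast
    then show "Fm c \<in> Hom ?D (id (Dom ?C c)) (id (Cod ?C c))"
      using f cls[of f f'] by (simp add: Hom_def E'.K.Mor_quotI)
    fix d assume d: "d \<in> Mor ?C" "Cod ?C c = Dom ?C d"
    then obtain g where g: "g \<in> Mor S" "d = E.kernel `` {g}" by (auto elim: E.K.Mor_quotE)
    obtain g' where g': "?p g g'" using img g by blast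
    have c: "Cod S f = Dom S g" using f g d by simp
    show "Fm (Comp ?C d c) = Comp ?D (Fm d) (Fm c)"
      using f g c f' g' cls[of f f'] cls[of g g'] cls[of "Comp S g f" "Comp S' g' f'"]
      by (simp add: E.K.Comp_quot E'.K.Comp_quot E.pre_Comp_in E'.pre_Comp_in E.pre_Dom_Comp
          E'.pre_Dom_Comp E.pre_Cod_Comp E'.pre_Cod_Comp E.ev_Comp E'.ev_Comp)
  qed
qed

lemma isomorphic_kernel_quotients:
  assumes "evaluation S D Fo ev" "evaluation S' D Fo ev'" "Obj S = Obj S'"
    and "\<forall>f \<in> Mor S.
      \<exists>f'. f' \<in> Mor S' \<and> Dom S' f' = Dom S f \<and> Cod S' f' = Cod S f \<and> ev' f' = ev f"
    and "\<forall>f' \<in> Mor S'.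
      \<exists>f. f \<in> Mor S \<and> Dom S f = Dom S' f' \<and> Cod S f = Cod S' f' \<and> ev f = ev' f'"
  shows "isomorphic_cats (quot_cat S (evaluation.kernel S ev)) (quot_cat S' (evaluation.kernel S' ev'))"
proof -
  interpret E: evaluation S D Fo ev by fact
  interpret E': evaluation S' D Fo ev' by fact
  define Fm where "Fm = (\<lambda>c. E'.kernel `` {SOME f'. f' \<in> Mor S' \<and>
      Dom S' f' = Dom (quot_cat S E.kernel) c \<and> Cod S' f' = Cod (quot_cat S E.kernel) c \<and>
      ev' f' = E.ev_cls c})"
  define Gm where "Gm = (\<lambda>c. E.kernel `` {SOME f. f \<in> Mor S \<and>
      Dom S f = Dom (quot_cat S' E'.kernel) c \<and> Cod S f = Cod (quot_cat S' E'.kernel) c \<and>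
      ev f = E'.ev_cls c})"
  note F = functor_between_kernel_quotients[OF assms(1,2,3,4) Fm_def]
  note G = functor_between_kernel_quotients[OF assms(2,1) assms(3)[symmetric] assms(5) Gm_def]
  have "Gm (Fm c) = c" if c: "c \<in> Mor (quot_cat S E.kernel)" for c
  proof -
    obtain f where f: "f \<in> Mor S" "c = E.kernel `` {f}" using c by (rule E.K.Mor_quotE)
    obtain f' where f': "f' \<in> Mor S'" "Dom S' f' = Dom S f" "Cod S' f' = Cod S f" "ev' f' = ev f"
      using assms(4) f by blast
    show ?thesis using F(2)[OF f(1) f'] G(2)[OF f'(1) f(1)] f f' by simp
  qed
  moreover have "Fm (Gm c) = c" if c: "c \<in> Mor (quot_cat S' E'.kernel)" for c
  proof -
    obtain f' where f': "f' \<in> Mor S'" "c = E'.kernel `` {f'}" using c by (rule E'.K.Mor_quotE)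
    obtain f where f: "f \<in> Mor S" "Dom S f = Dom S' f'" "Cod S f = Cod S' f'" "ev f = ev' f'"
      using assms(5) f' by blast
    show ?thesis using F(2)[OF f(1) f'(1)] G(2)[OF f'(1) f] f f' by simp
  qed
  ultimately show ?thesis
    unfolding isomorphic_cats_def using F(1) G(1) by (metis id_apply)
qed

text \<open>
  The hypothesis \<open>i (Fo Y) = Ident D (Fo Y)\<close> makes the composite functor on the quotient side
  the identity on the nose.
\<close>

lemma equivalent_kernel_quotient:
  assumes "evaluation S D Fo ev"
    and full: "\<And>Y Z m. \<lbrakk>Y \<in> Obj S; Z \<in> Obj S; m \<in> Hom D (Fo Y) (Fo Z)\<rbrakk> \<Longrightarrow>
      \<exists>f. f \<in> Mor S \<and> Dom S f = Y \<and> Cod S f = Z \<and> ev f = m"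
    and p: "\<And>x. x \<in> Obj D \<Longrightarrow> p x \<in> Obj S" "\<And>Y. Y \<in> Obj S \<Longrightarrow> p (Fo Y) = Y"
    and i: "\<And>x. x \<in> Obj D \<Longrightarrow> i x \<in> Hom D x (Fo (p x))"
    and j: "\<And>x. x \<in> Obj D \<Longrightarrow> j x \<in> Hom D (Fo (p x)) x"
    and ij: "\<And>x. x \<in> Obj D \<Longrightarrow> Comp D (i x) (j x) = Ident D (Fo (p x))"
    and ji: "\<And>x. x \<in> Obj D \<Longrightarrow> Comp D (j x) (i x) = Ident D x"
    and i_Fo: "\<And>Y. Y \<in> Obj S \<Longrightarrow> i (Fo Y) = Ident D (Fo Y)"
  shows "equivalent_cats D (quot_cat S (evaluation.kernel S ev))"
proof -
  interpret E: evaluation S D Fo ev by fact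
  let ?Q = "quot_cat S E.kernel"
  interpret Q: category ?Q by (rule E.K.category_quot)
  \<comment> \<open>Conjugation with the chosen isomorphisms moves \<open>m\<close> between objects
    in the image of \<open>Fo\<close>, where \<open>full\<close> provides a preimage.\<close>
  define cj where "cj m = Comp D (i (Cod D m)) (Comp D m (j (Dom D m)))" for m
  define Fm where "Fm m = E.kernel `` {SOME f. f \<in> Mor S \<and> Dom S f = p (Dom D m) \<and>
      Cod S f = p (Cod D m) \<and> ev f = cj m}" for m
  have iM: "i x \<in> Mor D" "Dom D (i x) = x" "Cod D (i x) = Fo (p x)"
    and jM: "j x \<in> Mor D" "Dom D (j x) = Fo (p x)" "Cod D (j x) = x" if "x \<in> Obj D" for x
    using i[OF that] j[OF that] by (simp_all add: Hom_def)
  note D_simps = iM jM E.D.Dom_in E.D.Cod_in E.D.Comp_in E.D.Dom_Comp E.D.Cod_Comp E.Fo_in p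
    E.D.Ident_in E.D.Dom_Ident E.D.Cod_Ident
  have cj_in: "cj m \<in> Hom D (Fo (p (Dom D m))) (Fo (p (Cod D m)))" if "m \<in> Mor D" for m
    using that by (simp add: cj_def Hom_def D_simps)
  have cj_Ident: "cj (Ident D x) = Ident D (Fo (p x))" if "x \<in> Obj D" for x
    using that E.D.Comp_Ident_left[of "j x"] by (simp add: cj_def D_simps ij)
  have cj_Comp: "cj (Comp D n m) = Comp D (cj n) (cj m)"
    if "m \<in> Mor D" "n \<in> Mor D" "Cod D m = Dom D n" for m n
  proof -
    let ?y = "Dom D n"
    have y: "?y \<in> Obj D" using that by (simp add: D_simps)
    \<comment> \<open>The inner pair \<open>j\<close>, \<open>i\<close> at the middle object
      cancels; the rest is reassociation.\<close>
    have "Comp D (j ?y) (Comp D (i ?y) (Comp D m (j (Dom D m)))) = Comp D m (j (Dom D m))"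
      using that y ji[OF y] E.D.Comp_Ident_left[of "Comp D m (j (Dom D m))"]
      by (simp add: E.D.Comp_assoc[of "Comp D m (j (Dom D m))" "i ?y" "j ?y"] D_simps)
    then have "Comp D (Comp D n (j ?y)) (Comp D (i ?y) (Comp D m (j (Dom D m))))
        = Comp D n (Comp D m (j (Dom D m)))"
      using that y by (simp add: E.D.Comp_assoc[symmetric] D_simps)
    then show ?thesis
      using that y by (simp add: cj_def E.D.Comp_assoc[symmetric] D_simps)
  qed
  have cj_Fo: "cj m = m" if "Y \<in> Obj S" "Z \<in> Obj S" "m \<in> Hom D (Fo Y) (Fo Z)" for Y Z m
  proof -
    \<comment> \<open>Since \<open>i (Fo Y)\<close> is an identity, so is its inverse, and
      conjugation is trivial between objects of the image.\<close>
    have "j (Fo Y) = Ident D (Fo Y)"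
      using E.D.Comp_Ident_right[of "j (Fo Y)"] ji[of "Fo Y"] i_Fo[of Y] that
      by (simp add: D_simps)
    then show ?thesis
      using that E.D.Comp_Ident_left[of m] E.D.Comp_Ident_right[of m]
      by (simp add: cj_def Hom_def i_Fo)
  qed
  have Fm_eq: "Fm m = E.kernel `` {f}"
    if "f \<in> Mor S" "Dom S f = p (Dom D m)" "Cod S f = p (Cod D m)" "ev f = cj m" for f m
  proof -
    let ?P = "\<lambda>f. f \<in> Mor S \<and> Dom S f = p (Dom D m) \<and> Cod S f = p (Cod D m) \<and> ev f = cj m"
    have "?P (SOME f. ?P f)" using that by (intro someI[of ?P f]) simp
    then show ?thesis using that by (simp add: Fm_def E.kernel_iff)
  qed
  have lift: "\<exists>f. f \<in> Mor S \<and> Dom S f = p (Dom D m) \<and> Cod S f = p (Cod D m) \<and> ev f = cj m"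
    if "m \<in> Mor D" for m
    using full[OF _ _ cj_in] that by (simp add: D_simps)
  have F: "is_functor D ?Q p Fm"
    unfolding is_functor_def
  proof (intro conjI ballI impI)
    show "Fm (Ident D x) = Ident ?Q (p x)" if "x \<in> Obj D" for x
      using that Fm_eq[of "Ident S (p x)" "Ident D x"]
      by (simp add: E.pre_Ident_in E.pre_Dom_Ident E.pre_Cod_Ident E.ev_Ident cj_Ident D_simps)
  next
    fix m assume m: "m \<in> Mor D"
    then obtain f where f: "f \<in> Mor S" "Dom S f = p (Dom D m)" "Cod S f = p (Cod D m)" "ev f = cj m"
      using lift by blast
    then show "Fm m \<in> Hom ?Q (p (Dom D m)) (p (Cod D m))"
      by (simp add: Hom_def Fm_eq[OF f] E.K.Mor_quotI)
    fix n assume n: "n \<in> Mor D" "Cod D m = Dom D n"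
    then obtain g where g: "g \<in> Mor S" "Dom S g = p (Dom D n)" "Cod S g = p (Cod D n)" "ev g = cj n"
      using lift by blast
    show "Fm (Comp D n m) = Comp ?Q (Fm n) (Fm m)"
      using Fm_eq[of "Comp S g f" "Comp D n m"] f g n m
      by (simp add: Fm_eq[OF f] Fm_eq[OF g] E.K.Comp_quot E.pre_Comp_in E.pre_Dom_Comp
          E.pre_Cod_Comp E.ev_Comp cj_Comp D_simps)
  qed (simp_all add: D_simps E.D.category_axioms Q.category_axioms)
  have G: "is_functor ?Q D Fo E.ev_cls"
    unfolding is_functor_def
  proof (intro conjI ballI impI)
    fix c assume "c \<in> Mor ?Q"
    then obtain f where f: "f \<in> Mor S" "c = E.kernel `` {f}" by (rule E.K.Mor_quotE)
    then show "E.ev_cls c \<in> Hom D (Fo (Dom ?Q c)) (Fo (Cod ?Q c))" by (simp add: E.ev_in)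
    fix d assume d: "d \<in> Mor ?Q" "Cod ?Q c = Dom ?Q d"
    then obtain g where g: "g \<in> Mor S" "d = E.kernel `` {g}" by (auto elim: E.K.Mor_quotE)
    then show "E.ev_cls (Comp ?Q d c) = Comp D (E.ev_cls d) (E.ev_cls c)"
      using f d by (simp add: E.K.Comp_quot E.pre_Comp_in E.ev_Comp)
  qed (simp_all add: D_simps E.D.category_axioms Q.category_axioms E.pre_Ident_in E.ev_Ident)
  have ev_Fm: "E.ev_cls (Fm m) = cj m" if "m \<in> Mor D" for m
    using lift[OF that] Fm_eq by force
  have nat1: "naturally_isomorphic D D (Fo \<circ> p) (E.ev_cls \<circ> Fm) id id"
    unfolding naturally_isomorphic_def
  proof (intro exI[of _ j] conjI ballI)
    fix x assume "x \<in> Obj D"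
    then show "j x \<in> Hom D ((Fo \<circ> p) x) (id x)" "is_iso D (j x)"
      using i[of x] j[of x] ij[of x] ji[of x] iM[of x] jM[of x] by (auto simp: is_iso_def)
  next
    fix m assume m: "m \<in> Mor D"
    have "Comp D (j (Cod D m)) (cj m) = Comp D m (j (Dom D m))"
      using m ji[of "Cod D m"] E.D.Comp_Ident_left[of "Comp D m (j (Dom D m))"]
      by (simp add: cj_def E.D.Comp_assoc[of _ "i _" "j _"] D_simps)
    then show "Comp D (j (Cod D m)) ((E.ev_cls \<circ> Fm) m) = Comp D (id m) (j (Dom D m))"
      by (simp add: ev_Fm m)
  qed
  have nat2: "naturally_isomorphic ?Q ?Q (p \<circ> Fo) (Fm \<circ> E.ev_cls) id id"
    unfolding naturally_isomorphic_def
  \<comment> \<open>\<open>p (Fo Y) = Y\<close> and \<open>cj_Fo\<close> make the composite the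
    identity functor on the quotient, so identities are natural.\<close>
  proof (intro exI[of _ "Ident ?Q"] conjI ballI)
    fix x assume x: "x \<in> Obj ?Q"
    then have "Ident ?Q x \<in> Hom ?Q x x"
      using Q.Ident_in[OF x] Q.Dom_Ident[OF x] Q.Cod_Ident[OF x] by (simp add: Hom_def)
    then show "Ident ?Q x \<in> Hom ?Q ((p \<circ> Fo) x) (id x)" "is_iso ?Q (Ident ?Q x)"
      using x Q.Comp_Ident_left[of "Ident ?Q x"] p unfolding is_iso_def Hom_def
      by (auto simp del: E.K.Ident_quot)
  next
    fix c assume c: "c \<in> Mor ?Q"
    then obtain f where f: "f \<in> Mor S" "c = E.kernel `` {f}" by (rule E.K.Mor_quotE)
    have "Fm (ev f) = c"
      using f Fm_eq[of f "ev f"] cj_Fo[OF _ _ E.ev_in]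
      by (simp add: E.Dom_ev E.Cod_ev p E.pre_Dom_in E.pre_Cod_in)
    then show "Comp ?Q (Ident ?Q (Cod ?Q c)) ((Fm \<circ> E.ev_cls) c) = Comp ?Q (id c) (Ident ?Q (Dom ?Q c))"
      using f c Q.Comp_Ident_left[OF c] Q.Comp_Ident_right[OF c] by (simp del: E.K.Ident_quot)
  qed
  show ?thesis
    unfolding equivalent_cats_def using F G nat1 nat2 by blast
qed

section \<open>Free categories and generated congruences\<close>

lemma is_walk_verts: "is_walk Q x es y \<Longrightarrow> x \<in> Verts Q \<and> y \<in> Verts Q"
  by (induction es arbitrary: x) auto

lemma is_walk_append:
  "is_walk Q x es y \<Longrightarrow> is_walk Q y fs z \<Longrightarrow> is_walk Q x (es @ fs) z"
  by (induction es arbitrary: x) auto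

lemma free_cat_simps [simp]:
  "Obj (free_cat Q) = Verts Q"
  "(x, es, y) \<in> Mor (free_cat Q) \<longleftrightarrow> is_walk Q x es y"
  "Dom (free_cat Q) (x, es, y) = x"
  "Cod (free_cat Q) (x, es, y) = y"
  "Ident (free_cat Q) x = (x, [], x)"
  "Comp (free_cat Q) (y', fs, z) (x, es, y) = (x, es @ fs, z)"
  by (auto simp: free_cat_def)

lemma category_free_cat: "category (free_cat Q)"
  by standard (auto simp: is_walk_verts intro: is_walk_append)

lemma (in category) precategory: "precategory C"
  by standard (fact Dom_in Cod_in Ident_in Dom_Ident Cod_Ident Comp_in Dom_Comp Cod_Comp)+

text \<open>The closure rules of \<open>gen_cong\<close> give every axiom of a congruence except
  that related elements are parallel morphisms; this is inherited from \<open>r\<close> by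
  induction.\<close>

lemma congruence_gen_cong:
  assumes "category C"
    and r: "\<And>f g. (f, g) \<in> r \<Longrightarrow> f \<in> Mor C \<and> g \<in> Mor C \<and> Dom C f = Dom C g \<and> Cod C f = Cod C g"
  shows "congruence C (gen_cong C r)"
proof -
  interpret category C by fact
  have typed: "f \<in> Mor C \<and> g \<in> Mor C \<and> Dom C f = Dom C g \<and> Cod C f = Cod C g"
    if "(f, g) \<in> gen_cong C r" for f g
    using that by induction (auto simp: r Comp_in Dom_Comp Cod_Comp)
  show ?thesis
  proof (intro congruence.intro congruence_axioms.intro precategory)
    show "equiv (Mor C) (gen_cong C r)"
      using typed by (intro equivI refl_onI symI transI) (auto intro: gen_cong.intros)
  qed (auto simp: typed Comp_Ident_left Comp_Ident_right Comp_assoc Comp_in Dom_Comp Cod_Comp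
      intro: gen_cong.intros)
qed

section \<open>Localization\<close>

locale localizing = category C for C :: "('o, 'm) cat" +
  fixes S :: "'m set"
  assumes S_Mor: "S \<subseteq> Mor C"
begin

abbreviation "D \<equiv> localization C S"
abbreviation "L \<equiv> loc_mor C S"
abbreviation "V \<equiv> loc_inv C S"
abbreviation "Zig \<equiv> free_cat (zigzag_quiver C S)"

lemma zigzag_simps [simp]:
  "Verts (zigzag_quiver C S) = Obj C"
  "Arrs (zigzag_quiver C S) = Fwd ` Mor C \<union> Bwd ` S"
  "Src (zigzag_quiver C S) (Fwd f) = Dom C f" "Src (zigzag_quiver C S) (Bwd f) = Cod C f"
  "Tgt (zigzag_quiver C S) (Fwd f) = Cod C f" "Tgt (zigzag_quiver C S) (Bwd f) = Dom C f"
  by (auto simp: zigzag_quiver_def)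

lemma congruence_zigzag: "congruence Zig (zigzag_cong C S)"
  unfolding zigzag_cong_def
  by (rule congruence_gen_cong[OF category_free_cat], use S_Mor in \<open>auto simp: zigzag_rels_def
      Ident_in Dom_Ident Cod_Ident Dom_in Cod_in Comp_in Dom_Comp Cod_Comp\<close>)

sublocale Z: congruence Zig "zigzag_cong C S"
  by (rule congruence_zigzag)

sublocale D: category D
  unfolding localization_def by (rule Z.category_quot)

lemma S_MorD: "s \<in> S \<Longrightarrow> s \<in> Mor C"
  using S_Mor by blast

lemma Obj_D [simp]: "Obj D = Obj C"
  by (simp add: localization_def)

lemma Ident_D: "Ident D x = zigzag_cong C S `` {(x, [], x)}"
  by (simp add: localization_def)

lemma L_Mor [simp]: "f \<in> Mor C \<Longrightarrow> L f \<in> Mor D"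
  and Dom_L [simp]: "f \<in> Mor C \<Longrightarrow> Dom D (L f) = Dom C f"
  and Cod_L [simp]: "f \<in> Mor C \<Longrightarrow> Cod D (L f) = Cod C f"
  by (simp_all add: localization_def loc_mor_def Z.Mor_quotI Dom_in Cod_in)

lemma V_Mor [simp]: "s \<in> S \<Longrightarrow> V s \<in> Mor D"
  and Dom_V [simp]: "s \<in> S \<Longrightarrow> Dom D (V s) = Cod C s"
  and Cod_V [simp]: "s \<in> S \<Longrightarrow> Cod D (V s) = Dom C s"
  by (simp_all add: localization_def loc_inv_def Z.Mor_quotI Dom_in Cod_in S_MorD)

lemma rel_zigzag: "(f, g) \<in> zigzag_rels C S \<Longrightarrow>
    zigzag_cong C S `` {f} = zigzag_cong C S `` {g}"
  unfolding zigzag_cong_def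
  by (rule Z.cls_eqI[unfolded zigzag_cong_def]) (rule gen_cong.base)

lemma L_Ident: "x \<in> Obj C \<Longrightarrow> L (Ident C x) = Ident D x"
  unfolding loc_mor_def Ident_D
  by (rule rel_zigzag) (auto simp: zigzag_rels_def Dom_Ident Cod_Ident)

lemma L_Comp: "f \<in> Mor C \<Longrightarrow> g \<in> Mor C \<Longrightarrow> Cod C f = Dom C g \<Longrightarrow> L (Comp C g f) = Comp D (L g) (L f)"
proof -
  assume fg: "f \<in> Mor C" "g \<in> Mor C" "Cod C f = Dom C g"
  have "L (Comp C g f) = zigzag_cong C S `` {(Dom C f, [Fwd f, Fwd g], Cod C g)}"
    unfolding loc_mor_def
    by (rule rel_zigzag[symmetric]) (use fg in \<open>auto simp: zigzag_rels_def Dom_Comp Cod_Comp\<close>)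
  also have "\<dots> = Comp D (L g) (L f)"
    using fg by (simp add: localization_def loc_mor_def Z.Comp_quot Dom_in Cod_in)
  finally show ?thesis .
qed

lemma V_L: "s \<in> S \<Longrightarrow> Comp D (V s) (L s) = Ident D (Dom C s)"
proof -
  assume s: "s \<in> S"
  have "Comp D (V s) (L s) = zigzag_cong C S `` {(Dom C s, [Fwd s, Bwd s], Dom C s)}"
    using s by (simp add: localization_def loc_mor_def loc_inv_def Z.Comp_quot Dom_in Cod_in S_MorD)
  also have "\<dots> = Ident D (Dom C s)"
    unfolding Ident_D by (rule rel_zigzag) (use s in \<open>auto simp: zigzag_rels_def\<close>)
  finally show ?thesis .
qed

lemma L_V: "s \<in> S \<Longrightarrow> Comp D (L s) (V s) = Ident D (Cod C s)"
proof -
  assume s: "s \<in> S"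
  have "Comp D (L s) (V s) = zigzag_cong C S `` {(Cod C s, [Bwd s, Fwd s], Cod C s)}"
    using s by (simp add: localization_def loc_mor_def loc_inv_def Z.Comp_quot Dom_in Cod_in S_MorD)
  also have "\<dots> = Ident D (Cod C s)"
    unfolding Ident_D by (rule rel_zigzag) (use s in \<open>auto simp: zigzag_rels_def\<close>)
  finally show ?thesis .
qed

text \<open>Zigzags are built by adding letters on the source side, that is, by precomposition.
  Fractions \<open>V s\<close> after \<open>L f\<close> are stable under precomposition with
  \<open>L\<close>, so in the induction for \<open>fraction\<close> only a formal inverse needs
  work.\<close>

lemma loc_induct [consumes 1, case_names Ident Fwd Bwd]:
  assumes "m \<in> Mor D"
    and Ident: "\<And>x. x \<in> Obj C \<Longrightarrow> Q (Ident D x)"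
    and Fwd: "\<And>f m. \<lbrakk>f \<in> Mor C; m \<in> Mor D; Dom D m = Cod C f; Q m\<rbrakk> \<Longrightarrow> Q (Comp D m (L f))"
    and Bwd: "\<And>s m. \<lbrakk>s \<in> S; m \<in> Mor D; Dom D m = Dom C s; Q m\<rbrakk> \<Longrightarrow> Q (Comp D m (V s))"
  shows "Q m"
proof -
  have walk: "Q (zigzag_cong C S `` {(x, es, y)})" if "is_walk (zigzag_quiver C S) x es y" for x es y
    using that
  proof (induction es arbitrary: x)
    case Nil
    then show ?case by (auto intro: Ident[unfolded Ident_D])
  next
    case (Cons e es)
    let ?m = "zigzag_cong C S `` {(Tgt (zigzag_quiver C S) e, es, y)}"
    have w: "is_walk (zigzag_quiver C S) (Tgt (zigzag_quiver C S) e) es y" using Cons.prems by simp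
    then have m: "?m \<in> Mor D" "Dom D ?m = Tgt (zigzag_quiver C S) e" "Q ?m"
      using Cons.IH by (simp_all add: localization_def Z.Mor_quotI)
    show ?case
    proof (cases e)
      case (Fwd f)
      have "zigzag_cong C S `` {(x, e # es, y)} = Comp D ?m (L f)"
        using Cons.prems w Fwd
        by (auto simp: localization_def loc_mor_def Z.Comp_quot Dom_in Cod_in)
      then show ?thesis using assms(3)[of f ?m] Fwd m Cons.prems by auto
    next
      case (Bwd s)
      have "zigzag_cong C S `` {(x, e # es, y)} = Comp D ?m (V s)"
        using Cons.prems w Bwd
        by (auto simp: localization_def loc_inv_def Z.Comp_quot Dom_in Cod_in S_MorD)
      then show ?thesis using assms(4)[of s ?m] Bwd m Cons.prems by auto
    qed
  qed
  obtain z where z: "z \<in> Mor Zig" "m = zigzag_cong C S `` {z}"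
    using assms(1) unfolding localization_def by (rule Z.Mor_quotE)
  then show ?thesis by (cases z) (auto intro: walk)
qed

end

section \<open>Pixelated categories\<close>

text \<open>Isolates what the study of the localization uses, free of reparametrizations. The
  interplay is always the same: \<open>S_directed\<close> and \<open>S_Ore\<close> provide common
  targets, \<open>S_thin\<close> makes the resulting diagrams of pixel morphisms commute, and
  cancellation removes what was added.\<close>

locale pixelated = localizing C S for C :: "('o, 'm) cat" and S +
  fixes \<pi> :: "'o \<Rightarrow> 'p" and pt :: "'p \<Rightarrow> 'o"
  assumes S_Ident: "x \<in> Obj C \<Longrightarrow> Ident C x \<in> S"
    and S_Comp: "\<lbrakk>f \<in> S; g \<in> S; Cod C f = Dom C g\<rbrakk> \<Longrightarrow> Comp C g f \<in> S"
    and S_factor: "\<lbrakk>f \<in> Mor C; g \<in> Mor C; Cod C f = Dom C g; Comp C g f \<in> S\<rbrakk> \<Longrightarrow> f \<in> S \<and> g \<in> S"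
    and S_thin: "\<lbrakk>f \<in> S; g \<in> S; Dom C f = Dom C g; Cod C f = Cod C g\<rbrakk> \<Longrightarrow> f = g"
    and S_pixel: "f \<in> S \<Longrightarrow> \<pi> (Dom C f) = \<pi> (Cod C f)"
    and S_directed: "\<lbrakk>x \<in> Obj C; y \<in> Obj C; \<pi> x = \<pi> y\<rbrakk> \<Longrightarrow>
      \<exists>a \<in> S. \<exists>b \<in> S. Dom C a = x \<and> Dom C b = y \<and> Cod C a = Cod C b"
    and S_Ore: "\<lbrakk>a \<in> S; f \<in> Mor C; Dom C a = Dom C f\<rbrakk> \<Longrightarrow>
      \<exists>b \<in> S. \<exists>g \<in> Mor C. Dom C b = Cod C f \<and> Dom C g = Cod C a \<and> Cod C g = Cod C b \<and>
        Comp C b f = Comp C g a"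
    and left_cancel: "\<lbrakk>f \<in> Mor C; g \<in> Mor C; h \<in> Mor C; Cod C f = Dom C h; Cod C g = Dom C h;
        Dom C f = Dom C g; Comp C h f = Comp C h g\<rbrakk> \<Longrightarrow> f = g"
    and right_cancel: "\<lbrakk>f \<in> Mor C; g \<in> Mor C; h \<in> Mor C; Dom C f = Cod C h; Dom C g = Cod C h;
        Cod C f = Cod C g; Comp C f h = Comp C g h\<rbrakk> \<Longrightarrow> f = g"
    and pt_in: "x \<in> Obj C \<Longrightarrow> pt (\<pi> x) \<in> Obj C"
    and pixel_pt: "x \<in> Obj C \<Longrightarrow> \<pi> (pt (\<pi> x)) = \<pi> x"
begin

abbreviation comp (infixr "\<star>" 70) where "g \<star> f \<equiv> Comp C g f"

lemmas C_simps = Dom_in Cod_in Ident_in Dom_Ident Cod_Ident Comp_in Dom_Comp Cod_Comp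
  Comp_assoc [symmetric]

lemmas S_simps = S_Comp S_Ident

lemma Comp_assoc_rewrite:
  "\<lbrakk>g \<star> f = k \<star> h; e \<in> Mor C; f \<in> Mor C; g \<in> Mor C; h \<in> Mor C; k \<in> Mor C; Cod C f = Dom C g;
    Cod C h = Dom C k; Cod C e = Dom C f; Cod C e = Dom C h\<rbrakk> \<Longrightarrow> g \<star> f \<star> e = k \<star> h \<star> e"
  using Comp_assoc[of e f g] Comp_assoc[of e h k] by simp

lemma OreE:
  assumes "a \<in> S" "f \<in> Mor C" "Dom C a = Dom C f"
  obtains b g where "b \<in> S" "b \<in> Mor C" "g \<in> Mor C" "Dom C b = Cod C f" "Dom C g = Cod C a"
    "Cod C g = Cod C b" "b \<star> f = g \<star> a"
  using S_Ore[OF assms] S_MorD by blast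

lemma directedE:
  assumes "x \<in> Obj C" "y \<in> Obj C" "\<pi> x = \<pi> y"
  obtains a b where "a \<in> S" "a \<in> Mor C" "b \<in> S" "b \<in> Mor C" "Dom C a = x" "Dom C b = y"
    "Cod C b = Cod C a"
  using S_directed[OF assms] S_MorD by metis

text \<open>
  In the localization, target points matter only up to their pixel, so a morphism \<open>g\<close> acts on
  the morphisms of \<open>C\<close> with target in the pixel of \<open>Dom C g\<close>. The relation \<open>act g\<close> is that action:
  it is insensitive to inverting \<open>S\<close>, but still determines \<open>g\<close>.
\<close>

definition act :: "'m \<Rightarrow> ('m \<times> 'm) set" where
  "act g = {(f, f'). f \<in> Mor C \<and> f' \<in> Mor C \<and> Dom C f = Dom C f' \<and>
     (\<exists>a\<in>S. \<exists>b\<in>S. \<exists>a'\<in>S. \<exists>b'\<in>S. \<exists>k\<in>Mor C.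
        Dom C a = Dom C g \<and> Dom C b = Cod C f \<and> Cod C a = Dom C k \<and> Cod C b = Dom C k \<and>
        Dom C a' = Cod C g \<and> Dom C b' = Cod C f' \<and> Cod C a' = Cod C k \<and> Cod C b' = Cod C k \<and>
        k \<star> a = a' \<star> g \<and> k \<star> b \<star> f = b' \<star> f')}"

lemma actI:
  assumes "f \<in> Mor C" "f' \<in> Mor C" "Dom C f = Dom C f'" "a \<in> S" "b \<in> S" "a' \<in> S" "b' \<in> S" "k \<in> Mor C"
    "Dom C a = Dom C g" "Dom C b = Cod C f" "Cod C a = Dom C k" "Cod C b = Dom C k"
    "Dom C a' = Cod C g" "Dom C b' = Cod C f'" "Cod C a' = Cod C k" "Cod C b' = Cod C k"
    "k \<star> a = a' \<star> g" "k \<star> b \<star> f = b' \<star> f'"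
  shows "(f, f') \<in> act g"
  using assms unfolding act_def by blast

lemma actE:
  assumes "(f, f') \<in> act g"
  obtains a b a' b' k where "f \<in> Mor C" "f' \<in> Mor C" "Dom C f' = Dom C f"
    "a \<in> S" "b \<in> S" "a' \<in> S" "b' \<in> S" "k \<in> Mor C"
    "a \<in> Mor C" "b \<in> Mor C" "a' \<in> Mor C" "b' \<in> Mor C"
    "Dom C a = Dom C g" "Dom C b = Cod C f" "Cod C a = Dom C k" "Cod C b = Dom C k"
    "Dom C a' = Cod C g" "Dom C b' = Cod C f'" "Cod C a' = Cod C k" "Cod C b' = Cod C k"
    "k \<star> a = a' \<star> g" "k \<star> b \<star> f = b' \<star> f'"
  using assms unfolding act_def mem_Collect_eq split
  apply (elim conjE bexE)
  subgoal for a b a' b' k by (rule that[of a b a' b' k]) (simp_all add: S_MorD)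
  done

text \<open>Read \<open>(f, f') \<in> act g\<close> as: up to pixel morphisms at the targets,
  \<open>f'\<close> is \<open>g\<close> after \<open>f\<close>, with \<open>k\<close> a translate of
  \<open>g\<close>. To split an action of \<open>h \<star> g\<close>, Ore squares push
  \<open>g\<close> and then \<open>h\<close> along pixel morphisms; the converse pastes two squares
  after linking them within a pixel.\<close>

lemma act_Comp:
  assumes gh: "g \<in> Mor C" "h \<in> Mor C" "Cod C g = Dom C h"
  shows "act (h \<star> g) = act g O act h"
proof (intro equalityI subrelI)
  fix f f2 assume "(f, f2) \<in> act (h \<star> g)"
  then obtain a b c d k where f: "f \<in> Mor C" "f2 \<in> Mor C" "Dom C f2 = Dom C f"
    and S: "a \<in> S" "b \<in> S" "c \<in> S" "d \<in> S" "k \<in> Mor C"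
      "a \<in> Mor C" "b \<in> Mor C" "c \<in> Mor C" "d \<in> Mor C"
    and "Dom C a = Dom C (h \<star> g)" "Dom C b = Cod C f" "Cod C a = Dom C k" "Cod C b = Dom C k"
      "Dom C c = Cod C (h \<star> g)" "Dom C d = Cod C f2" "Cod C c = Cod C k" "Cod C d = Cod C k"
    and eq: "k \<star> a = c \<star> h \<star> g" "k \<star> b \<star> f = d \<star> f2"
    by (rule actE)
  then have ty: "Dom C a = Dom C g" "Dom C b = Cod C f" "Cod C a = Dom C k" "Cod C b = Dom C k"
      "Dom C c = Cod C h" "Dom C d = Cod C f2" "Cod C c = Cod C k" "Cod C d = Cod C k"
    using gh by (simp_all add: C_simps)
  obtain a' g' where a': "a' \<in> S" "a' \<in> Mor C" "g' \<in> Mor C" "Dom C a' = Cod C g" "Dom C g' = Cod C a"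
      "Cod C g' = Cod C a'" and eq_a': "a' \<star> g = g' \<star> a"
    using OreE[OF S(1) gh(1) ty(1)] by blast
  obtain p h' where p: "p \<in> S" "p \<in> Mor C" "h' \<in> Mor C" "Dom C p = Cod C h" "Dom C h' = Cod C a'"
      "Cod C h' = Cod C p" and eq_p: "p \<star> h = h' \<star> a'"
    using OreE[of a' h] a' gh by metis
  have "\<pi> (Cod C p) = \<pi> (Cod C k)"
    using S_pixel[of p] S_pixel[of c] p S ty by simp
  then obtain p2 q where q: "p2 \<in> S" "p2 \<in> Mor C" "q \<in> S" "q \<in> Mor C"
      "Dom C p2 = Cod C p" "Dom C q = Cod C k" "Cod C q = Cod C p2"
    using p S directedE[of "Cod C p" "Cod C k"] Cod_in by metis
  have thin: "p2 \<star> p = q \<star> c"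
    by (rule S_thin) (use p q S ty in \<open>simp_all add: C_simps S_simps\<close>)
  note facts = f S ty a' p q gh
  have "(p2 \<star> h' \<star> g') \<star> a = p2 \<star> h' \<star> a' \<star> g"
    unfolding eq_a' using facts by (simp add: C_simps)
  also have "\<dots> = (p2 \<star> p) \<star> h \<star> g"
    using facts Comp_assoc_rewrite[OF eq_p, of g] by (simp add: C_simps)
  also have "\<dots> = q \<star> c \<star> h \<star> g"
    unfolding thin using facts by (simp add: C_simps)
  also have "\<dots> = (q \<star> k) \<star> a"
    unfolding eq(1)[symmetric] using facts by (simp add: C_simps)
  \<comment> \<open>Both sides agree after \<open>a\<close>; cancelling \<open>a\<close> on the
    right identifies the pushed composite with a translate of the given \<open>k\<close>.\<close>
  finally have k: "p2 \<star> h' \<star> g' = q \<star> k"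
    by (rule right_cancel[rotated -1]) (use facts in \<open>simp_all add: C_simps\<close>)
  \<comment> \<open>The intermediate morphism is the translate \<open>g'\<close> of
    \<open>g\<close>, applied to \<open>f\<close> after the link \<open>b\<close>.\<close>
  let ?f1 = "g' \<star> b \<star> f"
  have "(f, ?f1) \<in> act g"
    by (rule actI[of _ _ a b a' "Ident C (Cod C g')" g'])
      (use facts eq_a' Comp_Ident_left[of ?f1] in \<open>simp_all add: C_simps S_simps\<close>)
  moreover have "(?f1, f2) \<in> act h"
  proof (rule actI[of _ _ a' "Ident C (Cod C g')" "p2 \<star> p" "q \<star> d" "p2 \<star> h'"])
    show "(p2 \<star> h') \<star> a' = (p2 \<star> p) \<star> h" using facts eq_p by (simp add: C_simps)
    have "(p2 \<star> h') \<star> Ident C (Cod C g') \<star> ?f1 = (p2 \<star> h' \<star> g') \<star> b \<star> f"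
      using facts Comp_Ident_left[of ?f1] by (simp add: C_simps)
    also have "\<dots> = q \<star> k \<star> b \<star> f" unfolding k using facts by (simp add: C_simps)
    also have "\<dots> = (q \<star> d) \<star> f2" unfolding eq(2) using facts by (simp add: C_simps)
    finally show "(p2 \<star> h') \<star> Ident C (Cod C g') \<star> ?f1 = (q \<star> d) \<star> f2" .
  qed (use facts in \<open>simp_all add: C_simps S_simps\<close>)
  ultimately show "(f, f2) \<in> act g O act h" by blast
next
  fix f f2 assume "(f, f2) \<in> act g O act h"
  then obtain f1 where f1: "(f, f1) \<in> act g" "(f1, f2) \<in> act h" by blast
  obtain a b a' b' k where f: "f \<in> Mor C" "f1 \<in> Mor C" "Dom C f1 = Dom C f"
    and S: "a \<in> S" "b \<in> S" "a' \<in> S" "b' \<in> S" "k \<in> Mor C"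
      "a \<in> Mor C" "b \<in> Mor C" "a' \<in> Mor C" "b' \<in> Mor C"
    and ty: "Dom C a = Dom C g" "Dom C b = Cod C f" "Cod C a = Dom C k" "Cod C b = Dom C k"
      "Dom C a' = Cod C g" "Dom C b' = Cod C f1" "Cod C a' = Cod C k" "Cod C b' = Cod C k"
    and eq: "k \<star> a = a' \<star> g" "k \<star> b \<star> f = b' \<star> f1"
    using f1(1) by (rule actE)
  obtain c d c' d' h' where f2: "f2 \<in> Mor C" "Dom C f2 = Dom C f1"
    and S2: "c \<in> S" "d \<in> S" "c' \<in> S" "d' \<in> S" "h' \<in> Mor C"
      "c \<in> Mor C" "d \<in> Mor C" "c' \<in> Mor C" "d' \<in> Mor C"
    and ty2: "Dom C c = Dom C h" "Dom C d = Cod C f1" "Cod C c = Dom C h'" "Cod C d = Dom C h'"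
      "Dom C c' = Cod C h" "Dom C d' = Cod C f2" "Cod C c' = Cod C h'" "Cod C d' = Cod C h'"
    and eq2: "h' \<star> c = c' \<star> h" "h' \<star> d \<star> f1 = d' \<star> f2"
    using f1(2) by (rule actE)
  \<comment> \<open>The first square ends and the second begins in the pixel where \<open>g\<close>
    meets \<open>h\<close>, so \<open>p\<close> and \<open>q\<close> link them. The Ore square on
    \<open>q\<close> then yields the translate \<open>h2\<close> of \<open>h'\<close> that starts at
    the link.\<close>
  have "\<pi> (Cod C k) = \<pi> (Dom C h')"
    using S_pixel[of a'] S_pixel[of c] S S2 ty ty2 gh by simp
  then obtain p q where pq: "p \<in> S" "p \<in> Mor C" "q \<in> S" "q \<in> Mor C"
      "Dom C p = Cod C k" "Dom C q = Dom C h'" "Cod C q = Cod C p"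
    using S S2 directedE[of "Cod C k" "Dom C h'"] Cod_in Dom_in by metis
  obtain q' h2 where q': "q' \<in> S" "q' \<in> Mor C" "h2 \<in> Mor C" "Dom C q' = Cod C h'" "Dom C h2 = Cod C q"
      "Cod C h2 = Cod C q'" and eq_q': "q' \<star> h' = h2 \<star> q"
    using OreE[OF pq(3) S2(5) pq(6)] by blast
  note facts = f S ty f2 S2 ty2 pq q' gh
  have thin: "p \<star> a' = q \<star> c" "p \<star> b' = q \<star> d"
    by (rule S_thin; use facts in \<open>simp add: C_simps S_simps\<close>)+
  show "(f, f2) \<in> act (h \<star> g)"
  proof (rule actI[of _ _ a b "q' \<star> c'" "q' \<star> d'" "h2 \<star> p \<star> k"])
    have "(h2 \<star> p \<star> k) \<star> a = h2 \<star> p \<star> k \<star> a" using facts by (simp add: C_simps)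
    also have "\<dots> = h2 \<star> (p \<star> a') \<star> g" unfolding eq using facts by (simp add: C_simps)
    also have "\<dots> = (h2 \<star> q) \<star> c \<star> g" unfolding thin using facts by (simp add: C_simps)
    also have "\<dots> = q' \<star> (h' \<star> c) \<star> g" unfolding eq_q'[symmetric] using facts by (simp add: C_simps)
    also have "\<dots> = (q' \<star> c') \<star> h \<star> g" unfolding eq2 using facts by (simp add: C_simps)
    finally show "(h2 \<star> p \<star> k) \<star> a = (q' \<star> c') \<star> h \<star> g" .
    have "(h2 \<star> p \<star> k) \<star> b \<star> f = h2 \<star> p \<star> k \<star> b \<star> f" using facts by (simp add: C_simps)
    also have "\<dots> = h2 \<star> (p \<star> b') \<star> f1" unfolding eq using facts by (simp add: C_simps)
    also have "\<dots> = (h2 \<star> q) \<star> d \<star> f1" unfolding thin using facts by (simp add: C_simps)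
    also have "\<dots> = q' \<star> (h' \<star> d \<star> f1)" unfolding eq_q'[symmetric] using facts by (simp add: C_simps)
    also have "\<dots> = (q' \<star> d') \<star> f2" unfolding eq2 using facts by (simp add: C_simps)
    finally show "(h2 \<star> p \<star> k) \<star> b \<star> f = (q' \<star> d') \<star> f2" .
  qed (use facts in \<open>simp_all add: C_simps S_simps\<close>)
qed

text \<open>In a square over \<open>s\<close> the composite
  \<open>k \<star> a = a' \<star> s\<close> lies in \<open>S\<close>, hence so does \<open>k\<close>
  by \<open>S_factor\<close>. What remains depends on \<open>s\<close> only through its
  pixel.\<close>

lemma act_S:
  assumes s: "s \<in> S"
  shows "act s = {(f, f'). f \<in> Mor C \<and> f' \<in> Mor C \<and> Dom C f' = Dom C f \<and> \<pi> (Cod C f) = \<pi> (Dom C s) \<and>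
     (\<exists>a\<in>S. \<exists>b\<in>S. Dom C a = Cod C f \<and> Dom C b = Cod C f' \<and> Cod C a = Cod C b \<and> a \<star> f = b \<star> f')}"
    (is "_ = ?R")
proof (intro equalityI subrelI)
  fix f f' assume "(f, f') \<in> act s"
  then obtain a b a' b' k where f: "f \<in> Mor C" "f' \<in> Mor C" "Dom C f' = Dom C f"
    and S: "a \<in> S" "b \<in> S" "a' \<in> S" "b' \<in> S" "k \<in> Mor C"
      "a \<in> Mor C" "b \<in> Mor C" "a' \<in> Mor C" "b' \<in> Mor C"
    and ty: "Dom C a = Dom C s" "Dom C b = Cod C f" "Cod C a = Dom C k" "Cod C b = Dom C k"
      "Dom C a' = Cod C s" "Dom C b' = Cod C f'" "Cod C a' = Cod C k" "Cod C b' = Cod C k"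
    and eq: "k \<star> a = a' \<star> s" "k \<star> b \<star> f = b' \<star> f'"
    by (rule actE)
  have "k \<star> a \<in> S" unfolding eq using S s ty S_MorD by (simp add: S_simps)
  then have "k \<in> S" using S_factor S ty by blast
  then have "k \<star> b \<in> S" using S ty by (simp add: S_simps)
  moreover have "\<pi> (Cod C f) = \<pi> (Dom C s)" using S_pixel[of a] S_pixel[of b] S ty by simp
  moreover have "(k \<star> b) \<star> f = b' \<star> f'" "Dom C (k \<star> b) = Cod C f" "Cod C (k \<star> b) = Cod C b'"
    using f S ty eq by (simp_all add: C_simps)
  ultimately show "(f, f') \<in> ?R" using f S(4) ty(6) by blast
next
  fix f f' assume "(f, f') \<in> ?R"
  then obtain b b' where f: "f \<in> Mor C" "f' \<in> Mor C" "Dom C f' = Dom C f"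
    and S: "b \<in> S" "b' \<in> S" and ty: "Dom C b = Cod C f" "Dom C b' = Cod C f'" "Cod C b' = Cod C b"
    and eq: "\<pi> (Cod C f) = \<pi> (Dom C s)" "b \<star> f = b' \<star> f'"
    unfolding mem_Collect_eq split by (elim conjE bexE, intro that) simp_all
  have "\<pi> (Cod C s) = \<pi> (Cod C b)" using S_pixel[of s] S_pixel[of b] s S ty eq by simp
  then obtain c d where cd: "c \<in> S" "c \<in> Mor C" "d \<in> S" "d \<in> Mor C" "Dom C c = Cod C s" "Dom C d = Cod C b"
      "Cod C d = Cod C c"
    using directedE[of "Cod C s" "Cod C b"] Cod_in S_MorD S s by metis
  note facts = f S S[THEN S_MorD] s S_MorD[OF s] ty cd
  show "(f, f') \<in> act s"
  proof (rule actI[of _ _ "c \<star> s" "d \<star> b" c "d \<star> b'" "Ident C (Cod C d)"])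
    show "Ident C (Cod C d) \<star> c \<star> s = c \<star> s"
      using facts Comp_Ident_left[of "c \<star> s"] by (simp add: C_simps)
    show "Ident C (Cod C d) \<star> (d \<star> b) \<star> f = (d \<star> b') \<star> f'"
      using facts eq(2) Comp_Ident_left[of "d \<star> b \<star> f"] by (simp add: C_simps)
  qed (use facts in \<open>simp_all add: C_simps S_simps\<close>)
qed

lemma act_Ident_Ident: "x \<in> Obj C \<Longrightarrow> act (Ident C x) O act (Ident C x) = act (Ident C x)"
  using act_Comp[of "Ident C x" "Ident C x"] Comp_Ident_left[of "Ident C x"] by (simp add: C_simps)

lemma act_S_eq:
  assumes "s \<in> S" "t \<in> S" "\<pi> (Dom C s) = \<pi> (Dom C t)"
  shows "act s = act t"
  unfolding act_S[OF assms(1)] act_S[OF assms(2)] assms(3) by (rule HOL.refl)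

text \<open>A formal inverse acts by the same relation as the morphism that it inverts, because on
  \<open>S\<close> the action depends only on the pixel. The fold ends with the action of an
  identity and not with the identity relation: the former is in general only idempotent, and the
  empty walk must match the walk consisting of one identity.\<close>

definition act_walk :: "'o \<times> 'm zig list \<times> 'o \<Rightarrow> ('m \<times> 'm) set" where
  "act_walk = (\<lambda>(x, es, y). foldr (\<lambda>e r. act (case_zig id id e) O r) es (act (Ident C y)))"

lemma act_walk_append: "is_walk (zigzag_quiver C S) y fs z \<Longrightarrow> is_walk (zigzag_quiver C S) x es y \<Longrightarrow>
   act_walk (x, es @ fs, z) = act_walk (x, es, y) O act_walk (y, fs, z)"
proof (induction es arbitrary: x)
  case Nil
  have "act (Ident C y) O act_walk (y, fs, z) = act_walk (y, fs, z)"
  proof (cases fs)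
    case fs: Nil
    have "y = z" "z \<in> Obj C" using Nil.prems fs by auto
    then show ?thesis using act_Ident_Ident[of z] fs by (simp add: act_walk_def)
  next
    case (Cons e es)
    have "act (Ident C y) O act (case_zig id id e) = act (case_zig id id e)"
    proof (cases e)
      case (Fwd g)
      then have "g \<in> Mor C" "Dom C g = y" using Nil.prems Cons by auto
      then show ?thesis using Fwd act_Comp[of "Ident C y" g] Comp_Ident_right[of g] Dom_in[of g]
        by (simp add: C_simps)
    next
      case (Bwd s)
      then have s: "s \<in> S" "Cod C s = y" using Nil.prems Cons by auto
      then have "act s = act (Ident C y)"
        using S_pixel[of s] S_MorD[of s] Cod_in[of s]
        by (intro act_S_eq) (simp_all add: Dom_Ident S_Ident)
      then show ?thesis using s Bwd act_Ident_Ident[of y] S_MorD[of s] Cod_in[of s] by simp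
    qed
    then show ?thesis using Cons by (simp add: act_walk_def O_assoc[symmetric])
  qed
  moreover have "x = y" using Nil.prems by simp
  ultimately show ?case by (simp add: act_walk_def)
next
  case (Cons e es)
  then have "is_walk (zigzag_quiver C S) (Tgt (zigzag_quiver C S) e) es y" by simp
  from Cons.IH[OF Cons.prems(1) this] show ?case by (simp add: act_walk_def O_assoc)
qed

text \<open>The relations for identities and for inverse pairs reduce to idempotence of the action
  of an identity, the relation for composites to \<open>act_Comp\<close>.\<close>

lemma act_walk_cong: "(v, w) \<in> zigzag_cong C S \<Longrightarrow> act_walk v = act_walk w"
  unfolding zigzag_cong_def
proof (induction rule: gen_cong.induct)
  case (base f g)
  then consider
      x where "x \<in> Obj C" "f = (x, [Fwd (Ident C x)], x)" "g = (x, [], x)"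
    | a b where "a \<in> Mor C" "b \<in> Mor C" "Cod C a = Dom C b" "f = (Dom C a, [Fwd a, Fwd b], Cod C b)"
        "g = (Dom C a, [Fwd (b \<star> a)], Cod C b)"
    | s where "s \<in> S" "f = (Dom C s, [Fwd s, Bwd s], Dom C s)" "g = (Dom C s, [], Dom C s)"
    | s where "s \<in> S" "f = (Cod C s, [Bwd s, Fwd s], Cod C s)" "g = (Cod C s, [], Cod C s)"
    unfolding zigzag_rels_def by blast
  then show ?case
  proof cases
    case 1
    then show ?thesis by (simp add: act_walk_def act_Ident_Ident)
  next
    case 2
    then show ?thesis by (simp add: act_walk_def act_Comp O_assoc)
  next
    case 3
    then have "act s = act (Ident C (Dom C s))"
      using S_MorD[of s] by (intro act_S_eq) (simp_all add: C_simps S_simps)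
    then show ?thesis
      using 3 act_Ident_Ident[of "Dom C s"] S_MorD[of s] Dom_in[of s]
      by (simp add: act_walk_def)
  next
    case 4
    then have "act s = act (Ident C (Cod C s))"
      using S_pixel[of s] S_MorD[of s] by (intro act_S_eq) (simp_all add: C_simps S_simps)
    then show ?thesis
      using 4 act_Ident_Ident[of "Cod C s"] S_MorD[of s] Cod_in[of s]
      by (simp add: act_walk_def)
  qed
next
  case (comp f f' g g')
  obtain x es y where f: "f = (x, es, y)" by (cases f)
  obtain x1 es1 y1 where f': "f' = (x1, es1, y1)" by (cases f')
  obtain y2 fs z where g: "g = (y2, fs, z)" by (cases g)
  obtain y3 fs1 z1 where g': "g' = (y3, fs1, z1)" by (cases g')
  note rel = Z.rel_Mor[unfolded zigzag_cong_def] Z.par[unfolded zigzag_cong_def]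
  note typed = rel[OF comp.hyps(1)] rel[OF comp.hyps(2)]
  have w: "is_walk (zigzag_quiver C S) x es y" "is_walk (zigzag_quiver C S) x es1 y"
      "is_walk (zigzag_quiver C S) y fs z" "is_walk (zigzag_quiver C S) y fs1 z"
    and eq: "x1 = x" "y1 = y" "y2 = y" "y3 = y" "z1 = z"
    using typed comp.hyps(3) unfolding f f' g g' by simp_all
  show ?case
    using comp.IH act_walk_append[OF w(3,1)] act_walk_append[OF w(4,2)]
    unfolding f f' g g' eq by simp
qed simp_all

text \<open>The zigzag class of \<open>f\<close> determines \<open>act f\<close>, which contains the
  pair of an identity and \<open>f\<close>. Transferring this pair to \<open>act g\<close> gives two
  squares with parallel pixel sides; thinness identifies the sides, and \<open>left_cancel\<close>
  yields the equality.\<close>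

lemma L_faithful:
  assumes "f \<in> Mor C" "g \<in> Mor C" "Dom C f = Dom C g" "Cod C f = Cod C g" "L f = L g"
  shows "f = g"
proof -
  have "act_walk (Dom C f, [Fwd f], Cod C f) = act_walk (Dom C g, [Fwd g], Cod C g)"
    using assms by (intro act_walk_cong) (simp add: loc_mor_def Z.cls_eq Dom_in Cod_in)
  moreover have "act_walk (Dom C f, [Fwd f], Cod C f) = act f" if "f \<in> Mor C" for f
    using that act_Comp[of f "Ident C (Cod C f)"] Comp_Ident_left[of f]
    by (simp add: act_walk_def C_simps)
  ultimately have "act f = act g"
    using assms by metis
  moreover have "(Ident C (Dom C f), f) \<in> act f"
    by (rule actI[of _ _ "Ident C (Dom C f)" "Ident C (Dom C f)" "Ident C (Cod C f)" "Ident C (Cod C f)" f])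
      (use assms Comp_Ident_left[of "Ident C (Dom C f)"] Comp_Ident_left[of f] Comp_Ident_right[of f]
        in \<open>simp_all add: C_simps S_simps\<close>)
  ultimately have "(Ident C (Dom C f), f) \<in> act g" by simp
  then obtain a b a' b' k where
    S: "a \<in> S" "b \<in> S" "a' \<in> S" "b' \<in> S" "k \<in> Mor C"
      "a \<in> Mor C" "b \<in> Mor C" "a' \<in> Mor C" "b' \<in> Mor C"
    and ty: "Dom C a = Dom C g" "Dom C b = Cod C (Ident C (Dom C f))" "Cod C a = Dom C k" "Cod C b = Dom C k"
      "Dom C a' = Cod C g" "Dom C b' = Cod C f" "Cod C a' = Cod C k" "Cod C b' = Cod C k"
    and eq: "k \<star> a = a' \<star> g" "k \<star> b \<star> Ident C (Dom C f) = b' \<star> f"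
    by (rule actE)
  have b: "Dom C b = Dom C f" using ty(2) assms(1) by (simp add: C_simps)
  have "b = a" by (rule S_thin) (use S ty b assms in simp_all)
  moreover have "b' = a'" by (rule S_thin) (use S ty b assms in simp_all)
  ultimately have "a' \<star> f = a' \<star> g"
    using eq Comp_Ident_right[of a] b by (simp add: S)
  then show ?thesis
    by (rule left_cancel[rotated -1]) (use S ty assms in simp_all)
qed

end

section \<open>Left fractions, and cancellation in the localization\<close>

lemma (in category) section_cancel:
  assumes "f \<in> Mor C" "g \<in> Mor C" "Cod C f = Dom C g" "Comp C g f = Ident C (Dom C f)"
    and "p \<in> Mor C" "q \<in> Mor C" "Cod C p = Dom C f" "Cod C q = Dom C f" "Comp C f p = Comp C f q"
  shows "p = q"
proof -
  have "Comp C (Comp C g f) p = Comp C (Comp C g f) q"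
    using assms Comp_assoc[of p f g] Comp_assoc[of q f g] by metis
  then show ?thesis
    using assms Comp_Ident_left[of p] Comp_Ident_left[of q] by simp
qed

lemma (in category) retraction_cancel:
  assumes "f \<in> Mor C" "g \<in> Mor C" "Dom C f = Cod C g" "Comp C f g = Ident C (Cod C f)"
    and "p \<in> Mor C" "q \<in> Mor C" "Dom C p = Cod C f" "Dom C q = Cod C f" "Comp C p f = Comp C q f"
  shows "p = q"
proof -
  have "Comp C p (Comp C f g) = Comp C q (Comp C f g)"
    using assms Comp_assoc[of g f p] Comp_assoc[of g f q] by metis
  then show ?thesis
    using assms Comp_Ident_right[of p] Comp_Ident_right[of q] by simp
qed

context pixelated
begin

abbreviation compD (infixr "\<odot>" 70) where "g \<odot> f \<equiv> Comp D g f"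

lemmas D_simps = D.Comp_in D.Dom_Comp D.Cod_Comp D.Ident_in D.Dom_Ident D.Cod_Ident
  D.Comp_assoc [symmetric]

lemma V_cancel:
  assumes "s \<in> S" "p \<in> Mor D" "q \<in> Mor D" "Cod D p = Cod C s" "Cod D q = Cod C s" "V s \<odot> p = V s \<odot> q"
  shows "p = q"
  by (rule D.section_cancel[of "V s" "L s"]) (use assms L_V in \<open>simp_all add: S_MorD\<close>)

text \<open>Enlarges a denominator from \<open>s\<close> to \<open>a \<star> s\<close>; common
  denominators and the merging of two inverses rest on this.\<close>

lemma V_S_Comp:
  assumes "s \<in> S" "a \<in> S" "Dom C a = Cod C s"
  shows "V s = V (a \<star> s) \<odot> L a"
proof -
  have as: "a \<star> s \<in> S" "Dom C (a \<star> s) = Dom C s" "Cod C (a \<star> s) = Cod C a"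
    using assms by (simp_all add: S_Comp Dom_Comp Cod_Comp S_MorD)
  have "V (a \<star> s) \<odot> L a = V (a \<star> s) \<odot> L a \<odot> (L s \<odot> V s)"
    using assms as L_V[of s] D.Comp_Ident_right[of "L a"]
    by (simp add: D_simps S_MorD)
  also have "\<dots> = (V (a \<star> s) \<odot> L (a \<star> s)) \<odot> V s"
    using assms as by (simp add: D_simps S_MorD L_Comp)
  also have "\<dots> = V s"
    using assms as V_L[of "a \<star> s"] D.Comp_Ident_left[of "V s"] by simp
  finally show ?thesis by (rule HOL.sym)
qed

text \<open>Inverting the two pixel sides of an Ore square moves a formal inverse from the source
  side to the target side.\<close>

lemma Ore_V_L:
  assumes "a \<in> S" "b \<in> S" "f \<in> Mor C" "g \<in> Mor C" "Dom C a = Dom C f" "Dom C b = Cod C f"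
    "Dom C g = Cod C a" "Cod C g = Cod C b" "b \<star> f = g \<star> a"
  shows "L f \<odot> V a = V b \<odot> L g"
proof -
  have eq: "L b \<odot> L f = L g \<odot> L a"
    using assms by (simp add: S_MorD flip: L_Comp)
  have "L f \<odot> V a = (V b \<odot> L b) \<odot> L f \<odot> V a"
    using assms V_L[of b] D.Comp_Ident_left[of "L f \<odot> V a"] by (simp add: D_simps S_MorD)
  also have "\<dots> = V b \<odot> (L b \<odot> L f) \<odot> V a"
    using assms by (simp add: D_simps S_MorD)
  also have "\<dots> = V b \<odot> L g \<odot> L a \<odot> V a"
    unfolding eq using assms by (simp add: D_simps S_MorD)
  also have "\<dots> = V b \<odot> L g"
    using assms L_V[of a] D.Comp_Ident_right[of "L g"] by simp
  finally show ?thesis .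
qed

lemma fraction:
  assumes "m \<in> Mor D"
  obtains s f where "s \<in> S" "f \<in> Mor C" "Dom C f = Dom D m" "Dom C s = Cod D m" "Cod C f = Cod C s"
    "m = V s \<odot> L f"
proof -
  have "\<exists>s f. s \<in> S \<and> f \<in> Mor C \<and> Dom C f = Dom D m \<and> Dom C s = Cod D m \<and> Cod C f = Cod C s \<and>
      m = V s \<odot> L f"
    using assms
  proof (induction rule: loc_induct)
    case (Ident x)
    then have "Ident D x = V (Ident C x) \<odot> L (Ident C x)"
      using V_L[of "Ident C x"] by (simp add: S_Ident Dom_Ident)
    then show ?case
      using Ident by (intro exI[of _ "Ident C x"]) (simp add: S_Ident C_simps D_simps)
  next
    case (Fwd f m)
    then obtain s g where g: "s \<in> S" "g \<in> Mor C" "Dom C g = Dom D m" "Dom C s = Cod D m"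
      "Cod C g = Cod C s" "m = V s \<odot> L g" by blast
    have "m \<odot> L f = V s \<odot> L (g \<star> f)"
      using g Fwd by (simp add: D_simps L_Comp)
    then show ?case
      using g Fwd by (intro exI[of _ s] exI[of _ "g \<star> f"]) (simp add: C_simps D.Dom_Comp D.Cod_Comp)
  next
    case (Bwd a m)
    then obtain s f where f: "s \<in> S" "f \<in> Mor C" "Dom C f = Dom D m" "Dom C s = Cod D m"
      "Cod C f = Cod C s" "m = V s \<odot> L f" by blast
    obtain b g where b: "b \<in> S" "b \<in> Mor C" "g \<in> Mor C" "Dom C b = Cod C f" "Dom C g = Cod C a"
      "Cod C g = Cod C b" "b \<star> f = g \<star> a"
      using Bwd f OreE[of a f] by metis
    have "m \<odot> V a = V s \<odot> L f \<odot> V a"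
      using f Bwd by (simp add: D_simps)
    also have "\<dots> = V s \<odot> V b \<odot> L g"
      using Ore_V_L[of a b f g] f b Bwd by simp
    \<comment> \<open>Enlarging the denominator \<open>s\<close> by \<open>b\<close> lets
      \<open>L b\<close> cancel \<open>V b\<close>, so the two inverses merge into one.\<close>
    also have "\<dots> = (V (b \<star> s) \<odot> L b) \<odot> V b \<odot> L g"
      using V_S_Comp[of s b] f b by simp
    also have "\<dots> = V (b \<star> s) \<odot> (L b \<odot> V b) \<odot> L g"
      using f b by (simp add: D_simps S_Comp C_simps S_MorD)
    also have "\<dots> = V (b \<star> s) \<odot> L g"
      using f b L_V[of b] D.Comp_Ident_left[of "L g"] by simp
    finally show ?case
      using f b Bwd by (intro exI[of _ "b \<star> s"] exI[of _ g])
        (simp add: S_Comp C_simps S_MorD D.Dom_Comp D.Cod_Comp)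
  qed
  then show ?thesis using that by blast
qed

lemma fraction_V_change:
  assumes "s \<in> S" "a \<in> S" "Dom C a = Cod C s" "f \<in> Mor C" "Cod C f = Cod C s"
  shows "V s \<odot> L f = V (a \<star> s) \<odot> L (a \<star> f)"
proof -
  have "V s \<odot> L f = (V (a \<star> s) \<odot> L a) \<odot> L f" using V_S_Comp assms by simp
  then show ?thesis using assms by (simp add: D_simps S_Comp C_simps S_MorD L_Comp)
qed

text \<open>The two denominators start at the same object, so their targets lie in one pixel and map
  to a common object; by thinness the enlarged denominators coincide.\<close>

lemma fractions_common:
  assumes "m \<in> Mor D" "n \<in> Mor D" "Cod D m = Cod D n"
  obtains s f g where "s \<in> S" "f \<in> Mor C" "g \<in> Mor C" "Dom C f = Dom D m" "Dom C g = Dom D n"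
    "Dom C s = Cod D m" "Cod C f = Cod C s" "Cod C g = Cod C s" "m = V s \<odot> L f" "n = V s \<odot> L g"
proof -
  obtain s f where f: "s \<in> S" "f \<in> Mor C" "Dom C f = Dom D m" "Dom C s = Cod D m" "Cod C f = Cod C s"
    "m = V s \<odot> L f" using assms(1) by (rule fraction)
  obtain t g where g: "t \<in> S" "g \<in> Mor C" "Dom C g = Dom D n" "Dom C t = Cod D n" "Cod C g = Cod C t"
    "n = V t \<odot> L g" using assms(2) by (rule fraction)
  have "\<pi> (Cod C s) = \<pi> (Cod C t)" using S_pixel[of s] S_pixel[of t] f g assms by simp
  then obtain a b where ab: "a \<in> S" "a \<in> Mor C" "b \<in> S" "b \<in> Mor C" "Dom C a = Cod C s" "Dom C b = Cod C t"
    "Cod C b = Cod C a"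
    using directedE[of "Cod C s" "Cod C t"] Cod_in S_MorD f g by metis
  note facts = f(1-5) f(1)[THEN S_MorD] g(1-5) g(1)[THEN S_MorD] ab assms
  have "a \<star> s = b \<star> t"
    by (rule S_thin) (use facts in \<open>simp_all add: S_Comp C_simps\<close>)
  then have "m = V (a \<star> s) \<odot> L (a \<star> f)" "n = V (a \<star> s) \<odot> L (b \<star> g)"
    using f(6) g(6) fraction_V_change[of s a f] fraction_V_change[of t b g] facts by simp_all
  then show ?thesis
    by (intro that[of "a \<star> s" "a \<star> f" "b \<star> g"]) (use facts in \<open>simp_all add: S_Comp C_simps\<close>)
qed

text \<open>Over a common denominator, which cancels because it is invertible, the equation is one
  between images of morphisms of \<open>C\<close>. Faithfulness brings it back to \<open>C\<close>,
  where \<open>right_cancel\<close> applies.\<close>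

lemma L_epi:
  assumes "f \<in> Mor C" "m \<in> Mor D" "n \<in> Mor D" "Dom D m = Cod C f" "Dom D n = Cod C f"
    "Cod D m = Cod D n" "m \<odot> L f = n \<odot> L f"
  shows "m = n"
proof -
  obtain s g h where g: "s \<in> S" "g \<in> Mor C" "h \<in> Mor C" "Dom C g = Dom D m" "Dom C h = Dom D n"
    "Dom C s = Cod D m" "Cod C g = Cod C s" "Cod C h = Cod C s" "m = V s \<odot> L g" "n = V s \<odot> L h"
    using assms by (auto elim: fractions_common)
  have "V s \<odot> L (g \<star> f) = V s \<odot> L (h \<star> f)"
    using g assms by (simp add: D_simps L_Comp)
  then have "L (g \<star> f) = L (h \<star> f)"
    by (rule V_cancel[rotated -1]) (use g assms in \<open>simp_all add: C_simps\<close>)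
  then have "g \<star> f = h \<star> f"
    by (rule L_faithful[rotated -1]) (use g assms in \<open>simp_all add: C_simps\<close>)
  then have "g = h"
    by (rule right_cancel[rotated -1]) (use g assms in simp_all)
  then show ?thesis using g by simp
qed

text \<open>As for \<open>L_epi\<close>, except that the common denominator stands between
  \<open>L f\<close> and the numerators; an Ore square first moves it to the outside.\<close>

lemma L_mono:
  assumes "f \<in> Mor C" "m \<in> Mor D" "n \<in> Mor D" "Cod D m = Dom C f" "Cod D n = Dom C f"
    "Dom D m = Dom D n" "L f \<odot> m = L f \<odot> n"
  shows "m = n"
proof -
  obtain s g h where g: "s \<in> S" "g \<in> Mor C" "h \<in> Mor C" "Dom C g = Dom D m" "Dom C h = Dom D n"
    "Dom C s = Cod D m" "Cod C g = Cod C s" "Cod C h = Cod C s" "m = V s \<odot> L g" "n = V s \<odot> L h"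
    using assms by (auto elim: fractions_common)
  obtain b k where b: "b \<in> S" "b \<in> Mor C" "k \<in> Mor C" "Dom C b = Cod C f" "Dom C k = Cod C s"
      "Cod C k = Cod C b" "b \<star> f = k \<star> s"
    using g assms OreE[of s f] by metis
  have k: "L f \<odot> V s = V b \<odot> L k"
    using Ore_V_L[of s b f k] g b assms by simp
  have LfV: "L f \<odot> V s \<odot> L e = V b \<odot> L (k \<star> e)" if "e \<in> Mor C" "Cod C e = Cod C s" for e
  proof -
    have "L f \<odot> V s \<odot> L e = (L f \<odot> V s) \<odot> L e"
      using that g assms by (simp add: D_simps)
    also have "\<dots> = V b \<odot> L (k \<star> e)"
      unfolding k using that g b by (simp add: D_simps L_Comp)
    finally show ?thesis .
  qed
  have "V b \<odot> L (k \<star> g) = V b \<odot> L (k \<star> h)"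
    using g assms(7) LfV[of g] LfV[of h] by simp
  then have "L (k \<star> g) = L (k \<star> h)"
    by (rule V_cancel[rotated -1]) (use g b assms in \<open>simp_all add: C_simps\<close>)
  then have "k \<star> g = k \<star> h"
    by (rule L_faithful[rotated -1]) (use g b assms in \<open>simp_all add: C_simps\<close>)
  then have "g = h"
    by (rule left_cancel[rotated -1]) (use g b assms in simp_all)
  then show ?thesis using g by simp
qed

subsection \<open>The canonical isomorphisms within a pixel\<close>

definition can :: "'o \<Rightarrow> 'o \<Rightarrow> ('o \<times> 'm zig list \<times> 'o) set" where
  "can x y = (SOME m. \<exists>a\<in>S. \<exists>b\<in>S. Dom C a = x \<and> Dom C b = y \<and> Cod C b = Cod C a \<and> m = V b \<odot> L a)"

text \<open>Two cospans on the same pair of objects map to a third one by directedness, the legs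
  agree by thinness, and enlarging a denominator does not change the fraction. So the choice in
  \<open>can\<close> is immaterial.\<close>

lemma can_eq:
  assumes "a \<in> S" "b \<in> S" "Cod C b = Cod C a"
  shows "can (Dom C a) (Dom C b) = V b \<odot> L a"
proof -
  have unique: "V b' \<odot> L a' = V b \<odot> L a"
    if h: "a' \<in> S" "b' \<in> S" "Dom C a' = Dom C a" "Dom C b' = Dom C b" "Cod C b' = Cod C a'" for a' b'
  proof -
    have "\<pi> (Cod C a) = \<pi> (Cod C a')" using S_pixel[of a] S_pixel[of a'] h assms by simp
    then obtain c d where cd: "c \<in> S" "c \<in> Mor C" "d \<in> S" "d \<in> Mor C" "Dom C c = Cod C a"
      "Dom C d = Cod C a'" "Cod C d = Cod C c"
      using directedE[of "Cod C a" "Cod C a'"] Cod_in S_MorD h assms by metis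
    note facts = assms assms(1,2)[THEN S_MorD] h h(1,2)[THEN S_MorD] cd
    have eq: "c \<star> a = d \<star> a'" "c \<star> b = d \<star> b'"
      by (rule S_thin; use facts in \<open>simp add: S_Comp C_simps\<close>)+
    have "V b' \<odot> L a' = V (d \<star> b') \<odot> L (d \<star> a')"
      by (rule fraction_V_change) (use facts in simp_all)
    also have "\<dots> = V b \<odot> L a"
      unfolding eq[symmetric] by (rule fraction_V_change[symmetric]) (use facts in simp_all)
    finally show ?thesis .
  qed
  let ?P = "\<lambda>m. \<exists>a'\<in>S. \<exists>b'\<in>S. Dom C a' = Dom C a \<and> Dom C b' = Dom C b \<and> Cod C b' = Cod C a' \<and>
    m = V b' \<odot> L a'"
  have "?P (SOME m. ?P m)" using assms by (intro someI[of ?P]) blast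
  then show ?thesis unfolding can_def using unique by auto
qed

lemma canE:
  assumes "x \<in> Obj C" "y \<in> Obj C" "\<pi> x = \<pi> y"
  obtains a b where "a \<in> S" "b \<in> S" "a \<in> Mor C" "b \<in> Mor C" "Dom C a = x" "Dom C b = y"
    "Cod C b = Cod C a" "can x y = V b \<odot> L a"
  using directedE[OF assms] can_eq by metis

lemma can_in:
  assumes "x \<in> Obj C" "y \<in> Obj C" "\<pi> x = \<pi> y"
  shows "can x y \<in> Mor D" "Dom D (can x y) = x" "Cod D (can x y) = y"
  by (rule canE[OF assms], simp add: D_simps)+

lemma can_S: "s \<in> S \<Longrightarrow> can (Dom C s) (Cod C s) = L s"
  using can_eq[of s "Ident C (Cod C s)"] V_L[of "Ident C (Cod C s)"] Cod_in[of s]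
    L_Ident[of "Cod C s"] D.Comp_Ident_right[of "V (Ident C (Cod C s))"] D.Comp_Ident_left[of "L s"]
  by (simp add: S_Ident S_MorD C_simps)

lemma can_V: "s \<in> S \<Longrightarrow> can (Cod C s) (Dom C s) = V s"
  using can_eq[of "Ident C (Cod C s)" s] Cod_in[of s]
    L_Ident[of "Cod C s"] D.Comp_Ident_right[of "V s"]
  by (simp add: S_Ident S_MorD C_simps)

lemma can_refl: "x \<in> Obj C \<Longrightarrow> can x x = Ident D x"
  using can_S[of "Ident C x"] L_Ident by (simp add: S_Ident Dom_Ident Cod_Ident)

lemma can_can:
  assumes "x \<in> Obj C" "y \<in> Obj C" "z \<in> Obj C" "\<pi> x = \<pi> y" "\<pi> y = \<pi> z"
  shows "can y z \<odot> can x y = can x z"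
proof -
  obtain a b where ab: "a \<in> S" "b \<in> S" "a \<in> Mor C" "b \<in> Mor C" "Dom C a = x" "Dom C b = y"
    "Cod C b = Cod C a" "can x y = V b \<odot> L a"
    using assms canE by metis
  have "Cod C b \<in> Obj C" "\<pi> (Cod C b) = \<pi> z"
    using S_pixel[of b] ab assms Cod_in by auto
  \<comment> \<open>The second cospan is taken with a leg through the target of \<open>b\<close>, so
    that both fractions share the leg \<open>c \<star> b\<close>, which cancels.\<close>
  then obtain c d where cd: "c \<in> S" "c \<in> Mor C" "d \<in> S" "d \<in> Mor C" "Dom C c = Cod C b" "Dom C d = z"
    "Cod C d = Cod C c"
    using directedE[of "Cod C b" z] assms by metis
  have xy: "can x y = V (c \<star> b) \<odot> L (c \<star> a)"
    unfolding ab(8) by (rule fraction_V_change) (use ab(1-7) cd in simp_all)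
  have yz: "can y z = V d \<odot> L (c \<star> b)"
    using can_eq[of "c \<star> b" d] ab cd by (simp add: S_Comp C_simps)
  have xz: "can x z = V d \<odot> L (c \<star> a)"
    using can_eq[of "c \<star> a" d] ab cd by (simp add: S_Comp C_simps)
  have S: "c \<star> b \<in> S" "c \<star> a \<in> Mor C" "Cod C (c \<star> a) = Cod C (c \<star> b)" "Cod C (c \<star> b) = Cod C d"
    using ab cd by (simp_all add: S_Comp C_simps)
  define s where "s = c \<star> b"
  define t where "t = c \<star> a"
  note S = S[folded s_def t_def]
  have "(V d \<odot> L s) \<odot> V s \<odot> L t = V d \<odot> (L s \<odot> V s) \<odot> L t"
    using S cd by (simp add: D_simps S_MorD)
  also have "\<dots> = V d \<odot> L t"
    using S L_V[of s] D.Comp_Ident_left[of "L t"] by simp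
  finally show ?thesis
    unfolding xy yz xz s_def t_def .
qed

definition N :: "'m \<Rightarrow> ('o \<times> 'm zig list \<times> 'o) set" where
  "N f = can (Cod C f) (pt (\<pi> (Cod C f))) \<odot> L f \<odot> can (pt (\<pi> (Dom C f))) (Dom C f)"

lemmas can_simps = can_in pt_in pixel_pt Dom_in Cod_in

lemma N_Mor: "f \<in> Mor C \<Longrightarrow> N f \<in> Mor D"
  and Dom_N: "f \<in> Mor C \<Longrightarrow> Dom D (N f) = pt (\<pi> (Dom C f))"
  and Cod_N: "f \<in> Mor C \<Longrightarrow> Cod D (N f) = pt (\<pi> (Cod C f))"
  by (simp_all add: N_def D_simps can_simps)

lemma can_cancel:
  assumes "x \<in> Obj C" "y \<in> Obj C" "\<pi> x = \<pi> y" "m \<in> Mor D" "Cod D m = x"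
  shows "can y x \<odot> can x y \<odot> m = m"
  using assms D.Comp_Ident_left[of m]
  by (simp add: D.Comp_assoc can_in can_can can_refl)

lemma N_Comp:
  assumes "f \<in> Mor C" "g \<in> Mor C" "Cod C f = Dom C g"
  shows "N (g \<star> f) = N g \<odot> N f"
  using assms can_cancel[of "Cod C f" "pt (\<pi> (Cod C f))" "L f \<odot> can (pt (\<pi> (Dom C f))) (Dom C f)"]
  by (simp add: N_def D_simps can_simps C_simps L_Comp)

text \<open>A pixel morphism is itself a canonical isomorphism, and composites of canonical
  isomorphisms are canonical.\<close>

lemma N_S:
  assumes "s \<in> S"
  shows "N s = Ident D (pt (\<pi> (Dom C s)))"
  unfolding N_def can_S[OF assms, symmetric]
  using assms S_pixel[of s] by (simp add: can_can can_refl can_simps S_MorD)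

text \<open>At a chosen point the conjugation is trivial, and on the target side it is the inverse
  of \<open>s\<close>. This identifies pseudo arrows, which are fractions between chosen points,
  with values of \<open>N\<close>.\<close>

lemma N_fraction:
  assumes "f \<in> Mor C" "s \<in> S" "Cod C f = Cod C s" "pt (\<pi> (Dom C f)) = Dom C f" "pt (\<pi> (Dom C s)) = Dom C s"
  shows "N f = V s \<odot> L f"
proof -
  have "\<pi> (Cod C f) = \<pi> (Dom C s)" using S_pixel assms by simp
  then show ?thesis
    using assms can_V[of s] D.Comp_Ident_right[of "L f"] by (simp add: N_def can_refl Dom_in)
qed

lemma N_full:
  assumes "m \<in> Mor D" "pt (\<pi> (Dom D m)) = Dom D m" "pt (\<pi> (Cod D m)) = Cod D m"
  obtains f where "f \<in> Mor C" "Dom C f = Dom D m" "\<pi> (Cod C f) = \<pi> (Cod D m)" "N f = m"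
proof -
  obtain s f where f: "s \<in> S" "f \<in> Mor C" "Dom C f = Dom D m" "Dom C s = Cod D m" "Cod C f = Cod C s"
    "m = V s \<odot> L f" using assms(1) by (rule fraction)
  show ?thesis
    by (rule that[of f]) (use f assms S_pixel[of s] N_fraction[of f s] in simp_all)
qed

lemma N_epi:
  assumes "f \<in> Mor C" "m \<in> Mor D" "n \<in> Mor D" "Dom D m = pt (\<pi> (Cod C f))" "Dom D n = pt (\<pi> (Cod C f))"
    "Cod D m = Cod D n" "m \<odot> N f = n \<odot> N f"
  shows "m = n"
proof -
  let ?p = "can (pt (\<pi> (Dom C f))) (Dom C f)" and ?q = "can (Cod C f) (pt (\<pi> (Cod C f)))"
  have "((m \<odot> ?q) \<odot> L f) \<odot> ?p = ((n \<odot> ?q) \<odot> L f) \<odot> ?p"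
    using assms by (simp add: N_def D_simps can_simps)
  then have "(m \<odot> ?q) \<odot> L f = (n \<odot> ?q) \<odot> L f"
    by (rule D.retraction_cancel[rotated -1, where g = "can (Dom C f) (pt (\<pi> (Dom C f)))"])
      (use assms in \<open>simp_all add: can_can can_refl can_simps D_simps\<close>)
  then have "m \<odot> ?q = n \<odot> ?q"
    by (rule L_epi[rotated -1]) (use assms in \<open>simp_all add: can_simps D_simps\<close>)
  then show ?thesis
    by (rule D.retraction_cancel[rotated -1, where g = "can (pt (\<pi> (Cod C f))) (Cod C f)"])
      (use assms in \<open>simp_all add: can_can can_refl can_simps D_simps\<close>)
qed

lemma N_mono:
  assumes "f \<in> Mor C" "m \<in> Mor D" "n \<in> Mor D" "Cod D m = pt (\<pi> (Dom C f))" "Cod D n = pt (\<pi> (Dom C f))"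
    "Dom D m = Dom D n" "N f \<odot> m = N f \<odot> n"
  shows "m = n"
proof -
  let ?p = "can (pt (\<pi> (Dom C f))) (Dom C f)" and ?q = "can (Cod C f) (pt (\<pi> (Cod C f)))"
  have "?q \<odot> L f \<odot> ?p \<odot> m = ?q \<odot> L f \<odot> ?p \<odot> n"
    using assms by (simp add: N_def D_simps can_simps)
  then have "L f \<odot> ?p \<odot> m = L f \<odot> ?p \<odot> n"
    by (rule D.section_cancel[rotated -1, where g = "can (pt (\<pi> (Cod C f))) (Cod C f)"])
      (use assms in \<open>simp_all add: can_can can_refl can_simps D_simps\<close>)
  then have "?p \<odot> m = ?p \<odot> n"
    by (rule L_mono[rotated -1]) (use assms in \<open>simp_all add: can_simps D_simps\<close>)
  then show ?thesis
    by (rule D.section_cancel[rotated -1, where g = "can (Dom C f) (pt (\<pi> (Dom C f)))"])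
      (use assms in \<open>simp_all add: can_can can_refl can_simps D_simps\<close>)
qed

text \<open>A left inverse, written as a fraction and brought to a common denominator with the
  canonical isomorphism, becomes an equation \<open>d \<star> a = c \<star> h \<star> f\<close> in
  \<open>C\<close>. Its left side lies in \<open>S\<close>, so \<open>S_factor\<close> forces
  \<open>f\<close> into \<open>S\<close>.\<close>

lemma N_retraction:
  assumes "f \<in> Mor C" "m \<in> Mor D" "Dom D m = pt (\<pi> (Cod C f))" "m \<odot> N f = Ident D (pt (\<pi> (Dom C f)))"
  shows "f \<in> S"
proof -
  let ?x = "pt (\<pi> (Dom C f))" and ?q = "can (Cod C f) (pt (\<pi> (Cod C f)))"
  have Cod_m: "Cod D m = ?x"
    using D.Cod_Comp[of "N f" m] assms by (simp add: D.Cod_Ident N_Mor Cod_N can_simps)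
  have "(m \<odot> ?q \<odot> L f) \<odot> can ?x (Dom C f) = can (Dom C f) ?x \<odot> can ?x (Dom C f)"
    using assms by (simp add: N_def D_simps can_simps can_can can_refl)
  then have eq: "m \<odot> ?q \<odot> L f = can (Dom C f) ?x"
    by (rule D.retraction_cancel[rotated -1, where g = "can (Dom C f) ?x"])
      (use assms in \<open>simp_all add: can_can can_refl can_simps D_simps\<close>)
  obtain a b where ab: "a \<in> S" "b \<in> S" "a \<in> Mor C" "b \<in> Mor C" "Dom C a = Dom C f" "Dom C b = ?x"
    "Cod C b = Cod C a" "can (Dom C f) ?x = V b \<odot> L a"
    using canE[of "Dom C f" ?x] assms by (metis Dom_in pt_in pixel_pt)
  have mq: "m \<odot> ?q \<in> Mor D" "Dom D (m \<odot> ?q) = Cod C f" "Cod D (m \<odot> ?q) = ?x"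
    using assms Cod_m by (simp_all add: D_simps can_simps)
  obtain s h where h: "s \<in> S" "h \<in> Mor C" "Dom C h = Cod C f" "Dom C s = ?x" "Cod C h = Cod C s"
    "m \<odot> ?q = V s \<odot> L h"
    using fraction[OF mq(1)] unfolding mq by metis
  have "\<pi> (Cod C s) = \<pi> (Cod C b)" using S_pixel[of s] S_pixel[of b] h ab by simp
  then obtain c d where cd: "c \<in> S" "c \<in> Mor C" "d \<in> S" "d \<in> Mor C" "Dom C c = Cod C s"
    "Dom C d = Cod C b" "Cod C d = Cod C c"
    using directedE[of "Cod C s" "Cod C b"] Cod_in S_MorD ab h by metis
  note facts = assms(1) ab(1-7) h(1-5) S_MorD[OF h(1)] cd
  have ts: "c \<star> s = d \<star> b"
    by (rule S_thin) (use facts in \<open>simp_all add: S_Comp C_simps\<close>)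
  have "V (d \<star> b) \<odot> L (d \<star> a) = m \<odot> ?q \<odot> L f"
    unfolding eq ab(8) by (rule fraction_V_change[symmetric]) (use facts in simp_all)
  also have "\<dots> = (V s \<odot> L h) \<odot> L f"
    unfolding h(6)[symmetric] using assms by (simp add: D_simps can_simps)
  also have "V s \<odot> L h = V (d \<star> b) \<odot> L (c \<star> h)"
    unfolding ts[symmetric] by (rule fraction_V_change) (use facts in simp_all)
  also have "(V (d \<star> b) \<odot> L (c \<star> h)) \<odot> L f = V (d \<star> b) \<odot> L (c \<star> h) \<odot> L f"
    using facts by (simp add: D_simps S_Comp C_simps)
  also have "\<dots> = V (d \<star> b) \<odot> L (c \<star> h \<star> f)"
    using facts by (simp add: C_simps flip: L_Comp)
  finally have "L (d \<star> a) = L (c \<star> h \<star> f)"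
    by (rule V_cancel[rotated -1]) (use facts in \<open>simp_all add: S_Comp C_simps\<close>)
  then have "d \<star> a = c \<star> h \<star> f"
    by (rule L_faithful[rotated -1]) (use facts in \<open>simp_all add: C_simps\<close>)
  then have "(c \<star> h) \<star> f \<in> S" using facts S_Comp[of a d] by (simp add: C_simps)
  then show ?thesis using S_factor[of f "c \<star> h"] facts by (simp add: C_simps)
qed

end

section \<open>Paths\<close>

text \<open>Continuous images of intervals are connected, hence intervals. The explicit maps used
  below are piecewise affine.\<close>

lemma reparamI:
  assumes "continuous_on {0..1} \<phi>" "mono_on {0..1} \<phi>" "0 \<le> \<phi> 0" "\<phi> 1 \<le> 1"
  shows "reparam \<phi>"
  unfolding reparam_def
proof (intro conjI allI impI)
  show "\<phi> \<in> {0..1} \<rightarrow> {0..1}"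
  proof
    fix t :: real assume t: "t \<in> {0..1}"
    have "\<phi> 0 \<le> \<phi> t" "\<phi> t \<le> \<phi> 1"
      using t mono_onD[OF assms(2), of 0 t] mono_onD[OF assms(2), of t 1] by simp_all
    then show "\<phi> t \<in> {0..1}" using assms by simp
  qed
  fix I :: "real set" assume I: "I \<subseteq> {0..1}" "is_interval I"
  have "connected (\<phi> ` I)"
    by (rule connected_continuous_image[OF continuous_on_subset[OF assms(1) I(1)] is_interval_connected[OF I(2)]])
  then show "is_interval (\<phi> ` I)" by (rule is_interval_connected_1[THEN iffD2])
qed (rule assms(2))

lemma reparam_in: "reparam \<phi> \<Longrightarrow> t \<in> {0..1} \<Longrightarrow> \<phi> t \<in> {0..1}"
  unfolding reparam_def by blast

lemma reparam_interval: "reparam \<phi> \<Longrightarrow> I \<subseteq> {0..1} \<Longrightarrow> is_interval I \<Longrightarrow> is_interval (\<phi> ` I)"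
  unfolding reparam_def by blast

lemma reparam_mono: "reparam \<phi> \<Longrightarrow> 0 \<le> s \<Longrightarrow> s \<le> t \<Longrightarrow> t \<le> 1 \<Longrightarrow> \<phi> s \<le> \<phi> t"
  unfolding reparam_def by (elim conjE, drule mono_onD[of _ _ s t]) simp_all

text \<open>The condition that intervals go to intervals stands in for continuity; it is applied to
  \<open>{a..b}\<close>.\<close>

lemma reparam_IVT:
  assumes "reparam \<phi>" "0 \<le> a" "a \<le> b" "b \<le> 1" "\<phi> a \<le> y" "y \<le> \<phi> b"
  obtains t where "a \<le> t" "t \<le> b" "\<phi> t = y"
proof -
  have "is_interval (\<phi> ` {a..b})"
    by (rule reparam_interval[OF assms(1)]) (use assms in \<open>auto simp: is_interval_cc\<close>)
  moreover have "\<phi> a \<in> \<phi> ` {a..b}" "\<phi> b \<in> \<phi> ` {a..b}" using assms by auto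
  ultimately have "y \<in> \<phi> ` {a..b}"
    using assms(5,6) unfolding is_interval_1 by blast
  then show ?thesis using that by auto
qed

lemma reparam_affine: "0 \<le> a \<Longrightarrow> a \<le> b \<Longrightarrow> b \<le> 1 \<Longrightarrow> reparam (\<lambda>t. a + (b - a) * t)"
  by (rule reparamI) (auto intro!: continuous_intros mono_onI mult_left_mono)

lemma reparam_compose:
  assumes "reparam \<phi>" "reparam \<psi>"
  shows "reparam (\<phi> \<circ> \<psi>)"
  unfolding reparam_def
proof (intro conjI allI impI)
  show "\<phi> \<circ> \<psi> \<in> {0..1} \<rightarrow> {0..1}"
    using reparam_in[OF assms(1)] reparam_in[OF assms(2)] by (intro Pi_I) (simp del: atLeastAtMost_iff)
  show "mono_on {0..1} (\<phi> \<circ> \<psi>)"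
  proof (rule mono_onI)
    fix u v :: real assume *: "u \<in> {0..1}" "v \<in> {0..1}" "u \<le> v"
    have "\<psi> u \<in> {0..1}" "\<psi> v \<in> {0..1}" using reparam_in[OF assms(2)] * by blast+
    moreover have "\<psi> u \<le> \<psi> v" using * by (intro reparam_mono[OF assms(2)]) auto
    ultimately show "(\<phi> \<circ> \<psi>) u \<le> (\<phi> \<circ> \<psi>) v" by (auto intro: reparam_mono[OF assms(1)])
  qed
  fix I :: "real set" assume I: "I \<subseteq> {0..1}" "is_interval I"
  have "is_interval (\<psi> ` I)" "\<psi> ` I \<subseteq> {0..1}"
    using reparam_interval[OF assms(2) I] reparam_in[OF assms(2)] I(1) by blast+
  then show "is_interval ((\<phi> \<circ> \<psi>) ` I)"
    unfolding image_comp[symmetric] by (intro reparam_interval[OF assms(1)])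
qed

definition sub_path :: "(real \<Rightarrow> 'a) \<Rightarrow> real \<Rightarrow> real \<Rightarrow> real \<Rightarrow> 'a" where
  "sub_path \<gamma> a b = (\<lambda>t \<in> {0..1}. \<gamma> (a + (b - a) * t))"

lemma sub_path_eq_compose: "sub_path \<gamma> a b = compose {0..1} \<gamma> (\<lambda>t. a + (b - a) * t)"
  by (simp add: sub_path_def compose_def)

lemma sub_path_simps [simp]:
  "0 \<le> t \<Longrightarrow> t \<le> 1 \<Longrightarrow> sub_path \<gamma> a b t = \<gamma> (a + (b - a) * t)"
  by (simp add: sub_path_def)

lemma path_join_simps [simp]:
  "(\<gamma> \<cdot> \<gamma>') 0 = \<gamma> 0" "(\<gamma> \<cdot> \<gamma>') 1 = \<gamma>' 1"
  by (simp_all add: path_join_def)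

lemma path_join_left: "0 \<le> t \<Longrightarrow> t \<le> 1/2 \<Longrightarrow> (\<gamma> \<cdot> \<gamma>') t = \<gamma> (2 * t)"
  by (simp add: path_join_def)

lemma path_join_right:
  assumes "1/2 \<le> t" "t \<le> 1" "\<gamma> 1 = \<gamma>' 0"
  shows "(\<gamma> \<cdot> \<gamma>') t = \<gamma>' (2 * t - 1)"
proof (cases "t = 1/2")
  case True
  show ?thesis unfolding True using assms(3) by (simp add: path_join_def)
qed (use assms in \<open>simp add: path_join_def\<close>)

lemma const_path_simps [simp]: "0 \<le> t \<Longrightarrow> t \<le> 1 \<Longrightarrow> const_path x t = x"
  by (simp add: const_path_def)

lemma path_join_ext: "\<gamma> \<cdot> \<gamma>' \<in> extensional {0..1}"
  by (simp add: path_join_def)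

lemma im_join:
  assumes "\<gamma> 1 = \<gamma>' 0"
  shows "im (\<gamma> \<cdot> \<gamma>') = im \<gamma> \<union> im \<gamma>'"
proof -
  have "(\<gamma> \<cdot> \<gamma>') t \<in> im \<gamma> \<union> im \<gamma>'" if "t \<in> {0..1}" for t
  proof (cases "t \<le> 1/2")
    case True
    have "(\<gamma> \<cdot> \<gamma>') t \<in> im \<gamma>"
      using path_join_left[of t \<gamma> \<gamma>'] True that
      by (intro image_eqI[of _ \<gamma> "2 * t"]) auto
    then show ?thesis ..
  next
    case False
    have "(\<gamma> \<cdot> \<gamma>') t \<in> im \<gamma>'"
      using path_join_right[of t \<gamma> \<gamma>', OF _ _ assms] False that
      by (intro image_eqI[of _ \<gamma>' "2 * t - 1"]) auto
    then show ?thesis ..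
  qed
  moreover have "\<gamma> t \<in> im (\<gamma> \<cdot> \<gamma>')" if "t \<in> {0..1}" for t
    using that path_join_left[of "t/2" \<gamma> \<gamma>'] by (intro image_eqI[of _ _ "t/2"]) auto
  moreover have "\<gamma>' t \<in> im (\<gamma> \<cdot> \<gamma>')" if "t \<in> {0..1}" for t
    using that path_join_right[of "(t+1)/2" \<gamma> \<gamma>', OF _ _ assms] by (intro image_eqI[of _ _ "(t+1)/2"]) (auto simp: add_divide_distrib)
  ultimately show ?thesis by blast
qed

lemma im_subsetD: "im \<gamma> \<subseteq> Y \<Longrightarrow> 0 \<le> t \<Longrightarrow> t \<le> 1 \<Longrightarrow> \<gamma> t \<in> Y"
  by auto

section \<open>Joins of paths modulo equivalence\<close>

context triple
begin

lemma path_ext: "\<gamma> \<in> \<Gamma> \<Longrightarrow> \<gamma> \<in> extensional {0..1}"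
  using paths by (auto simp: PiE_def)

lemma path_in: "\<gamma> \<in> \<Gamma> \<Longrightarrow> 0 \<le> t \<Longrightarrow> t \<le> 1 \<Longrightarrow> \<gamma> t \<in> X"
  using paths PiE_mem[of \<gamma> "{0..1}" "\<lambda>_. X" t] by auto

lemma R_sym: "(\<gamma>, \<gamma>') \<in> R \<Longrightarrow> (\<gamma>', \<gamma>) \<in> R"
  using equiv by (auto simp: equiv_def sym_def)

lemma R_trans [trans]: "(\<gamma>, \<gamma>') \<in> R \<Longrightarrow> (\<gamma>', \<gamma>'') \<in> R \<Longrightarrow> (\<gamma>, \<gamma>'') \<in> R"
  using equiv by (meson equiv_def transD)

lemma R_in: "(\<gamma>, \<gamma>') \<in> R \<Longrightarrow> \<gamma> \<in> \<Gamma> \<and> \<gamma>' \<in> \<Gamma>"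
  using equiv by (auto simp: equiv_def refl_on_def)

lemma R_reparamI:
  assumes "\<gamma> \<in> \<Gamma>" "reparam \<phi>" "\<phi> 0 = 0" "\<phi> 1 = 1" "\<delta> \<in> extensional {0..1}"
    "\<And>t. 0 \<le> t \<Longrightarrow> t \<le> 1 \<Longrightarrow> \<delta> t = \<gamma> (\<phi> t)"
  shows "(\<gamma>, \<delta>) \<in> R"
proof -
  have "\<delta> = compose {0..1} \<gamma> \<phi>"
    by (rule extensionalityI[of _ "{0..1}"]) (use assms in \<open>auto simp: compose_def\<close>)
  then show ?thesis using equiv_reparam assms by simp
qed

lemma sub_path_in: "\<gamma> \<in> \<Gamma> \<Longrightarrow> 0 \<le> a \<Longrightarrow> a \<le> b \<Longrightarrow> b \<le> 1 \<Longrightarrow> sub_path \<gamma> a b \<in> \<Gamma>"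
  unfolding sub_path_eq_compose by (rule reparam) (simp_all add: reparam_affine)

lemma R_unit_right: "\<gamma> \<in> \<Gamma> \<Longrightarrow> (\<gamma>, \<gamma> \<cdot> const_path (\<gamma> 1)) \<in> R"
  by (rule R_reparamI[of _ "\<lambda>t. min 1 (2 * t)"])
    (auto intro!: reparamI continuous_intros mono_onI path_join_ext simp: path_join_def)

lemma R_unit_left: "\<gamma> \<in> \<Gamma> \<Longrightarrow> (\<gamma>, const_path (\<gamma> 0) \<cdot> \<gamma>) \<in> R"
  by (rule R_reparamI[of _ "\<lambda>t. max 0 (2 * t - 1)"])
    (auto intro!: reparamI continuous_intros mono_onI path_join_ext simp: path_join_def)

text \<open>The bracketing is that of \<open>cancel\<close>: with \<open>\<cdot>\<close> associating
  to the left, the constant path is joined to \<gamma> before \<delta> is. This is the padding used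
  in \<open>R_cancel_right\<close>.\<close>

lemma R_unit_left_join:
  assumes "\<gamma> \<cdot> \<delta> \<in> \<Gamma>"
  shows "(\<gamma> \<cdot> \<delta>, const_path (\<gamma> 0) \<cdot> \<gamma> \<cdot> \<delta>) \<in> R"
\<comment> \<open>The map waits at 0 until 1/4, runs at double speed until it catches up with
  \<open>t\<close> at 1/2, and is the identity from there.\<close>
proof (rule R_reparamI[of _ "\<lambda>t. max 0 (min t (2 * t - 1/2))"])
  show "reparam (\<lambda>t. max 0 (min t (2 * t - 1/2)))"
    by (rule reparamI) (auto intro!: continuous_intros mono_onI)
  fix t :: real assume t: "0 \<le> t" "t \<le> 1"
  consider "t \<le> 1/4" | "1/4 < t" "t \<le> 1/2" | "1/2 < t" by linarith
  then show "(const_path (\<gamma> 0) \<cdot> \<gamma> \<cdot> \<delta>) t = (\<gamma> \<cdot> \<delta>) (max 0 (min t (2 * t - 1/2)))"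
  proof cases
    case 1
    then have "max 0 (min t (2 * t - 1/2)) = 0" by (simp add: max_def min_def)
    then show ?thesis using 1 t by (simp add: path_join_def)
  next
    case 2
    then have "max 0 (min t (2 * t - 1/2)) = 2 * t - 1/2" by (simp add: max_def min_def)
    then show ?thesis using 2 t by (simp add: path_join_def algebra_simps)
  next
    case 3
    then have "max 0 (min t (2 * t - 1/2)) = t" by (simp add: max_def min_def)
    then show ?thesis using 3 t by (simp add: path_join_def)
  qed
qed (use assms in \<open>simp_all add: path_join_ext\<close>)

lemma R_assoc:
  assumes "\<alpha> \<cdot> \<beta> \<cdot> \<gamma> \<in> \<Gamma>"
  shows "(\<alpha> \<cdot> \<beta> \<cdot> \<gamma>, \<alpha> \<cdot> (\<beta> \<cdot> \<gamma>)) \<in> R"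
\<comment> \<open>The three affine branches send the pieces cut at 1/2 and 3/4 to the pieces cut at
  1/4 and 1/2.\<close>
proof (rule R_reparamI[of _ "\<lambda>t. max (max (t / 2) (t - 1/4)) (2 * t - 1)"])
  show "reparam (\<lambda>t. max (max (t / 2) (t - 1/4)) (2 * t - 1))"
    by (rule reparamI) (auto intro!: continuous_intros mono_onI max.mono)
  fix t :: real assume t: "0 \<le> t" "t \<le> 1"
  consider "t \<le> 1/2" | "1/2 < t" "t \<le> 3/4" | "3/4 < t" by linarith
  then show "(\<alpha> \<cdot> (\<beta> \<cdot> \<gamma>)) t = (\<alpha> \<cdot> \<beta> \<cdot> \<gamma>) (max (max (t / 2) (t - 1/4)) (2 * t - 1))"
  proof cases
    case 1
    then have "max (max (t / 2) (t - 1/4)) (2 * t - 1) = t / 2" by (simp add: max_def)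
    then show ?thesis using 1 t by (simp add: path_join_def)
  next
    case 2
    then have "max (max (t / 2) (t - 1/4)) (2 * t - 1) = t - 1/4" by (simp add: max_def)
    then show ?thesis using 2 t by (simp add: path_join_def algebra_simps)
  next
    case 3
    then have "max (max (t / 2) (t - 1/4)) (2 * t - 1) = 2 * t - 1" by (simp add: max_def)
    then show ?thesis using 3 t by (simp add: path_join_def)
  qed
qed (use assms in \<open>simp_all add: path_join_ext\<close>)

lemma R_sub_path_join:
  assumes "\<gamma> \<in> \<Gamma>" "0 \<le> a" "a \<le> b" "b \<le> c" "c \<le> 1"
  shows "(sub_path \<gamma> a c, sub_path \<gamma> a b \<cdot> sub_path \<gamma> b c) \<in> R"
proof -
  \<comment> \<open>\<open>p\<close> is the relative position of \<open>b\<close> in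
    \<open>{a..c}\<close>. If \<open>a = c\<close>, division by zero gives 0, and the three facts
    below still hold.\<close>
  define p where "p = (b - a) / (c - a)"
  have p: "0 \<le> p" "p \<le> 1" "(c - a) * p = b - a"
    using assms by (auto simp: p_def divide_simps)
  \<comment> \<open>Half of the time is spent up to \<open>p\<close> and half from \<open>p\<close>
    on, as in the join.\<close>
  define \<phi> where "\<phi> t = p * min 1 (2 * t) + (1 - p) * max 0 (2 * t - 1)" for t
  have "mono_on {0..1} \<phi>"
    unfolding \<phi>_def using p by (intro mono_onI add_mono mult_left_mono) auto
  then have \<phi>: "reparam \<phi>"
    by (rule reparamI[rotated]) (auto simp: \<phi>_def intro!: continuous_intros)
  have left: "a + (c - a) * \<phi> t = a + (b - a) * (2 * t)" if "t \<le> 1/2" for t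
  proof -
    have "min 1 (2 * t) = 2 * t" "max 0 (2 * t - 1) = 0" using that by auto
    then have "(c - a) * \<phi> t = ((c - a) * p) * (2 * t)" by (simp add: \<phi>_def)
    then show ?thesis unfolding p(3) by simp
  qed
  have right: "a + (c - a) * \<phi> t = b + (c - b) * (2 * t - 1)" if "t > 1/2" for t
  proof -
    have "min 1 (2 * t) = 1" "max 0 (2 * t - 1) = 2 * t - 1" using that by auto
    then have "(c - a) * \<phi> t = (c - a) * p + ((c - a) - (c - a) * p) * (2 * t - 1)"
      by (simp add: \<phi>_def algebra_simps)
    then have "(c - a) * \<phi> t = (b - a) + ((c - a) - (b - a)) * (2 * t - 1)" unfolding p(3) .
    then show ?thesis by (simp add: algebra_simps)
  qed
  show ?thesis
  proof (rule R_reparamI[OF _ \<phi>])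
    fix t :: real assume t: "0 \<le> t" "t \<le> 1"
    have "0 \<le> \<phi> t" "\<phi> t \<le> 1" using reparam_in[OF \<phi>, of t] t by auto
    then show "(sub_path \<gamma> a b \<cdot> sub_path \<gamma> b c) t = sub_path \<gamma> a c (\<phi> t)"
      using t left[of t] right[of t] by (cases "t \<le> 1/2") (simp_all add: path_join_def)
  qed (use assms in \<open>auto simp: \<phi>_def sub_path_in path_join_ext\<close>)
qed

text \<open>\<open>cancel\<close> has a path on either side; a constant path, absorbed up to
  equivalence, supplies the missing one.\<close>

lemma R_cancel_left:
  assumes "\<gamma> \<in> \<Gamma>" "\<gamma>' \<in> \<Gamma>" "\<rho> \<in> \<Gamma>" "\<rho> 1 = \<gamma> 0" "\<rho> 1 = \<gamma>' 0" "\<gamma> 1 = \<gamma>' 1"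
  shows "(\<gamma>, \<gamma>') \<in> R \<longleftrightarrow> (\<rho> \<cdot> \<gamma>, \<rho> \<cdot> \<gamma>') \<in> R"
proof -
  let ?e = "const_path (\<gamma> 1)"
  have e: "?e \<in> \<Gamma>" using assms const path_in[of \<gamma> 1] by simp
  have "(\<rho> \<cdot> \<gamma>, \<rho> \<cdot> \<gamma> \<cdot> ?e) \<in> R" "(\<rho> \<cdot> \<gamma>', \<rho> \<cdot> \<gamma>' \<cdot> ?e) \<in> R"
    using R_unit_right[of "\<rho> \<cdot> \<gamma>"] R_unit_right[of "\<rho> \<cdot> \<gamma>'"] join assms by simp_all
  moreover have "(\<gamma>, \<gamma>') \<in> R \<longleftrightarrow> (\<rho> \<cdot> \<gamma> \<cdot> ?e, \<rho> \<cdot> \<gamma>' \<cdot> ?e) \<in> R"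
    using assms e by (intro cancel) (auto intro!: join)
  ultimately show ?thesis by (meson R_sym R_trans)
qed

lemma R_cancel_right:
  assumes "\<gamma> \<in> \<Gamma>" "\<gamma>' \<in> \<Gamma>" "\<rho> \<in> \<Gamma>" "\<gamma> 1 = \<rho> 0" "\<gamma>' 1 = \<rho> 0" "\<gamma> 0 = \<gamma>' 0"
  shows "(\<gamma>, \<gamma>') \<in> R \<longleftrightarrow> (\<gamma> \<cdot> \<rho>, \<gamma>' \<cdot> \<rho>) \<in> R"
proof -
  let ?e = "const_path (\<gamma> 0)"
  have e: "?e \<in> \<Gamma>" using assms const path_in[of \<gamma> 0] by simp
  have "(\<gamma> \<cdot> \<rho>, ?e \<cdot> \<gamma> \<cdot> \<rho>) \<in> R" "(\<gamma>' \<cdot> \<rho>, ?e \<cdot> \<gamma>' \<cdot> \<rho>) \<in> R"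
    using R_unit_left_join[of \<gamma> \<rho>] R_unit_left_join[of \<gamma>' \<rho>] join assms by simp_all
  moreover have "(\<gamma>, \<gamma>') \<in> R \<longleftrightarrow> (?e \<cdot> \<gamma> \<cdot> \<rho>, ?e \<cdot> \<gamma>' \<cdot> \<rho>) \<in> R"
    using assms e by (intro cancel) (auto intro!: join)
  ultimately show ?thesis by (meson R_sym R_trans)
qed

lemma R_join:
  assumes "(\<gamma>, \<gamma>') \<in> R" "(\<delta>, \<delta>') \<in> R" "\<gamma> 1 = \<delta> 0"
  shows "(\<gamma> \<cdot> \<delta>, \<gamma>' \<cdot> \<delta>') \<in> R"
proof -
  note facts = assms R_in[OF assms(1)] R_in[OF assms(2)] endpoints[OF assms(1)] endpoints[OF assms(2)]
  have "(\<gamma> \<cdot> \<delta>, \<gamma>' \<cdot> \<delta>) \<in> R" using facts R_cancel_right[of \<gamma> \<gamma>' \<delta>] by simp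
  also have "(\<gamma>' \<cdot> \<delta>, \<gamma>' \<cdot> \<delta>') \<in> R" using facts R_cancel_left[of \<delta> \<delta>' \<gamma>'] by simp
  finally show ?thesis .
qed

lemma path_structure_simps:
  "Obj (path_structure X \<Gamma>) = X" "Mor (path_structure X \<Gamma>) = \<Gamma>"
  "Dom (path_structure X \<Gamma>) \<gamma> = \<gamma> 0" "Cod (path_structure X \<Gamma>) \<gamma> = \<gamma> 1"
  "Ident (path_structure X \<Gamma>) = const_path" "Comp (path_structure X \<Gamma>) \<gamma>' \<gamma> = \<gamma> \<cdot> \<gamma>'"
  by (simp_all add: path_structure_def)

lemma congruence_path_structure: "congruence (path_structure X \<Gamma>) R"
proof
  show "equiv (Mor (path_structure X \<Gamma>)) R" using equiv by (simp add: path_structure_simps)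
qed (auto simp: path_structure_simps path_in const join endpoints R_join R_assoc[THEN R_sym]
    R_unit_left[THEN R_sym] R_unit_right[THEN R_sym] R_assoc)

sublocale PC: congruence "path_structure X \<Gamma>" R
  by (rule congruence_path_structure)

lemma path_cat_simps:
  "Obj (path_cat X \<Gamma> R) = X"
  "\<gamma> \<in> \<Gamma> \<Longrightarrow> R `` {\<gamma>} \<in> Mor (path_cat X \<Gamma> R)"
  "\<gamma> \<in> \<Gamma> \<Longrightarrow> Dom (path_cat X \<Gamma> R) (R `` {\<gamma>}) = \<gamma> 0"
  "\<gamma> \<in> \<Gamma> \<Longrightarrow> Cod (path_cat X \<Gamma> R) (R `` {\<gamma>}) = \<gamma> 1"
  "Ident (path_cat X \<Gamma> R) x = R `` {const_path x}"
  "\<gamma> \<in> \<Gamma> \<Longrightarrow> \<gamma>' \<in> \<Gamma> \<Longrightarrow> \<gamma> 1 = \<gamma>' 0 \<Longrightarrow>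
    Comp (path_cat X \<Gamma> R) (R `` {\<gamma>'}) (R `` {\<gamma>}) = R `` {\<gamma> \<cdot> \<gamma>'}"
  unfolding path_cat_def
  using PC.Mor_quotI[of \<gamma>] PC.Dom_quot[of \<gamma>] PC.Cod_quot[of \<gamma>] PC.Comp_quot[of \<gamma> \<gamma>']
  by (simp_all add: path_structure_simps)

lemma path_class_eq: "\<gamma> \<in> \<Gamma> \<Longrightarrow> \<gamma>' \<in> \<Gamma> \<Longrightarrow> R `` {\<gamma>} = R `` {\<gamma>'} \<longleftrightarrow> (\<gamma>, \<gamma>') \<in> R"
  using PC.cls_eq by (simp add: path_structure_simps)

lemma path_cat_MorE:
  assumes "f \<in> Mor (path_cat X \<Gamma> R)"
  obtains \<gamma> where "\<gamma> \<in> \<Gamma>" "f = R `` {\<gamma>}"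
  using PC.Mor_quotE[of f] assms unfolding path_cat_def by (auto simp: path_structure_simps)

lemma category_path_cat: "category (path_cat X \<Gamma> R)"
  unfolding path_cat_def by (rule PC.category_quot)

end

section \<open>Screens\<close>

context screen
begin

definition in_pixel :: "(real \<Rightarrow> 'a) \<Rightarrow> bool" where
  "in_pixel \<gamma> \<longleftrightarrow> (\<exists>Y \<in> P. im \<gamma> \<subseteq> Y)"

definition pix :: "'a \<Rightarrow> 'a set" where
  "pix x = (THE Y. Y \<in> P \<and> x \<in> Y)"

lemma pix_eqI: "Y \<in> P \<Longrightarrow> x \<in> Y \<Longrightarrow> pix x = Y"
  unfolding pix_def using partition by (intro the_equality) (auto simp: partition_on_def disjoint_def)

lemma pix_in: "x \<in> X \<Longrightarrow> pix x \<in> P" "x \<in> X \<Longrightarrow> x \<in> pix x"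
  using pix_eqI partition by (auto simp: partition_on_def)

lemma pixel_subset: "Y \<in> P \<Longrightarrow> Y \<subseteq> X"
  using partition by (auto simp: partition_on_def)

lemma in_pixel_iff:
  assumes "\<gamma> \<in> \<Gamma>"
  shows "in_pixel \<gamma> \<longleftrightarrow> (\<forall>t. 0 \<le> t \<and> t \<le> 1 \<longrightarrow> pix (\<gamma> t) = pix (\<gamma> 0))"
proof
  assume "in_pixel \<gamma>"
  then obtain Y where "Y \<in> P" "im \<gamma> \<subseteq> Y" by (auto simp: in_pixel_def)
  then have "pix (\<gamma> t) = Y" if "0 \<le> t" "t \<le> 1" for t
    using that by (intro pix_eqI) auto
  then show "\<forall>t. 0 \<le> t \<and> t \<le> 1 \<longrightarrow> pix (\<gamma> t) = pix (\<gamma> 0)" by simp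
next
  assume *: "\<forall>t. 0 \<le> t \<and> t \<le> 1 \<longrightarrow> pix (\<gamma> t) = pix (\<gamma> 0)"
  have "\<gamma> t \<in> pix (\<gamma> 0)" if "0 \<le> t" "t \<le> 1" for t
    using pix_in(2)[OF path_in[OF assms that]] * that by metis
  then show "in_pixel \<gamma>"
    unfolding in_pixel_def using pix_in(1) path_in assms by (intro bexI[of _ "pix (\<gamma> 0)"]) auto
qed

lemma in_pixelI:
  "\<gamma> \<in> \<Gamma> \<Longrightarrow> (\<And>t. 0 \<le> t \<Longrightarrow> t \<le> 1 \<Longrightarrow> pix (\<gamma> t) = pix (\<gamma> 0)) \<Longrightarrow> in_pixel \<gamma>"
  by (rule in_pixel_iff[THEN iffD2]) blast+

lemma in_pixel_pix: "\<gamma> \<in> \<Gamma> \<Longrightarrow> in_pixel \<gamma> \<Longrightarrow> 0 \<le> t \<Longrightarrow> t \<le> 1 \<Longrightarrow> pix (\<gamma> t) = pix (\<gamma> 0)"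
  using in_pixel_iff by blast

lemma in_pixel_const: "x \<in> X \<Longrightarrow> in_pixel (const_path x)"
  by (subst in_pixel_iff) (auto simp: const)

lemma in_pixel_join:
  assumes "\<gamma> \<in> \<Gamma>" "\<gamma>' \<in> \<Gamma>" "\<gamma> 1 = \<gamma>' 0"
  shows "in_pixel (\<gamma> \<cdot> \<gamma>') \<longleftrightarrow> in_pixel \<gamma> \<and> in_pixel \<gamma>'"
proof
  show "in_pixel (\<gamma> \<cdot> \<gamma>') \<Longrightarrow> in_pixel \<gamma> \<and> in_pixel \<gamma>'"
    unfolding in_pixel_def im_join[of \<gamma> \<gamma>', OF assms(3)] Un_subset_iff by (elim bexE conjE) (intro conjI bexI)
next
  assume *: "in_pixel \<gamma> \<and> in_pixel \<gamma>'"
  then obtain Y Y' where Y: "Y \<in> P" "im \<gamma> \<subseteq> Y" "Y' \<in> P" "im \<gamma>' \<subseteq> Y'"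
    unfolding in_pixel_def by blast
  have "\<gamma> 1 \<in> Y" "\<gamma> 1 \<in> Y'" using im_subsetD[OF Y(2), of 1] im_subsetD[OF Y(4), of 0] assms(3) by simp_all
  then have "Y = Y'" using Y pix_eqI[of Y "\<gamma> 1"] pix_eqI[of Y' "\<gamma> 1"] by simp
  then show "in_pixel (\<gamma> \<cdot> \<gamma>')"
    unfolding in_pixel_def im_join[of \<gamma> \<gamma>', OF assms(3)] Un_subset_iff
    using Y by (intro bexI[of _ Y]) simp_all
qed

lemma in_pixel_R:
  assumes "(\<gamma>, \<gamma>') \<in> R" "in_pixel \<gamma>"
  shows "in_pixel \<gamma>'"
proof -
  obtain Y where "Y \<in> P" "im \<gamma> \<subseteq> Y" using assms(2) unfolding in_pixel_def by blast
  then have "im \<gamma>' \<subseteq> Y"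
    using S1[of \<gamma> \<gamma>' Y] R_in[OF assms(1)] endpoints[OF assms(1)] assms by simp
  then show ?thesis unfolding in_pixel_def using \<open>Y \<in> P\<close> by blast
qed

lemma in_pixel_thin:
  assumes "\<gamma> \<in> \<Gamma>" "\<gamma>' \<in> \<Gamma>" "in_pixel \<gamma>" "in_pixel \<gamma>'" "\<gamma> 0 = \<gamma>' 0" "\<gamma> 1 = \<gamma>' 1"
  shows "(\<gamma>, \<gamma>') \<in> R"
proof -
  obtain Y where Y: "Y \<in> P" "im \<gamma> \<subseteq> Y" using assms unfolding in_pixel_def by blast
  obtain Y' where Y': "Y' \<in> P" "im \<gamma>' \<subseteq> Y'" using assms unfolding in_pixel_def by blast
  have "\<gamma> 0 \<in> Y" "\<gamma> 0 \<in> Y'" using im_subsetD[OF Y(2), of 0] im_subsetD[OF Y'(2), of 0] assms(5) by simp_all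
  then have "Y = Y'" using Y Y' pix_eqI[of Y "\<gamma> 0"] pix_eqI[of Y' "\<gamma> 0"] by simp
  then show ?thesis using S1[of \<gamma> \<gamma>' Y] Y Y' assms by simp
qed

lemma pixel_mors_iff: "\<gamma> \<in> \<Gamma> \<Longrightarrow> R `` {\<gamma>} \<in> pixel_mors \<Gamma> R P \<longleftrightarrow> in_pixel \<gamma>"
  unfolding pixel_mors_def mem_Collect_eq in_pixel_def[symmetric]
  using path_class_eq in_pixel_R R_sym by metis

lemma pixel_mors_cases:
  assumes "f \<in> pixel_mors \<Gamma> R P"
  obtains \<gamma> where "\<gamma> \<in> \<Gamma>" "f = R `` {\<gamma>}" "in_pixel \<gamma>"
  using assms unfolding pixel_mors_def in_pixel_def by blast

text \<open>By (S2), the endpoints of pixel paths generate, under symmetry and transitivity, the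
  relation of lying in one pixel. In the uses below, \<open>trans\<close> is where (S3) or its dual
  enters.\<close>

lemma pixel_connected:
  assumes path: "\<And>\<gamma>. \<gamma> \<in> \<Gamma> \<Longrightarrow> in_pixel \<gamma> \<Longrightarrow> E (\<gamma> 0) (\<gamma> 1)"
    and sym: "\<And>x y. E x y \<Longrightarrow> E y x"
    and trans: "\<And>x y z. E x y \<Longrightarrow> E y z \<Longrightarrow> E x z"
    and "Y \<in> P" "x \<in> Y" "y \<in> Y"
  shows "E x y"
proof -
  obtain n \<gamma> where \<gamma>: "\<And>i. i \<le> 2 * n \<Longrightarrow> \<gamma> i \<in> \<Gamma> \<and> im (\<gamma> i) \<subseteq> Y"
    "\<gamma> 0 0 = x" "\<gamma> (2 * n) 1 = y"
    "\<And>i. i < 2 * n \<Longrightarrow> if even i then \<gamma> i 1 = \<gamma> (Suc i) 1 else \<gamma> i 0 = \<gamma> (Suc i) 0"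
    using S2[OF assms(4-6)] by blast
  have E: "E (\<gamma> i 0) (\<gamma> i 1)" if "i \<le> 2 * n" for i
    using path[of "\<gamma> i"] \<gamma>(1)[OF that] \<open>Y \<in> P\<close> by (auto simp: in_pixel_def)
  \<comment> \<open>Odd paths are run backwards, so the point reached after step \<open>i\<close> is
    the end of an even path and the start of an odd one.\<close>
  have "E x (\<gamma> i (if even i then 1 else 0))" if "i \<le> 2 * n" for i
    using that
  proof (induction i)
    case 0
    then show ?case using E[of 0] \<gamma>(2) by simp
  next
    case (Suc i)
    then have "E x (\<gamma> i (if even i then 1 else 0))" by simp
    then show ?case
      using E[of "Suc i"] \<gamma>(4)[of i] Suc.prems by (auto split: if_splits intro: trans sym)
  qed
  from this[of "2 * n"] show ?thesis using \<gamma>(3) by simp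
qed

text \<open>For transitivity, two cospans over a shared point \<open>y\<close> contain a span at
  \<open>y\<close>, which (S3) completes to a square. One composite of the square lies in a pixel;
  hence so does the equivalent one, and with it the new side \<beta>.\<close>

lemma pixel_directed_up:
  assumes "x \<in> X" "y \<in> X" "pix x = pix y"
  shows "\<exists>\<rho>\<in>\<Gamma>. \<exists>\<sigma>\<in>\<Gamma>. in_pixel \<rho> \<and> in_pixel \<sigma> \<and> \<rho> 0 = x \<and> \<sigma> 0 = y \<and> \<rho> 1 = \<sigma> 1"
    (is "?E x y")
proof (rule pixel_connected[of ?E])
  show "?E (\<gamma> 0) (\<gamma> 1)" if "\<gamma> \<in> \<Gamma>" "in_pixel \<gamma>" for \<gamma>
    using that const in_pixel_const path_in[of \<gamma> 1]
    by (intro bexI[of _ \<gamma>] bexI[of _ "const_path (\<gamma> 1)"]) auto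
  show "?E y x" if "?E x y" for x y using that by metis
  show "?E x z" if "?E x y" "?E y z" for x y z
  proof -
    from that obtain \<rho> \<sigma> \<rho>' \<sigma>' where *: "\<rho> \<in> \<Gamma>" "\<sigma> \<in> \<Gamma>" "\<rho>' \<in> \<Gamma>" "\<sigma>' \<in> \<Gamma>"
      "in_pixel \<rho>" "in_pixel \<sigma>" "in_pixel \<rho>'" "in_pixel \<sigma>'" "\<rho> 0 = x" "\<sigma> 0 = y" "\<rho>' 0 = y" "\<sigma>' 0 = z"
      "\<rho> 1 = \<sigma> 1" "\<rho>' 1 = \<sigma>' 1" by blast
    then obtain \<alpha> \<beta> where ab: "\<alpha> \<in> \<Gamma>" "\<beta> \<in> \<Gamma>" "in_pixel \<alpha>" "\<rho>' 1 = \<alpha> 0" "\<sigma> 1 = \<beta> 0"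
      "(\<rho>' \<cdot> \<alpha>, \<sigma> \<cdot> \<beta>) \<in> R"
      using S3[of \<sigma> \<rho>'] unfolding in_pixel_def by metis
    have "in_pixel (\<rho>' \<cdot> \<alpha>)" using * ab by (simp add: in_pixel_join)
    then have "in_pixel \<beta>" using in_pixel_R[OF ab(6)] ab * in_pixel_join[of \<sigma> \<beta>] by simp
    moreover have "\<alpha> 1 = \<beta> 1" using endpoints[OF ab(6)] by simp
    ultimately show ?thesis
      using * ab join[of \<rho> \<beta>] join[of \<sigma>' \<alpha>]
      by (intro bexI[of _ "\<rho> \<cdot> \<beta>"] bexI[of _ "\<sigma>' \<cdot> \<alpha>"]) (auto simp: in_pixel_join)
  qed
  show "pix x \<in> P" "x \<in> pix x" "y \<in> pix x" using assms pix_in by auto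
qed

text \<open>Dual to the preceding lemma, with (S3) replaced by its dual. It serves to equalize
  starting points in \<open>NP_same_pixels\<close>.\<close>

lemma pixel_directed_down:
  assumes "x \<in> X" "y \<in> X" "pix x = pix y"
  shows "\<exists>\<rho>\<in>\<Gamma>. \<exists>\<sigma>\<in>\<Gamma>. in_pixel \<rho> \<and> in_pixel \<sigma> \<and> \<rho> 1 = x \<and> \<sigma> 1 = y \<and> \<rho> 0 = \<sigma> 0"
    (is "?E x y")
proof (rule pixel_connected[of ?E])
  show "?E (\<gamma> 0) (\<gamma> 1)" if "\<gamma> \<in> \<Gamma>" "in_pixel \<gamma>" for \<gamma>
    using that const in_pixel_const path_in[of \<gamma> 0]
    by (intro bexI[of _ \<gamma>] bexI[of _ "const_path (\<gamma> 0)"]) auto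
  show "?E y x" if "?E x y" for x y using that by metis
  show "?E x z" if "?E x y" "?E y z" for x y z
  proof -
    from that obtain \<rho> \<sigma> \<rho>' \<sigma>' where *: "\<rho> \<in> \<Gamma>" "\<sigma> \<in> \<Gamma>" "\<rho>' \<in> \<Gamma>" "\<sigma>' \<in> \<Gamma>"
      "in_pixel \<rho>" "in_pixel \<sigma>" "in_pixel \<rho>'" "in_pixel \<sigma>'" "\<rho> 1 = x" "\<sigma> 1 = y" "\<rho>' 1 = y" "\<sigma>' 1 = z"
      "\<rho> 0 = \<sigma> 0" "\<rho>' 0 = \<sigma>' 0" by blast
    then obtain \<alpha> \<beta> where ab: "\<alpha> \<in> \<Gamma>" "\<beta> \<in> \<Gamma>" "in_pixel \<alpha>" "\<beta> 1 = \<rho>' 0" "\<alpha> 1 = \<sigma> 0"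
      "(\<beta> \<cdot> \<rho>', \<alpha> \<cdot> \<sigma>) \<in> R"
      using S3_dual[of \<rho>' \<sigma>] unfolding in_pixel_def by metis
    have "in_pixel (\<alpha> \<cdot> \<sigma>)" using * ab by (simp add: in_pixel_join)
    then have "in_pixel \<beta>" using in_pixel_R[OF R_sym[OF ab(6)]] ab * in_pixel_join[of \<beta> \<rho>'] by simp
    moreover have "\<alpha> 0 = \<beta> 0" using endpoints[OF ab(6)] by simp
    ultimately show ?thesis
      using * ab join[of \<alpha> \<rho>] join[of \<beta> \<sigma>']
      by (intro bexI[of _ "\<alpha> \<cdot> \<rho>"] bexI[of _ "\<beta> \<cdot> \<sigma>'"]) (auto simp: in_pixel_join)
  qed
  show "pix x \<in> P" "x \<in> pix x" "y \<in> pix x" using assms pix_in by auto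
qed

text \<open>A partition for \<gamma> from (S4) also fits \<gamma>', since only the pixels of the
  values matter; (S5) thus becomes a pointwise criterion free of partitions.\<close>

lemma R_same_pixels:
  assumes "\<gamma> \<in> \<Gamma>" "\<gamma>' \<in> \<Gamma>" "\<gamma> 0 = \<gamma>' 0" "\<gamma> 1 = \<gamma>' 1"
    and eq: "\<And>t. 0 \<le> t \<Longrightarrow> t \<le> 1 \<Longrightarrow> pix (\<gamma> t) = pix (\<gamma>' t)"
  shows "(\<gamma>, \<gamma>') \<in> R"
proof -
  obtain Is Xs where p: "pixel_partition P \<gamma> Is Xs" using S4[OF assms(1)] by blast
  have "\<gamma>' ` I \<subseteq> Y" if "I \<in> set Is" "Y \<in> set Xs" "\<gamma> ` I \<subseteq> Y" for I Y
  proof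
    fix x assume "x \<in> \<gamma>' ` I"
    then obtain t where t: "t \<in> I" "x = \<gamma>' t" by blast
    have "t \<in> {0..1}" "Y \<in> P" using t that p by (auto simp: pixel_partition_def)
    moreover have "\<gamma> t \<in> Y" using t that by blast
    ultimately show "x \<in> Y"
      using eq[of t] t pix_eqI[of Y "\<gamma> t"] pix_in(2)[OF path_in[OF assms(2), of t]] by auto
  qed
  then have "list_all2 (\<lambda>I Y. \<gamma>' ` I \<subseteq> Y) Is Xs"
    using p unfolding pixel_partition_def by (auto elim!: list.rel_mono_strong)
  then have "pixel_partition P \<gamma>' Is Xs" using p by (simp add: pixel_partition_def)
  with p show ?thesis using assms by (intro S5)
qed

end

section \<open>The path category of a screen as a pixelated category\<close>

locale pointed_screen = screen X \<Gamma> R P for X :: "'a set" and \<Gamma> R P +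
  fixes s :: "'a set \<Rightarrow> 'a"
  assumes s_in: "Y \<in> P \<Longrightarrow> s Y \<in> Y"
begin

abbreviation "C \<equiv> path_cat X \<Gamma> R"
abbreviation "\<Sigma> \<equiv> pixel_mors \<Gamma> R P"

lemma pix_s: "Y \<in> P \<Longrightarrow> pix (s Y) = Y"
  using s_in pix_eqI by blast

lemma s_X: "Y \<in> P \<Longrightarrow> s Y \<in> X"
  using s_in pixel_subset by blast

text \<open>Thinness comes from (S1), directedness from (S2) and (S3), the Ore condition from (S3),
  and both cancellation laws from \<open>cancel\<close>. Factors of a pixel path are pixel paths
  because the image of a join is the union of the images.\<close>

lemma pixelated_path_cat: "pixelated C \<Sigma> pix s"
proof (intro pixelated.intro localizing.intro category_path_cat localizing_axioms.intro
    pixelated_axioms.intro)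
  show "\<Sigma> \<subseteq> Mor C" by (auto elim!: pixel_mors_cases simp: path_cat_simps)
  show "Ident C x \<in> \<Sigma>" if "x \<in> Obj C" for x
    using that by (simp add: path_cat_simps pixel_mors_iff const in_pixel_const)
  show "Comp C g f \<in> \<Sigma>" if "f \<in> \<Sigma>" "g \<in> \<Sigma>" "Cod C f = Dom C g" for f g
    using that by (auto elim!: pixel_mors_cases simp: path_cat_simps pixel_mors_iff join in_pixel_join)
  show "f \<in> \<Sigma> \<and> g \<in> \<Sigma>" if "f \<in> Mor C" "g \<in> Mor C" "Cod C f = Dom C g" "Comp C g f \<in> \<Sigma>" for f g
    using that by (auto elim!: path_cat_MorE simp: path_cat_simps pixel_mors_iff join in_pixel_join)
  show "f = g" if "f \<in> \<Sigma>" "g \<in> \<Sigma>" "Dom C f = Dom C g" "Cod C f = Cod C g" for f g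
  proof -
    obtain \<rho> where \<rho>: "\<rho> \<in> \<Gamma>" "f = R `` {\<rho>}" "in_pixel \<rho>" using \<open>f \<in> \<Sigma>\<close> by (rule pixel_mors_cases)
    obtain \<sigma> where \<sigma>: "\<sigma> \<in> \<Gamma>" "g = R `` {\<sigma>}" "in_pixel \<sigma>" using \<open>g \<in> \<Sigma>\<close> by (rule pixel_mors_cases)
    show ?thesis using that(3,4) \<rho> \<sigma> in_pixel_thin[of \<rho> \<sigma>] by (simp add: path_cat_simps path_class_eq)
  qed
  show "pix (Dom C f) = pix (Cod C f)" if "f \<in> \<Sigma>" for f
    using that in_pixel_pix[of _ 1] by (auto elim!: pixel_mors_cases simp: path_cat_simps)
  show "\<exists>a\<in>\<Sigma>. \<exists>b\<in>\<Sigma>. Dom C a = x \<and> Dom C b = y \<and> Cod C a = Cod C b"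
    if "x \<in> Obj C" "y \<in> Obj C" "pix x = pix y" for x y
  proof -
    obtain \<rho> \<sigma> where "\<rho>\<in>\<Gamma>" "\<sigma>\<in>\<Gamma>" "in_pixel \<rho>" "in_pixel \<sigma>" "\<rho> 0 = x" "\<sigma> 0 = y" "\<rho> 1 = \<sigma> 1"
      using pixel_directed_up[of x y] \<open>x \<in> Obj C\<close> \<open>y \<in> Obj C\<close> \<open>pix x = pix y\<close>
      by (auto simp: path_cat_simps)
    then show ?thesis
      by (intro bexI[of _ "R `` {\<rho>}"] bexI[of _ "R `` {\<sigma>}"]) (simp_all add: path_cat_simps pixel_mors_iff)
  qed
  show "\<exists>b\<in>\<Sigma>. \<exists>g\<in>Mor C. Dom C b = Cod C f \<and> Dom C g = Cod C a \<and> Cod C g = Cod C b \<and>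
      Comp C b f = Comp C g a" if "a \<in> \<Sigma>" "f \<in> Mor C" "Dom C a = Dom C f" for a f
  proof -
    obtain \<rho> where \<rho>: "\<rho> \<in> \<Gamma>" "a = R `` {\<rho>}" "in_pixel \<rho>" using \<open>a \<in> \<Sigma>\<close> by (rule pixel_mors_cases)
    obtain \<gamma> where \<gamma>: "\<gamma> \<in> \<Gamma>" "f = R `` {\<gamma>}" using \<open>f \<in> Mor C\<close> by (rule path_cat_MorE)
    have "\<rho> 0 = \<gamma> 0" using \<open>Dom C a = Dom C f\<close> \<rho> \<gamma> by (simp add: path_cat_simps)
    then obtain \<rho>' \<gamma>' where *: "\<rho>' \<in> \<Gamma>" "\<gamma>' \<in> \<Gamma>" "in_pixel \<rho>'" "\<gamma> 1 = \<rho>' 0" "\<rho> 1 = \<gamma>' 0"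
        "(\<gamma> \<cdot> \<rho>', \<rho> \<cdot> \<gamma>') \<in> R"
      using S3[of \<rho> \<gamma>] \<rho> \<gamma> unfolding in_pixel_def by metis
    then show ?thesis
      using \<rho> \<gamma> endpoints[OF *(6)] join
      by (intro bexI[of _ "R `` {\<rho>'}"] bexI[of _ "R `` {\<gamma>'}"])
        (simp_all add: path_cat_simps pixel_mors_iff path_class_eq)
  qed
  show "f = g" if "f \<in> Mor C" "g \<in> Mor C" "h \<in> Mor C" "Cod C f = Dom C h" "Cod C g = Dom C h"
    "Dom C f = Dom C g" "Comp C h f = Comp C h g" for f g h
  proof -
    obtain \<alpha> where \<alpha>: "\<alpha> \<in> \<Gamma>" "f = R `` {\<alpha>}" using \<open>f \<in> Mor C\<close> by (rule path_cat_MorE)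
    obtain \<beta> where \<beta>: "\<beta> \<in> \<Gamma>" "g = R `` {\<beta>}" using \<open>g \<in> Mor C\<close> by (rule path_cat_MorE)
    obtain \<gamma> where \<gamma>: "\<gamma> \<in> \<Gamma>" "h = R `` {\<gamma>}" using \<open>h \<in> Mor C\<close> by (rule path_cat_MorE)
    have e: "\<alpha> 1 = \<gamma> 0" "\<beta> 1 = \<gamma> 0" "\<alpha> 0 = \<beta> 0"
      using that(4-6) \<alpha> \<beta> \<gamma> by (simp_all add: path_cat_simps)
    have "R `` {\<alpha> \<cdot> \<gamma>} = R `` {\<beta> \<cdot> \<gamma>}"
      using that(7) \<alpha> \<beta> \<gamma> e by (simp add: path_cat_simps)
    then have "(\<alpha> \<cdot> \<gamma>, \<beta> \<cdot> \<gamma>) \<in> R"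
      by (rule path_class_eq[THEN iffD1, rotated -1]) (use \<alpha> \<beta> \<gamma> e in \<open>simp_all add: join\<close>)
    then show ?thesis
      using R_cancel_right[OF \<alpha>(1) \<beta>(1) \<gamma>(1) e] \<alpha> \<beta> by (simp add: path_class_eq)
  qed
  show "f = g" if "f \<in> Mor C" "g \<in> Mor C" "h \<in> Mor C" "Dom C f = Cod C h" "Dom C g = Cod C h"
    "Cod C f = Cod C g" "Comp C f h = Comp C g h" for f g h
  proof -
    obtain \<alpha> where \<alpha>: "\<alpha> \<in> \<Gamma>" "f = R `` {\<alpha>}" using \<open>f \<in> Mor C\<close> by (rule path_cat_MorE)
    obtain \<beta> where \<beta>: "\<beta> \<in> \<Gamma>" "g = R `` {\<beta>}" using \<open>g \<in> Mor C\<close> by (rule path_cat_MorE)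
    obtain \<gamma> where \<gamma>: "\<gamma> \<in> \<Gamma>" "h = R `` {\<gamma>}" using \<open>h \<in> Mor C\<close> by (rule path_cat_MorE)
    have e: "\<gamma> 1 = \<alpha> 0" "\<gamma> 1 = \<beta> 0" "\<alpha> 1 = \<beta> 1"
      using that(4-6) \<alpha> \<beta> \<gamma> by (simp_all add: path_cat_simps)
    have "R `` {\<gamma> \<cdot> \<alpha>} = R `` {\<gamma> \<cdot> \<beta>}"
      using that(7) \<alpha> \<beta> \<gamma> e by (simp add: path_cat_simps)
    then have "(\<gamma> \<cdot> \<alpha>, \<gamma> \<cdot> \<beta>) \<in> R"
      by (rule path_class_eq[THEN iffD1, rotated -1]) (use \<alpha> \<beta> \<gamma> e in \<open>simp_all add: join\<close>)
    then show ?thesis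
      using R_cancel_left[OF \<alpha>(1) \<beta>(1) \<gamma>(1) e] \<alpha> \<beta> by (simp add: path_class_eq)
  qed
  show "s (pix x) \<in> Obj C" "pix (s (pix x)) = pix x" if "x \<in> Obj C" for x
    using that pix_in pix_s s_X by (simp_all add: path_cat_simps)
qed

sublocale pixelated C \<Sigma> pix s
  by (rule pixelated_path_cat)

definition NP :: "(real \<Rightarrow> 'a) \<Rightarrow> 'a pixelation_mor" where
  "NP \<gamma> = N (R `` {\<gamma>})"

lemma NP_in: "\<gamma> \<in> \<Gamma> \<Longrightarrow> NP \<gamma> \<in> Hom D (s (pix (\<gamma> 0))) (s (pix (\<gamma> 1)))"
  by (simp add: NP_def Hom_def N_Mor Dom_N Cod_N path_cat_simps)

lemma NP_join: "\<gamma> \<in> \<Gamma> \<Longrightarrow> \<gamma>' \<in> \<Gamma> \<Longrightarrow> \<gamma> 1 = \<gamma>' 0 \<Longrightarrow> NP (\<gamma> \<cdot> \<gamma>') = Comp D (NP \<gamma>') (NP \<gamma>)"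
  using N_Comp[of "R `` {\<gamma>}" "R `` {\<gamma>'}"] by (simp add: NP_def path_cat_simps)

lemma NP_in_pixel: "\<gamma> \<in> \<Gamma> \<Longrightarrow> in_pixel \<gamma> \<Longrightarrow> NP \<gamma> = Ident D (s (pix (\<gamma> 0)))"
  by (simp add: NP_def N_S pixel_mors_iff path_cat_simps)

lemma NP_R: "(\<gamma>, \<gamma>') \<in> R \<Longrightarrow> NP \<gamma> = NP \<gamma>'"
  using PC.cls_eqI by (simp add: NP_def)

lemma NP_join_pixel_paths:
  assumes "\<gamma> \<in> \<Gamma>" "\<rho> \<in> \<Gamma>" "\<sigma> \<in> \<Gamma>" "in_pixel \<rho>" "in_pixel \<sigma>" "\<rho> 1 = \<gamma> 0" "\<gamma> 1 = \<sigma> 0"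
  shows "NP (\<rho> \<cdot> \<gamma> \<cdot> \<sigma>) = NP \<gamma>"
proof -
  have "NP (\<rho> \<cdot> \<gamma> \<cdot> \<sigma>) = Comp D (Ident D (s (pix (\<gamma> 1)))) (Comp D (NP \<gamma>) (Ident D (s (pix (\<gamma> 0)))))"
    using assms in_pixel_pix[of \<rho> 1] by (simp add: NP_join NP_in_pixel join)
  then show ?thesis
    using NP_in[OF assms(1)] D.Comp_Ident_left[of "NP \<gamma>"] D.Comp_Ident_right[of "NP \<gamma>"]
    by (simp add: Hom_def)
qed

text \<open>
  The endpoints of the two paths are first made equal by pixel paths, in a span on the left and a
  cospan on the right, so that (S5) applies.
\<close>

lemma NP_same_pixels:
  assumes "\<gamma> \<in> \<Gamma>" "\<gamma>' \<in> \<Gamma>" and eq: "\<And>t. 0 \<le> t \<Longrightarrow> t \<le> 1 \<Longrightarrow> pix (\<gamma> t) = pix (\<gamma>' t)"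
  shows "NP \<gamma> = NP \<gamma>'"
proof -
  obtain \<rho> \<rho>' where \<rho>: "\<rho> \<in> \<Gamma>" "\<rho>' \<in> \<Gamma>" "in_pixel \<rho>" "in_pixel \<rho>'" "\<rho> 1 = \<gamma> 0" "\<rho>' 1 = \<gamma>' 0" "\<rho> 0 = \<rho>' 0"
    using pixel_directed_down[of "\<gamma> 0" "\<gamma>' 0"] eq[of 0] assms path_in by force
  obtain \<sigma> \<sigma>' where \<sigma>: "\<sigma> \<in> \<Gamma>" "\<sigma>' \<in> \<Gamma>" "in_pixel \<sigma>" "in_pixel \<sigma>'" "\<sigma> 0 = \<gamma> 1" "\<sigma>' 0 = \<gamma>' 1" "\<sigma> 1 = \<sigma>' 1"
    using pixel_directed_up[of "\<gamma> 1" "\<gamma>' 1"] eq[of 1] assms path_in by force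
  have "(\<rho> \<cdot> \<gamma> \<cdot> \<sigma>, \<rho>' \<cdot> \<gamma>' \<cdot> \<sigma>') \<in> R"
  proof (rule R_same_pixels)
    fix t :: real assume t: "0 \<le> t" "t \<le> 1"
    have 1: "pix (\<rho> u) = pix (\<rho>' u)" if "0 \<le> u" "u \<le> 1" for u
      using that \<rho> in_pixel_pix[of \<rho>] in_pixel_pix[of \<rho>'] by metis
    have 2: "pix (\<sigma> u) = pix (\<sigma>' u)" if "0 \<le> u" "u \<le> 1" for u
      using that \<sigma> in_pixel_pix[of \<sigma> u] in_pixel_pix[of \<sigma>' u] eq[of 1] by simp
    have 3: "pix ((\<rho> \<cdot> \<gamma>) u) = pix ((\<rho>' \<cdot> \<gamma>') u)" if "0 \<le> u" "u \<le> 1" for u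
      using that 1 eq by (simp add: path_join_def)
    show "pix ((\<rho> \<cdot> \<gamma> \<cdot> \<sigma>) t) = pix ((\<rho>' \<cdot> \<gamma>' \<cdot> \<sigma>') t)"
    proof (cases "t \<le> 1/2")
      case True
      then show ?thesis using t 3[of "2 * t"] by (simp add: path_join_left)
    next
      case False
      then show ?thesis using t 2[of "2 * t - 1"] \<sigma> by (simp add: path_join_right)
    qed
  qed (use assms \<rho> \<sigma> in \<open>auto intro!: join\<close>)
  then have "NP (\<rho> \<cdot> \<gamma> \<cdot> \<sigma>) = NP (\<rho>' \<cdot> \<gamma>' \<cdot> \<sigma>')" by (rule NP_R)
  then show ?thesis using NP_join_pixel_paths assms \<rho> \<sigma> by simp
qed

end

section \<open>Triples of piecewise evaluated paths\<close>

text \<open>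
  \<open>J f a b m\<close> says that \<open>f\<close> is elementary on \<open>{a..b}\<close> and evaluates there to the morphism \<open>m\<close>.
\<close>

locale step_paths = category D for D :: "('o, 'm) cat" +
  fixes P :: "'p set" and s :: "'p \<Rightarrow> 'o" and J :: "(real \<Rightarrow> 'p) \<Rightarrow> real \<Rightarrow> real \<Rightarrow> 'm \<Rightarrow> bool"
  assumes P_nonempty: "P \<noteq> {}"
    and s_Obj: "Y \<in> P \<Longrightarrow> s Y \<in> Obj D"
    and J_le: "J f a b m \<Longrightarrow> 0 \<le> a \<and> a \<le> b \<and> b \<le> 1"
    and J_in: "J f a b m \<Longrightarrow> m \<in> Hom D (s (f a)) (s (f b))"
    and J_det: "\<lbrakk>J f a b m; J f a b m'\<rbrakk> \<Longrightarrow> m = m'"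
    and J_split: "\<lbrakk>J f a c m; a \<le> b; b \<le> c\<rbrakk> \<Longrightarrow>
      \<exists>m1 m2. J f a b m1 \<and> J f b c m2 \<and> m = Comp D m2 m1"
    and J_const: "\<lbrakk>Y \<in> P; 0 \<le> a; a \<le> b; b \<le> 1; \<And>t. a \<le> t \<Longrightarrow> t \<le> b \<Longrightarrow> f t = Y\<rbrakk> \<Longrightarrow>
      J f a b (Ident D (s Y))"
    and J_reparam: "\<lbrakk>J f a b m; reparam \<phi>; 0 \<le> c; c \<le> d; d \<le> 1; \<phi> c = a; \<phi> d = b;
      \<And>t. c \<le> t \<Longrightarrow> t \<le> d \<Longrightarrow> g t = f (\<phi> t)\<rbrakk> \<Longrightarrow> J g c d m"
    and J_retraction: "\<lbrakk>J f a b m; n \<in> Mor D; Dom D n = s (f b); Comp D n m = Ident D (s (f a));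
      a \<le> t; t \<le> b\<rbrakk> \<Longrightarrow> f t = f a"
    and J_epi: "\<lbrakk>J f a b m; n \<in> Mor D; n' \<in> Mor D; Dom D n = s (f b); Dom D n' = s (f b);
      Cod D n = Cod D n'; Comp D n m = Comp D n' m\<rbrakk> \<Longrightarrow> n = n'"
    and J_mono: "\<lbrakk>J f a b m; n \<in> Mor D; n' \<in> Mor D; Cod D n = s (f a); Cod D n' = s (f a);
      Dom D n = Dom D n'; Comp D m n = Comp D m n'\<rbrakk> \<Longrightarrow> n = n'"
begin

text \<open>A subdivision is recorded only by the derivation, which adds pieces at the left end.
  That the value does not depend on the derivation is \<open>Ev_det\<close>.\<close>

inductive Ev :: "(real \<Rightarrow> 'p) \<Rightarrow> real \<Rightarrow> real \<Rightarrow> 'm \<Rightarrow> bool" for f where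
  Ev_J: "J f a b m \<Longrightarrow> Ev f a b m"
| Ev_step: "\<lbrakk>J f a b m; Ev f b c n\<rbrakk> \<Longrightarrow> Ev f a c (Comp D n m)"

lemma Ev_le: "Ev f a b m \<Longrightarrow> 0 \<le> a \<and> a \<le> b \<and> b \<le> 1"
  by (induction rule: Ev.induct) (auto dest: J_le)

lemma J_Mor: "J f a b m \<Longrightarrow> m \<in> Mor D" "J f a b m \<Longrightarrow> Dom D m = s (f a)" "J f a b m \<Longrightarrow> Cod D m = s (f b)"
  using J_in by (auto simp: Hom_def)

lemma Ev_in: "Ev f a b m \<Longrightarrow> m \<in> Hom D (s (f a)) (s (f b))"
  by (induction rule: Ev.induct) (auto simp: Hom_def J_Mor Comp_in Dom_Comp Cod_Comp)

lemma Ev_Mor: "Ev f a b m \<Longrightarrow> m \<in> Mor D" "Ev f a b m \<Longrightarrow> Dom D m = s (f a)" "Ev f a b m \<Longrightarrow> Cod D m = s (f b)"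
  using Ev_in by (auto simp: Hom_def)

lemma Ev_Comp: "Ev f a b m \<Longrightarrow> Ev f b c n \<Longrightarrow> Ev f a c (Comp D n m)"
proof (induction rule: Ev.induct)
  case (Ev_J a b m)
  then show ?case by (rule Ev_step)
next
  case (Ev_step a b m c' m')
  have "Ev f a c (Comp D (Comp D n m') m)"
    by (rule Ev.Ev_step[OF Ev_step.hyps(1) Ev_step.IH[OF Ev_step.prems]])
  then show ?case
    using Ev_step by (simp add: Comp_assoc J_Mor Ev_Mor)
qed

text \<open>The cut falls into the first piece, which \<open>J_split\<close> divides, or into the
  rest, which the induction hypothesis divides.\<close>

lemma Ev_split:
  assumes "Ev f a c m" "a \<le> b" "b \<le> c"
  shows "\<exists>m1 m2. Ev f a b m1 \<and> Ev f b c m2 \<and> m = Comp D m2 m1"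
  using assms
proof (induction rule: Ev.induct)
  case (Ev_J a c m)
  then show ?case using J_split Ev.Ev_J by blast
next
  case (Ev_step a e m c n)
  show ?case
  proof (cases "b \<le> e")
    case True
    obtain m1 m2 where m: "J f a b m1" "J f b e m2" "m = Comp D m2 m1"
      using J_split[OF Ev_step.hyps(1)] True Ev_step.prems by blast
    have "Ev f b c (Comp D n m2)" by (rule Ev.Ev_step[OF m(2) Ev_step.hyps(2)])
    moreover have "Comp D n m = Comp D (Comp D n m2) m1"
      using m Ev_step.hyps by (simp add: Comp_assoc J_Mor Ev_Mor)
    ultimately show ?thesis using m(1) Ev.Ev_J by blast
  next
    case False
    then obtain m1 m2 where m: "Ev f e b m1" "Ev f b c m2" "n = Comp D m2 m1"
      using Ev_step.IH Ev_step.prems by auto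
    have "Comp D n m = Comp D m2 (Comp D m1 m)"
      using m Ev_step.hyps by (simp add: Comp_assoc J_Mor Ev_Mor)
    then show ?thesis using m Ev_step.hyps(1) Ev.Ev_step by blast
  qed
qed

text \<open>The single piece is cut where the first piece of the derivation ends, so no common
  refinement has to be written down.\<close>

lemma J_Ev_det: "Ev f a b m \<Longrightarrow> J f a b m' \<Longrightarrow> m = m'"
proof (induction arbitrary: m' rule: Ev.induct)
  case (Ev_J a b m)
  then show ?case using J_det by blast
next
  case (Ev_step a b m c n)
  have "a \<le> b" "b \<le> c" using J_le[OF Ev_step.hyps(1)] Ev_le[OF Ev_step.hyps(2)] by auto
  then obtain m1 m2 where "J f a b m1" "J f b c m2" "m' = Comp D m2 m1"
    using J_split[OF Ev_step.prems] by blast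
  then show ?case using Ev_step J_det by blast
qed

text \<open>\<open>Ev_split\<close> cuts the second derivation where the first piece of the first
  one ends; \<open>J_Ev_det\<close> compares the initial parts, the induction hypothesis the
  rest.\<close>

lemma Ev_det: "Ev f a b m \<Longrightarrow> Ev f a b m' \<Longrightarrow> m = m'"
proof (induction arbitrary: m' rule: Ev.induct)
  case (Ev_J a b m)
  then show ?case using J_Ev_det by blast
next
  case (Ev_step a b m c n)
  have "a \<le> b" "b \<le> c" using J_le[OF Ev_step.hyps(1)] Ev_le[OF Ev_step.hyps(2)] by auto
  then obtain m1 m2 where "Ev f a b m1" "Ev f b c m2" "m' = Comp D m2 m1"
    using Ev_split[OF Ev_step.prems] by blast
  then show ?case using Ev_step J_Ev_det by blast
qed

lemma Ev_const:
  "\<lbrakk>Y \<in> P; 0 \<le> a; a \<le> b; b \<le> 1; \<And>t. a \<le> t \<Longrightarrow> t \<le> b \<Longrightarrow> f t = Y\<rbrakk> \<Longrightarrow> Ev f a b (Ident D (s Y))"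
  using J_const Ev_J by blast

text \<open>\<open>reparam_IVT\<close> lifts each cut along \<phi>, so pieces of \<open>f\<close>
  pull back to pieces of \<open>g\<close>. The left end \<open>c\<close> is generalized because it
  moves to the lifted cut.\<close>

lemma Ev_reparam:
  assumes "Ev f a b m" "reparam \<phi>" "0 \<le> c" "c \<le> d" "d \<le> 1" "\<phi> c = a" "\<phi> d = b"
    "\<And>t. c \<le> t \<Longrightarrow> t \<le> d \<Longrightarrow> g t = f (\<phi> t)"
  shows "Ev g c d m"
  using assms
proof (induction arbitrary: c rule: Ev.induct)
  case (Ev_J a b m)
  have "J g c d m" by (rule J_reparam[OF Ev_J(1) assms(2)]) (use Ev_J(3-) in simp_all)
  then show ?case by (rule Ev.Ev_J)
next
  case (Ev_step a e m b n)
  have "a \<le> e" "e \<le> b" using J_le[OF Ev_step.hyps(1)] Ev_le[OF Ev_step.hyps(2)] by auto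
  then obtain u where u: "c \<le> u" "u \<le> d" "\<phi> u = e"
    using reparam_IVT[OF assms(2), of c d e] Ev_step.prems(2-6) by metis
  have "J g c u m"
    by (rule J_reparam[OF Ev_step.hyps(1) assms(2)]) (use Ev_step.prems(2-7) u in simp_all)
  moreover have "Ev g u d n"
    by (rule Ev_step.IH[OF assms(2)]) (use Ev_step.prems(2-7) u in simp_all)
  ultimately show ?case by (rule Ev.Ev_step)
qed

text \<open>A left inverse of the whole value yields one of the first piece, which is therefore
  constant and, by \<open>J_det\<close>, has an identity as value. The same \<open>n\<close> is then
  a left inverse of the rest.\<close>

lemma Ev_retraction:
  assumes "Ev f a b m" "n \<in> Mor D" "Dom D n = s (f b)" "Comp D n m = Ident D (s (f a))"
    "f a \<in> P" "a \<le> t" "t \<le> b"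
  shows "f t = f a"
  using assms
proof (induction arbitrary: t rule: Ev.induct)
  case (Ev_J a b m)
  then show ?case using J_retraction by blast
next
  case (Ev_step a e m b m')
  have le: "0 \<le> a" "a \<le> e" "e \<le> b" "b \<le> 1"
    using J_le[OF Ev_step.hyps(1)] Ev_le[OF Ev_step.hyps(2)] by auto
  have eq: "Comp D (Comp D n m') m = Ident D (s (f a))"
    using Ev_step.prems Ev_step.hyps by (simp add: Comp_assoc J_Mor Ev_Mor)
  have const: "f u = f a" if "a \<le> u" "u \<le> e" for u
    using J_retraction[OF Ev_step.hyps(1) _ _ eq that] Ev_step.hyps Ev_step.prems(1,2)
    by (simp add: Ev_Mor Comp_in Dom_Comp)
  have "J f a e (Ident D (s (f a)))"
    using le by (intro J_const[OF Ev_step.prems(4)] const) auto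
  then have m: "m = Ident D (s (f a))" using J_det Ev_step.hyps(1) by blast
  have fe: "f e = f a" using le by (intro const) auto
  have "Comp D n m' = Ident D (s (f e))"
    using eq Comp_Ident_right[of "Comp D n m'"] Ev_step.hyps Ev_step.prems(1,2)
    by (simp add: m fe Ev_Mor Comp_in Dom_Comp)
  then have "f u = f e" if "e \<le> u" "u \<le> b" for u
    using Ev_step.IH[OF Ev_step.prems(1,2) _ _ that] Ev_step.prems(4) by (simp add: fe)
  then show ?case using const[of t] fe Ev_step.prems(5,6) by (cases "t \<le> e") auto
qed

lemma Ev_epi:
  assumes "Ev f a b m" "n \<in> Mor D" "n' \<in> Mor D" "Dom D n = s (f b)" "Dom D n' = s (f b)"
    "Cod D n = Cod D n'" "Comp D n m = Comp D n' m"
  shows "n = n'"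
  using assms
proof (induction rule: Ev.induct)
  case (Ev_J a b m)
  then show ?case using J_epi by blast
next
  case (Ev_step a e m b m')
  have "Comp D (Comp D n m') m = Comp D (Comp D n' m') m"
    using Ev_step.prems Ev_step.hyps by (simp add: Comp_assoc J_Mor Ev_Mor)
  then have "Comp D n m' = Comp D n' m'"
    by (rule J_epi[OF Ev_step.hyps(1), rotated -1])
      (use Ev_step.prems Ev_step.hyps in \<open>simp_all add: Ev_Mor Comp_in Dom_Comp Cod_Comp\<close>)
  then show ?case using Ev_step.IH Ev_step.prems by blast
qed

lemma Ev_mono:
  assumes "Ev f a b m" "n \<in> Mor D" "n' \<in> Mor D" "Cod D n = s (f a)" "Cod D n' = s (f a)"
    "Dom D n = Dom D n'" "Comp D m n = Comp D m n'"
  shows "n = n'"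
  using assms
proof (induction arbitrary: n n' rule: Ev.induct)
  case (Ev_J a b m)
  then show ?case using J_mono by blast
next
  case (Ev_step a e m b m')
  have "Comp D m' (Comp D m n) = Comp D m' (Comp D m n')"
    using Ev_step.prems Ev_step.hyps by (simp add: Comp_assoc J_Mor Ev_Mor)
  then have "Comp D m n = Comp D m n'"
    by (rule Ev_step.IH[rotated -1])
      (use Ev_step.prems Ev_step.hyps in \<open>simp_all add: J_Mor Comp_in Dom_Comp Cod_Comp\<close>)
  then show ?case
    by (rule J_mono[OF Ev_step.hyps(1), rotated -1]) (use Ev_step.prems in simp_all)
qed

definition ev_paths :: "(real \<Rightarrow> 'p) set" where
  "ev_paths = {f \<in> {0..1} \<rightarrow>\<^sub>E P. \<exists>m. Ev f 0 1 m}"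

definition val :: "(real \<Rightarrow> 'p) \<Rightarrow> 'm" where
  "val f = (THE m. Ev f 0 1 m)"

lemma val_eqI: "Ev f 0 1 m \<Longrightarrow> val f = m"
  unfolding val_def using Ev_det by blast

lemma Ev_val: "f \<in> ev_paths \<Longrightarrow> Ev f 0 1 (val f)"
  using val_eqI by (auto simp: ev_paths_def)

lemma ev_paths_in: "f \<in> ev_paths \<Longrightarrow> 0 \<le> t \<Longrightarrow> t \<le> 1 \<Longrightarrow> f t \<in> P"
  using PiE_mem[of f "{0..1}" "\<lambda>_. P" t] by (simp add: ev_paths_def)

lemma Ev_join:
  assumes "f \<in> ev_paths" "g \<in> ev_paths" "f 1 = g 0"
  shows "Ev (f \<cdot> g) 0 1 (Comp D (val g) (val f))"
proof -
  have "Ev (f \<cdot> g) 0 (1/2) (val f)"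
  \<comment> \<open>Truncation at 1 only makes doubling a reparametrization of the whole unit
    interval; it has no effect on the first half.\<close>
  proof (rule Ev_reparam[OF Ev_val[OF assms(1)], where \<phi> = "\<lambda>t. min 1 (2 * t)"])
    show "reparam (\<lambda>t. min 1 (2 * t))"
      by (rule reparamI) (auto intro!: continuous_intros mono_onI)
    show "(f \<cdot> g) t = f (min 1 (2 * t))" if "0 \<le> t" "t \<le> 1/2" for t
    proof -
      have "min 1 (2 * t) = 2 * t" using that by auto
      then show ?thesis using that by (simp add: path_join_left)
    qed
  qed simp_all
  moreover have "Ev (f \<cdot> g) (1/2) 1 (val g)"
  proof (rule Ev_reparam[OF Ev_val[OF assms(2)], where \<phi> = "\<lambda>t. max 0 (2 * t - 1)"])
    show "reparam (\<lambda>t. max 0 (2 * t - 1))"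
      by (rule reparamI) (auto intro!: continuous_intros mono_onI)
    show "(f \<cdot> g) t = g (max 0 (2 * t - 1))" if "1/2 \<le> t" "t \<le> 1" for t
    proof -
      have "max 0 (2 * t - 1) = 2 * t - 1" using that by auto
      then show ?thesis using that assms(3) by (simp add: path_join_right)
    qed
  qed simp_all
  ultimately show ?thesis by (rule Ev_Comp)
qed

lemma join_ev_paths: "f \<in> ev_paths \<Longrightarrow> g \<in> ev_paths \<Longrightarrow> f 1 = g 0 \<Longrightarrow> f \<cdot> g \<in> ev_paths"
  using Ev_join[of f g] ev_paths_in[of f] ev_paths_in[of g]
  by (auto simp: ev_paths_def path_join_def)

lemma Ev_const_path: "Y \<in> P \<Longrightarrow> Ev (const_path Y) 0 1 (Ident D (s Y))"
  by (rule Ev_const) auto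

lemma const_ev_paths: "Y \<in> P \<Longrightarrow> const_path Y \<in> ev_paths"
  using Ev_const_path[of Y] by (auto simp: ev_paths_def const_path_def)

text \<open>\<phi> need not reach the ends of the unit interval, so the evaluation of
  \<open>f\<close> is first restricted to the interval from \<open>\<phi> 0\<close> to
  \<open>\<phi> 1\<close> by cutting twice.\<close>

lemma reparam_ev_paths:
  assumes "f \<in> ev_paths" "reparam \<phi>"
  shows "compose {0..1} f \<phi> \<in> ev_paths"
proof -
  have \<phi>: "0 \<le> \<phi> 0" "\<phi> 0 \<le> \<phi> 1" "\<phi> 1 \<le> 1"
    using reparam_in[OF assms(2), of 0] reparam_in[OF assms(2), of 1] reparam_mono[OF assms(2), of 0 1]
    by auto
  obtain m where "Ev f 0 (\<phi> 1) m" using Ev_split[OF Ev_val[OF assms(1)], of "\<phi> 1"] \<phi> by auto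
  then obtain n where "Ev f (\<phi> 0) (\<phi> 1) n" using Ev_split[of f 0 "\<phi> 1" m "\<phi> 0"] \<phi> by auto
  then have "Ev (compose {0..1} f \<phi>) 0 1 n"
    by (rule Ev_reparam[OF _ assms(2)]) (auto simp: compose_def)
  moreover have "compose {0..1} f \<phi> \<in> {0..1} \<rightarrow>\<^sub>E P"
    using ev_paths_in[OF assms(1)] reparam_in[OF assms(2)] by (auto simp: compose_def)
  ultimately show ?thesis by (auto simp: ev_paths_def)
qed

lemma val_reparam:
  assumes "f \<in> ev_paths" "reparam \<phi>" "\<phi> 0 = 0" "\<phi> 1 = 1"
  shows "val (compose {0..1} f \<phi>) = val f"
  by (rule val_eqI, rule Ev_reparam[OF Ev_val[OF assms(1)] assms(2)]) (use assms in \<open>auto simp: compose_def\<close>)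

lemma ev_structure_simps:
  "Obj (path_structure P ev_paths) = P" "Mor (path_structure P ev_paths) = ev_paths"
  "Dom (path_structure P ev_paths) \<gamma> = \<gamma> 0" "Cod (path_structure P ev_paths) \<gamma> = \<gamma> 1"
  "Ident (path_structure P ev_paths) = const_path" "Comp (path_structure P ev_paths) \<gamma>' \<gamma> = \<gamma> \<cdot> \<gamma>'"
  by (simp_all add: path_structure_def)

lemma evaluation_val: "evaluation (path_structure P ev_paths) D s val"
proof
  show "val f \<in> Hom D (s (Dom (path_structure P ev_paths) f)) (s (Cod (path_structure P ev_paths) f))"
    if "f \<in> Mor (path_structure P ev_paths)" for f
    using that Ev_in[OF Ev_val] by (simp add: ev_structure_simps)
qed (simp_all add: ev_structure_simps ev_paths_in const_ev_paths join_ev_paths s_Obj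
    val_eqI[OF Ev_const_path] val_eqI[OF Ev_join])

sublocale E: evaluation "path_structure P ev_paths" D s val
  by (rule evaluation_val)

lemma kernel_val_iff:
  "(f, g) \<in> E.kernel \<longleftrightarrow> f \<in> ev_paths \<and> g \<in> ev_paths \<and> f 0 = g 0 \<and> f 1 = g 1 \<and> val f = val g"
  by (simp add: E.kernel_def ev_structure_simps)

lemma triple_ev_paths: "triple P ev_paths E.kernel"
proof
  show "P \<noteq> {}" by (rule P_nonempty)
  show "ev_paths \<subseteq> {0..1} \<rightarrow>\<^sub>E P" by (auto simp: ev_paths_def)
  show "equiv ev_paths E.kernel" using E.K.equiv_r by (simp add: ev_structure_simps)
  show "\<exists>y\<in>P. f = const_path y" if "(f, const_path x) \<in> E.kernel" "x \<in> P" for f x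
  proof -
    have f: "f \<in> ev_paths" "f 0 = x" "val f = Ident D (s x)" "f 1 = x"
      using that val_eqI[OF Ev_const_path] by (auto simp: kernel_val_iff)
    \<comment> \<open>The value of \<open>f\<close> is an identity, hence has a left inverse, and
      \<open>Ev_retraction\<close> makes \<open>f\<close> constant.\<close>
    have "Comp D (Ident D (s x)) (val f) = Ident D (s (f 0))"
      using f that s_Obj Comp_Ident_left[of "Ident D (s x)"] by (simp add: Ident_in Cod_Ident)
    then have const: "f t = x" if "0 \<le> t" "t \<le> 1" for t
      using Ev_retraction[OF Ev_val[OF f(1)], of "Ident D (s x)" t] that f \<open>x \<in> P\<close> s_Obj
      by (simp add: Ident_in Dom_Ident)
    have "f = const_path x"
      by (rule extensionalityI[of _ "{0..1}"]) (use f const in \<open>auto simp: ev_paths_def const_path_def PiE_def\<close>)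
    then show ?thesis using \<open>x \<in> P\<close> by blast
  qed
  show "(f, g) \<in> E.kernel \<longleftrightarrow> (p \<cdot> f \<cdot> q, p \<cdot> g \<cdot> q) \<in> E.kernel"
    if "f \<in> ev_paths" "g \<in> ev_paths" "p \<in> ev_paths" "q \<in> ev_paths"
      "p 1 = f 0" "f 1 = q 0" "p 1 = g 0" "g 1 = q 0" for f g p q
  proof -
    note [simp] = ev_structure_simps
    have val: "val (p \<cdot> h \<cdot> q) = Comp D (val q) (Comp D (val h) (val p))"
      if "h \<in> ev_paths" "p 1 = h 0" "h 1 = q 0" for h
      using that \<open>p \<in> ev_paths\<close> \<open>q \<in> ev_paths\<close>
      by (simp add: val_eqI[OF Ev_join] join_ev_paths)
    \<comment> \<open>The value of \<open>q\<close> is monic and that of \<open>p\<close> is epic,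
      so the outer factors cancel.\<close>
    have "val f = val g" if eq: "val (p \<cdot> f \<cdot> q) = val (p \<cdot> g \<cdot> q)"
    proof -
      have "Comp D (val f) (val p) = Comp D (val g) (val p)"
        by (rule Ev_mono[OF Ev_val[OF \<open>q \<in> ev_paths\<close>]])
          (use \<open>f \<in> ev_paths\<close> \<open>g \<in> ev_paths\<close> \<open>p \<in> ev_paths\<close> \<open>p 1 = f 0\<close> \<open>p 1 = g 0\<close> \<open>f 1 = q 0\<close>
            \<open>g 1 = q 0\<close> eq val[of f] val[of g]
            in \<open>simp_all add: E.ev_Mor E.Dom_ev E.Cod_ev Comp_in Dom_Comp Cod_Comp\<close>)
      then show ?thesis
        by (rule Ev_epi[OF Ev_val[OF \<open>p \<in> ev_paths\<close>], rotated -1])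
          (use \<open>f \<in> ev_paths\<close> \<open>g \<in> ev_paths\<close> \<open>p \<in> ev_paths\<close> \<open>p 1 = f 0\<close> \<open>p 1 = g 0\<close> \<open>f 1 = q 0\<close>
            \<open>g 1 = q 0\<close> in \<open>simp_all add: E.ev_Mor E.Dom_ev E.Cod_ev\<close>)
    qed
    then show ?thesis
      using that val[of f] val[of g] by (auto simp: kernel_val_iff join_ev_paths)
  qed
qed (auto simp: kernel_val_iff join_ev_paths const_ev_paths reparam_ev_paths val_reparam
    compose_eq[of 0 "{0..1}"] compose_eq[of 1 "{0..1}"])

lemma path_cat_ev_paths: "path_cat P ev_paths E.kernel = quot_cat (path_structure P ev_paths) E.kernel"
  by (simp add: path_cat_def)

end

section \<open>Free categories on quivers\<close>

lemma evaluation_free_extension: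
  assumes "category D"
    and verts: "\<And>x. x \<in> Verts Q \<Longrightarrow> Fo x \<in> Obj D"
    and arrs: "\<And>e. e \<in> Arrs Q \<Longrightarrow> Fa e \<in> Hom D (Fo (Src Q e)) (Fo (Tgt Q e))"
  shows "evaluation (free_cat Q) D Fo (free_extension Q D Fo Fa)"
proof -
  interpret D: category D by fact
  have ev: "free_extension Q D Fo Fa (x, es, y) \<in> Hom D (Fo x) (Fo y)"
    if "is_walk Q x es y" for x es y
    using that
  proof (induction es arbitrary: x)
    case Nil
    then show ?case using verts by (auto simp: Hom_def D.Ident_in D.Dom_Ident D.Cod_Ident)
  next
    case (Cons e es)
    then have "is_walk Q (Tgt Q e) es y" "e \<in> Arrs Q" "Src Q e = x" by simp_all
    then show ?case
      using Cons.IH[of "Tgt Q e"] arrs[of e] by (simp add: Hom_def D.Comp_in D.Dom_Comp D.Cod_Comp)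
  qed
  have comp: "free_extension Q D Fo Fa (x, es @ fs, z) =
      Comp D (free_extension Q D Fo Fa (y, fs, z)) (free_extension Q D Fo Fa (x, es, y))"
    if "is_walk Q x es y" "is_walk Q y fs z" for x es y fs z
    using that(1)
  proof (induction es arbitrary: x)
    case Nil
    then show ?case
      using ev[OF that(2)] D.Comp_Ident_right[of "free_extension Q D Fo Fa (y, fs, z)"]
      by (auto simp: Hom_def)
  next
    case (Cons e es)
    then have "is_walk Q (Tgt Q e) es y" "e \<in> Arrs Q" "Src Q e = x" by simp_all
    then show ?case
      using Cons.IH[of "Tgt Q e"] ev[OF that(2)] ev[of "Tgt Q e" es y] arrs[of e]
      by (simp add: Hom_def D.Comp_assoc)
  qed
  interpret F: category "free_cat Q" by (rule category_free_cat)
  show ?thesis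
  proof (intro evaluation.intro evaluation_axioms.intro F.precategory \<open>category D\<close>)
    show "free_extension Q D Fo Fa f \<in> Hom D (Fo (Dom (free_cat Q) f)) (Fo (Cod (free_cat Q) f))"
      if "f \<in> Mor (free_cat Q)" for f
      using that by (cases f) (simp add: ev)
    show "free_extension Q D Fo Fa (Comp (free_cat Q) g f) =
        Comp D (free_extension Q D Fo Fa g) (free_extension Q D Fo Fa f)"
      if "f \<in> Mor (free_cat Q)" "g \<in> Mor (free_cat Q)" "Cod (free_cat Q) f = Dom (free_cat Q) g" for f g
      using that by (cases f, cases g) (simp add: comp)
  qed (simp_all add: verts)
qed

section \<open>Projecting paths to the set of pixels\<close>

context pointed_screen
begin

definition proj_step :: "(real \<Rightarrow> 'a) set \<Rightarrow> (real \<Rightarrow> 'a set) \<Rightarrow> real \<Rightarrow> real \<Rightarrow> 'a pixelation_mor \<Rightarrow> bool" where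
  "proj_step G f a b m \<longleftrightarrow> 0 \<le> a \<and> a \<le> b \<and> b \<le> 1 \<and>
     (\<exists>\<gamma> \<in> G. (\<forall>t. 0 \<le> t \<and> t \<le> 1 \<longrightarrow> f (a + (b - a) * t) = pix (\<gamma> t)) \<and> m = NP \<gamma>)"

lemma proj_stepI:
  assumes "0 \<le> a" "a \<le> b" "b \<le> 1" "\<gamma> \<in> G" "m = NP \<gamma>"
    "\<And>t. 0 \<le> t \<Longrightarrow> t \<le> 1 \<Longrightarrow> f (a + (b - a) * t) = pix (\<gamma> t)"
  shows "proj_step G f a b m"
  using assms unfolding proj_step_def by blast

lemma proj_stepE:
  assumes "proj_step G f a b m"
  obtains \<gamma> where "0 \<le> a" "a \<le> b" "b \<le> 1" "\<gamma> \<in> G" "m = NP \<gamma>"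
    "\<And>t. 0 \<le> t \<Longrightarrow> t \<le> 1 \<Longrightarrow> f (a + (b - a) * t) = pix (\<gamma> t)" "f a = pix (\<gamma> 0)" "f b = pix (\<gamma> 1)"
proof -
  obtain \<gamma> where *: "0 \<le> a" "a \<le> b" "b \<le> 1" "\<gamma> \<in> G" "m = NP \<gamma>"
    "\<And>t. 0 \<le> t \<Longrightarrow> t \<le> 1 \<Longrightarrow> f (a + (b - a) * t) = pix (\<gamma> t)"
    using assms by (auto simp: proj_step_def)
  show ?thesis by (rule that[OF *]) (use *(6)[of 0] *(6)[of 1] in simp_all)
qed

text \<open>Uniqueness of the value is \<open>NP_same_pixels\<close>, cutting is
  \<open>R_sub_path_join\<close>, and the last three laws are those of \<open>N\<close>. Closure of
  \<open>G\<close> under reparametrization keeps cut and reparametrized pieces in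
  \<open>G\<close>.\<close>

lemma step_paths_proj_step:
  assumes "G \<subseteq> \<Gamma>" and sub: "\<And>\<gamma> \<phi>. \<gamma> \<in> G \<Longrightarrow> reparam \<phi> \<Longrightarrow> compose {0..1} \<gamma> \<phi> \<in> G"
    and G_const: "\<And>Y. Y \<in> P \<Longrightarrow> const_path (s Y) \<in> G"
  shows "step_paths D P s (proj_step G)"
proof (intro step_paths.intro D.category_axioms step_paths_axioms.intro)
  have G: "\<gamma> \<in> \<Gamma>" if "\<gamma> \<in> G" for \<gamma> using assms(1) that by blast
  show "P \<noteq> {}" using partition nonempty by (auto simp: partition_on_def)
  show "s Y \<in> Obj D" if "Y \<in> P" for Y using s_X[OF that] by (simp add: path_cat_simps)
  show "0 \<le> a \<and> a \<le> b \<and> b \<le> 1" if "proj_step G f a b m" for f a b m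
    using that by (simp add: proj_step_def)
  show "m \<in> Hom D (s (f a)) (s (f b))" if "proj_step G f a b m" for f a b m
    using that by (rule proj_stepE) (simp add: NP_in G)
  show "m = m'" if m: "proj_step G f a b m" "proj_step G f a b m'" for f a b m m'
  proof -
    obtain \<gamma> where 1: "\<gamma> \<in> G" "m = NP \<gamma>" "\<And>t. 0 \<le> t \<Longrightarrow> t \<le> 1 \<Longrightarrow> f (a + (b - a) * t) = pix (\<gamma> t)"
      using m(1) by (rule proj_stepE) (rule that)
    obtain \<gamma>' where 2: "\<gamma>' \<in> G" "m' = NP \<gamma>'" "\<And>t. 0 \<le> t \<Longrightarrow> t \<le> 1 \<Longrightarrow> f (a + (b - a) * t) = pix (\<gamma>' t)"
      using m(2) by (rule proj_stepE) (rule that)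
    have "pix (\<gamma> t) = pix (\<gamma>' t)" if "0 \<le> t" "t \<le> 1" for t
      using 1(3)[OF that] 2(3)[OF that] by simp
    then show ?thesis unfolding 1(2) 2(2) by (rule NP_same_pixels[OF G[OF 1(1)] G[OF 2(1)]])
  qed
  show "\<exists>m1 m2. proj_step G f a b m1 \<and> proj_step G f b c m2 \<and> m = Comp D m2 m1"
    if m: "proj_step G f a c m" "a \<le> b" "b \<le> c" for f a b c m
  proof -
    obtain \<gamma> where \<gamma>: "0 \<le> a" "c \<le> 1" "\<gamma> \<in> G" "m = NP \<gamma>"
      "\<And>t. 0 \<le> t \<Longrightarrow> t \<le> 1 \<Longrightarrow> f (a + (c - a) * t) = pix (\<gamma> t)"
      using m(1) by (rule proj_stepE) (rule that)
    \<comment> \<open>\<open>u\<close> is the relative position of the cut; for \<open>a = c\<close>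
      it is 0 by division by zero, and \<open>(c - a) * u = b - a\<close> still holds.\<close>
    define u where "u = (b - a) / (c - a)"
    have u: "0 \<le> u" "u \<le> 1" "(c - a) * u = b - a"
      using m(2,3) by (auto simp: u_def divide_simps)
    let ?l = "sub_path \<gamma> 0 u" and ?r = "sub_path \<gamma> u 1"
    have lr: "?l \<in> G" "?r \<in> G"
      unfolding sub_path_eq_compose by (rule sub[OF \<gamma>(3)]; rule reparam_affine; use u in simp)+
    have "f (a + (b - a) * t) = pix (?l t)" if "0 \<le> t" "t \<le> 1" for t
    proof -
      have "f (a + (c - a) * (u * t)) = pix (\<gamma> (u * t))"
        using that u by (intro \<gamma>(5)) (simp_all add: mult_le_one)
      also have "(c - a) * (u * t) = (b - a) * t"
        using u(3) by (simp add: mult.assoc[symmetric])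
      finally show ?thesis using that by simp
    qed
    then have 1: "proj_step G f a b (NP ?l)"
      by (rule proj_stepI[OF _ _ _ lr(1) HOL.refl, rotated -1]) (use \<gamma>(1,2) m(2,3) in simp_all)
    have "f (b + (c - b) * t) = pix (?r t)" if "0 \<le> t" "t \<le> 1" for t
    proof -
      have "0 \<le> (1 - u) * t"
        using that u by simp
      moreover have "(1 - u) * t \<le> (1 - u) * 1"
        using that u by (intro mult_left_mono) simp_all
      ultimately have "f (a + (c - a) * (u + (1 - u) * t)) = pix (\<gamma> (u + (1 - u) * t))"
        using that u by (intro \<gamma>(5)) simp_all
      also have "(c - a) * (u + (1 - u) * t) = (c - a) * u + ((c - a) - (c - a) * u) * t"
        by (simp add: algebra_simps)
      finally show ?thesis using that by (simp add: u(3))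
    qed
    then have 2: "proj_step G f b c (NP ?r)"
      by (rule proj_stepI[OF _ _ _ lr(2) HOL.refl, rotated -1]) (use \<gamma>(1,2) m(2,3) in simp_all)
    have "sub_path \<gamma> 0 1 = \<gamma>"
      by (rule extensionalityI[of _ "{0..1}"]) (use path_ext[OF G[OF \<gamma>(3)]] in \<open>auto simp: sub_path_def\<close>)
    then have "(\<gamma>, ?l \<cdot> ?r) \<in> R"
      using R_sub_path_join[OF G[OF \<gamma>(3)], of 0 u 1] u by simp
    then have "m = Comp D (NP ?r) (NP ?l)"
      using NP_R[of \<gamma> "?l \<cdot> ?r"] NP_join[OF G[OF lr(1)] G[OF lr(2)]] \<gamma>(4) by simp
    with 1 2 show ?thesis by blast
  qed
  show "proj_step G f a b (Ident D (s Y))"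
    if "Y \<in> P" "0 \<le> a" "a \<le> b" "b \<le> 1" "\<And>t. a \<le> t \<Longrightarrow> t \<le> b \<Longrightarrow> f t = Y" for Y a b f
  proof -
    have "f (a + (b - a) * t) = Y" if "0 \<le> t" "t \<le> 1" for t
      using that \<open>a \<le> b\<close> mult_left_mono[of t 1 "b - a"] by (intro \<open>\<And>t. a \<le> t \<Longrightarrow> t \<le> b \<Longrightarrow> f t = Y\<close>) simp_all
    moreover have "NP (const_path (s Y)) = Ident D (s Y)"
      using NP_in_pixel[of "const_path (s Y)"] const in_pixel_const s_X pix_s \<open>Y \<in> P\<close> by simp
    ultimately show ?thesis
      unfolding proj_step_def using that(1-4) G_const[OF \<open>Y \<in> P\<close>] pix_s[OF \<open>Y \<in> P\<close>]
      by (intro conjI bexI[of _ "const_path (s Y)"]) simp_all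
  qed
  show "proj_step G g c d m"
    if m: "proj_step G f a b m" and \<phi>: "reparam \<phi>" and cd: "0 \<le> c" "c \<le> d" "d \<le> 1" "\<phi> c = a" "\<phi> d = b"
      and g: "\<And>t. c \<le> t \<Longrightarrow> t \<le> d \<Longrightarrow> g t = f (\<phi> t)" for f a b m \<phi> c d g
  proof -
    obtain \<gamma> where \<gamma>: "0 \<le> a" "a \<le> b" "b \<le> 1" "\<gamma> \<in> G" "m = NP \<gamma>"
      "\<And>t. 0 \<le> t \<Longrightarrow> t \<le> 1 \<Longrightarrow> f (a + (b - a) * t) = pix (\<gamma> t)"
      using m by (rule proj_stepE) (rule that)
    have \<phi>_cd: "a \<le> \<phi> t" "\<phi> t \<le> b" if "c \<le> t" "t \<le> d" for t
      using reparam_mono[OF \<phi>, of c t] reparam_mono[OF \<phi>, of t d] cd that by simp_all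
    have aff: "c \<le> c + (d - c) * t" "c + (d - c) * t \<le> d" if "0 \<le> t" "t \<le> 1" for t
      using that cd mult_left_mono[of t 1 "d - c"] by simp_all
    show ?thesis
    \<comment> \<open>A degenerate interval cannot be rescaled to the unit interval. In that case
      \<phi> is constant on \<open>{c..d}\<close> and \<gamma> stays in one pixel, so \<gamma>
      itself serves.\<close>
    proof (cases "a = b")
      case True
      have "g (c + (d - c) * t) = pix (\<gamma> t)" if "0 \<le> t" "t \<le> 1" for t
        using g[OF aff[OF that]] \<phi>_cd[OF aff[OF that]] \<gamma>(6)[OF that] True by simp
      then show ?thesis by (rule proj_stepI[OF cd(1-3) \<gamma>(4,5)])
    next
      case False
      \<comment> \<open>This is \<phi> in rescaled coordinates: \<open>{0..1}\<close> is stretched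
        to \<open>{c..d}\<close>, and \<open>{a..b}\<close> is rescaled to \<open>{0..1}\<close>.
        The clamping makes the second map a reparametrization and does nothing on
        \<open>{a..b}\<close>.\<close>
      define \<psi> where "\<psi> = (\<lambda>x. max 0 (min 1 ((x - a) / (b - a)))) \<circ> (\<phi> \<circ> (\<lambda>t. c + (d - c) * t))"
      have "reparam (\<lambda>x. max 0 (min 1 ((x - a) / (b - a))))"
        by (rule reparamI)
          (use \<gamma>(1-3) False in \<open>auto intro!: continuous_intros mono_onI max.mono min.mono divide_right_mono\<close>)
      then have \<psi>: "reparam \<psi>"
        unfolding \<psi>_def using \<phi> cd by (intro reparam_compose reparam_affine)
      have \<psi>_eq: "a + (b - a) * \<psi> t = \<phi> (c + (d - c) * t)" "0 \<le> \<psi> t" "\<psi> t \<le> 1" if "0 \<le> t" "t \<le> 1" for t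
      proof -
        let ?y = "\<phi> (c + (d - c) * t)"
        have "0 \<le> (?y - a) / (b - a)" "(?y - a) / (b - a) \<le> 1"
          using \<phi>_cd[OF aff[OF that]] \<gamma>(2) False by (auto simp: divide_simps)
        then have eq: "\<psi> t = (?y - a) / (b - a)" "0 \<le> \<psi> t" "\<psi> t \<le> 1" by (auto simp: \<psi>_def)
        then show "a + (b - a) * \<psi> t = ?y" "0 \<le> \<psi> t" "\<psi> t \<le> 1" using False by simp_all
      qed
      have ends: "\<psi> 0 = 0" "\<psi> 1 = 1" using cd False by (simp_all add: \<psi>_def)
      have "g (c + (d - c) * t) = pix (compose {0..1} \<gamma> \<psi> t)" if t: "0 \<le> t" "t \<le> 1" for t
        using g[OF aff[OF t]] \<gamma>(6)[OF \<psi>_eq(2,3)[OF t]] \<psi>_eq(1)[OF t] t by (simp add: compose_def)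
      moreover have "m = NP (compose {0..1} \<gamma> \<psi>)"
        using NP_R[OF equiv_reparam[OF G[OF \<gamma>(4)] \<psi> ends]] \<gamma>(5) by simp
      ultimately show ?thesis
        by (intro proj_stepI[OF cd(1-3) sub[OF \<gamma>(4) \<psi>]])
    qed
  qed
  show "f t = f a"
    if m: "proj_step G f a b m" and n: "n \<in> Mor D" "Dom D n = s (f b)" "Comp D n m = Ident D (s (f a))"
      and t: "a \<le> t" "t \<le> b" for f a b m n t
  proof -
    obtain \<gamma> where \<gamma>: "a \<le> b" "\<gamma> \<in> G" "m = NP \<gamma>"
      "\<And>t. 0 \<le> t \<Longrightarrow> t \<le> 1 \<Longrightarrow> f (a + (b - a) * t) = pix (\<gamma> t)" "f a = pix (\<gamma> 0)" "f b = pix (\<gamma> 1)"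
      using m by (rule proj_stepE) (rule that)
    have "R `` {\<gamma>} \<in> \<Sigma>"
      by (rule N_retraction[of _ n]) (use n \<gamma> G[OF \<gamma>(2)] in \<open>simp_all add: path_cat_simps NP_def\<close>)
    then have "in_pixel \<gamma>" using pixel_mors_iff G[OF \<gamma>(2)] by simp
    define u where "u = (t - a) / (b - a)"
    have u: "0 \<le> u" "u \<le> 1" "a + (b - a) * u = t" using t by (auto simp: u_def divide_simps)
    show "f t = f a"
      using \<gamma>(4)[OF u(1,2)] in_pixel_pix[OF G[OF \<gamma>(2)] \<open>in_pixel \<gamma>\<close> u(1,2)] \<gamma>(5) u(3) by simp
  qed
  show "n = n'"
    if m: "proj_step G f a b m" and n: "n \<in> Mor D" "n' \<in> Mor D" "Dom D n = s (f b)" "Dom D n' = s (f b)"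
      "Cod D n = Cod D n'" "Comp D n m = Comp D n' m" for f a b m n n'
  proof -
    obtain \<gamma> where \<gamma>: "\<gamma> \<in> G" "m = NP \<gamma>" "f b = pix (\<gamma> 1)" using m by (rule proj_stepE) (rule that)
    show ?thesis
      by (rule N_epi[of "R `` {\<gamma>}"]) (use n \<gamma> G in \<open>simp_all add: path_cat_simps NP_def\<close>)
  qed
  show "n = n'"
    if m: "proj_step G f a b m" and n: "n \<in> Mor D" "n' \<in> Mor D" "Cod D n = s (f a)" "Cod D n' = s (f a)"
      "Dom D n = Dom D n'" "Comp D m n = Comp D m n'" for f a b m n n'
  proof -
    obtain \<gamma> where \<gamma>: "\<gamma> \<in> G" "m = NP \<gamma>" "f a = pix (\<gamma> 0)" using m by (rule proj_stepE) (rule that)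
    show ?thesis
      by (rule N_mono[of "R `` {\<gamma>}"]) (use n \<gamma> G in \<open>simp_all add: path_cat_simps NP_def\<close>)
  qed
qed

section \<open>The pixelation\<close>

text \<open>Every point is isomorphic by \<open>can\<close> to the chosen point of its pixel, and
  \<open>N_full\<close> realizes each morphism between chosen points by a path.\<close>

lemma pixelation_equivalent_path_cat:
  "\<exists>(X' :: 'a set set) \<Gamma>' R'. triple X' \<Gamma>' R' \<and> equivalent_cats D (path_cat X' \<Gamma>' R')"
proof -
  interpret T: step_paths D P s "proj_step \<Gamma>"
    by (rule step_paths_proj_step) (use reparam const s_X in auto)
  have "equivalent_cats D (path_cat P T.ev_paths T.E.kernel)"
    unfolding T.path_cat_ev_paths
  proof (rule equivalent_kernel_quotient[OF T.evaluation_val, where p = pix and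
        i = "\<lambda>x. can x (s (pix x))" and j = "\<lambda>x. can (s (pix x)) x"])
    fix Y Z m
    assume "Y \<in> Obj (path_structure P T.ev_paths)" "Z \<in> Obj (path_structure P T.ev_paths)"
      and m: "m \<in> Hom D (s Y) (s Z)"
    then have YZ: "Y \<in> P" "Z \<in> P" by (simp_all add: T.ev_structure_simps)
    obtain c where c: "c \<in> Mor C" "Dom C c = s Y" "pix (Cod C c) = Z" "N c = m"
      using N_full[of m] m YZ pix_s by (auto simp: Hom_def)
    obtain \<gamma> where \<gamma>: "\<gamma> \<in> \<Gamma>" "c = R `` {\<gamma>}" using c(1) by (rule path_cat_MorE)
    \<comment> \<open>A single piece suffices, since \<open>m\<close> comes from one path; that this
      path ends merely somewhere in \<open>Z\<close> is invisible after projection.\<close>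
    define f where "f = (\<lambda>t \<in> {0..1}. pix (\<gamma> t))"
    have "proj_step \<Gamma> f 0 1 m"
      by (rule proj_stepI[where \<gamma> = \<gamma>]) (use \<gamma> c in \<open>simp_all add: f_def NP_def\<close>)
    then have "T.Ev f 0 1 m" by (rule T.Ev_J)
    moreover have "f \<in> {0..1} \<rightarrow>\<^sub>E P" using path_in[OF \<gamma>(1)] pix_in by (auto simp: f_def)
    moreover have "f 0 = Y" "f 1 = Z" using c \<gamma> YZ pix_s by (simp_all add: f_def path_cat_simps)
    ultimately have "f \<in> T.ev_paths \<and> f 0 = Y \<and> f 1 = Z \<and> T.val f = m"
      using T.val_eqI by (auto simp: T.ev_paths_def)
    then show "\<exists>f. f \<in> Mor (path_structure P T.ev_paths) \<and> Dom (path_structure P T.ev_paths) f = Y \<and>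
        Cod (path_structure P T.ev_paths) f = Z \<and> T.val f = m"
      by (intro exI[of _ f]) (simp add: T.ev_structure_simps)
  next
    fix Y assume "Y \<in> Obj (path_structure P T.ev_paths)"
    then have "Y \<in> P" by (simp add: T.ev_structure_simps)
    then show "pix (s Y) = Y" "can (s Y) (s (pix (s Y))) = Ident D (s Y)"
      using pix_s s_X can_refl by (simp_all add: path_cat_simps)
  qed (simp_all add: path_cat_simps Hom_def can_in can_can can_refl pix_in pix_s s_X T.ev_structure_simps)
  then show ?thesis using T.triple_ev_paths by blast
qed

section \<open>The category of pseudo arrows\<close>

text \<open>Phrased through \<open>pix\<close> alone, so that it passes to other paths with the same
  pixels. The last clause makes the times spent in the first pixel an initial segment, open or
  closed at the cut.\<close>

definition two_pieces :: "(real \<Rightarrow> 'a) \<Rightarrow> bool" where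
  "two_pieces \<gamma> \<longleftrightarrow> pix (\<gamma> 0) \<noteq> pix (\<gamma> 1) \<and>
     (\<forall>t. 0 \<le> t \<and> t \<le> 1 \<longrightarrow> pix (\<gamma> t) = pix (\<gamma> 0) \<or> pix (\<gamma> t) = pix (\<gamma> 1)) \<and>
     (\<forall>u t. 0 \<le> u \<and> u \<le> t \<and> t \<le> 1 \<longrightarrow> pix (\<gamma> t) = pix (\<gamma> 0) \<longrightarrow> pix (\<gamma> u) = pix (\<gamma> 0))"

lemma two_pieces_iff:
  assumes "\<gamma> \<in> \<Gamma>"
  shows "two_pieces \<gamma> \<longleftrightarrow> (\<exists>Is Xs. pixel_partition P \<gamma> Is Xs \<and> length Is = 2)"
proof
  assume *: "two_pieces \<gamma>"
  \<comment> \<open>The intervals are forced: they are the preimages of the two pixels.\<close>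
  define I where "I = {t. 0 \<le> t \<and> t \<le> 1 \<and> pix (\<gamma> t) = pix (\<gamma> 0)}"
  define J where "J = {t. 0 \<le> t \<and> t \<le> 1 \<and> pix (\<gamma> t) = pix (\<gamma> 1)}"
  have down: "pix (\<gamma> u) = pix (\<gamma> 0)" if "0 \<le> u" "u \<le> t" "t \<le> 1" "pix (\<gamma> t) = pix (\<gamma> 0)" for u t
    using * that unfolding two_pieces_def by blast
  have or: "pix (\<gamma> t) = pix (\<gamma> 0) \<or> pix (\<gamma> t) = pix (\<gamma> 1)" if "0 \<le> t" "t \<le> 1" for t
    using * that unfolding two_pieces_def by blast
  have ne: "pix (\<gamma> 0) \<noteq> pix (\<gamma> 1)" using * unfolding two_pieces_def by blast
  have "is_interval I"
    unfolding is_interval_1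
  proof (intro ballI allI impI)
    fix u v t assume "u \<in> I" "v \<in> I" "u \<le> t \<and> t \<le> v"
    then have "0 \<le> t" "t \<le> v" "v \<le> 1" "pix (\<gamma> v) = pix (\<gamma> 0)" unfolding I_def by auto
    then show "t \<in> I" using down[of t v] unfolding I_def by simp
  qed
  moreover have "is_interval J"
    unfolding is_interval_1
  proof (intro ballI allI impI)
    fix u v t assume "u \<in> J" "v \<in> J" "u \<le> t \<and> t \<le> v"
    then have *: "0 \<le> u" "u \<le> t" "t \<le> 1" "pix (\<gamma> u) = pix (\<gamma> 1)" unfolding J_def by auto
    then have "pix (\<gamma> t) \<noteq> pix (\<gamma> 0)" using down[of u t] ne by auto
    then show "t \<in> J" using * or[of t] unfolding J_def by simp
  qed
  moreover have "0 \<in> I" "1 \<in> J" unfolding I_def J_def by simp_all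
  moreover have "I \<union> J = {0..1}"
  proof (intro equalityI subsetI)
    show "t \<in> {0..1}" if "t \<in> I \<union> J" for t using that unfolding I_def J_def by auto
    show "t \<in> I \<union> J" if "t \<in> {0..1}" for t using that or[of t] unfolding I_def J_def by auto
  qed
  moreover have "\<forall>u\<in>I. \<forall>v\<in>J. u < v"
  proof (intro ballI)
    fix u v assume "u \<in> I" "v \<in> J"
    then have *: "u \<le> 1" "0 \<le> v" "pix (\<gamma> u) = pix (\<gamma> 0)" "pix (\<gamma> v) = pix (\<gamma> 1)"
      unfolding I_def J_def by auto
    then show "u < v" using down[of v u] ne by (cases "u < v") simp_all
  qed
  moreover have "\<gamma> ` I \<subseteq> pix (\<gamma> 0)" "\<gamma> ` J \<subseteq> pix (\<gamma> 1)"
  proof -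
    have "\<gamma> t \<in> pix (\<gamma> t)" if "0 \<le> t" "t \<le> 1" for t using pix_in(2)[OF path_in[OF assms that]] .
    then show "\<gamma> ` I \<subseteq> pix (\<gamma> 0)" "\<gamma> ` J \<subseteq> pix (\<gamma> 1)"
      unfolding I_def J_def by (auto intro!: image_subsetI)
  qed
  moreover have "pix (\<gamma> 0) \<in> P" "pix (\<gamma> 1) \<in> P" using pix_in(1)[OF path_in[OF assms]] by simp_all
  ultimately have "pixel_partition P \<gamma> [I, J] [pix (\<gamma> 0), pix (\<gamma> 1)]"
    unfolding pixel_partition_def using ne by (auto simp: less_Suc_eq)
  then show "\<exists>Is Xs. pixel_partition P \<gamma> Is Xs \<and> length Is = 2"
    by (intro exI[of _ "[I, J]"] exI[of _ "[pix (\<gamma> 0), pix (\<gamma> 1)]"]) simp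
next
  assume "\<exists>Is Xs. pixel_partition P \<gamma> Is Xs \<and> length Is = 2"
  then obtain Is Xs where p: "pixel_partition P \<gamma> Is Xs" "length Is = 2" by blast
  then obtain I J where Is: "Is = [I, J]" by (auto simp: numeral_2_eq_2 length_Suc_conv)
  have "list_all2 (\<lambda>I Y. \<gamma> ` I \<subseteq> Y) Is Xs" using p(1) unfolding pixel_partition_def by (elim conjE)
  then have "length Xs = 2" using list_all2_lengthD p(2) by fastforce
  then obtain Y Z where Xs: "Xs = [Y, Z]" by (auto simp: numeral_2_eq_2 length_Suc_conv)
  have "\<forall>i < length Xs. \<forall>j < length Xs. i \<noteq> j \<longrightarrow> Xs ! i = Xs ! j \<longrightarrow> \<bar>int i - int j\<bar> > 1"
    using p(1) unfolding pixel_partition_def by (elim conjE)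
  \<comment> \<open>Positions 0 and 1 differ by exactly 1, so the condition on repeated pixels
    separates \<open>Y\<close> from \<open>Z\<close>.\<close>
  from this[rule_format, of 0 1] have ne: "Y \<noteq> Z" unfolding Xs by auto
  have IJ: "I \<noteq> {}" "J \<noteq> {}" "I \<union> J = {0..1}" "\<And>u v. u \<in> I \<Longrightarrow> v \<in> J \<Longrightarrow> u < v"
    and im: "\<gamma> ` I \<subseteq> Y" "\<gamma> ` J \<subseteq> Z" and YZ: "Y \<in> P" "Z \<in> P"
    using p(1) unfolding pixel_partition_def Is Xs by auto
  have I: "pix (\<gamma> t) = Y" if "t \<in> I" for t
    by (rule pix_eqI[OF YZ(1) subsetD[OF im(1) imageI[OF that]]])
  have J: "pix (\<gamma> t) = Z" if "t \<in> J" for t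
    by (rule pix_eqI[OF YZ(2) subsetD[OF im(2) imageI[OF that]]])
  obtain i j where ij: "i \<in> I" "j \<in> J" using IJ(1,2) by blast
  then have "i \<in> {0..1}" "j \<in> {0..1}" unfolding IJ(3)[symmetric] by simp_all
  then have "0 \<le> i" "j \<le> 1" by simp_all
  have "0 \<notin> J" using IJ(4)[OF ij(1), of 0] \<open>0 \<le> i\<close> by auto
  moreover have "1 \<notin> I" using IJ(4)[OF _ ij(2), of 1] \<open>j \<le> 1\<close> by auto
  moreover have cases: "t \<in> I \<or> t \<in> J" if "0 \<le> t" "t \<le> 1" for t
  proof -
    have "t \<in> I \<union> J" unfolding IJ(3) using that by simp
    then show ?thesis by simp
  qed
  ultimately have "0 \<in> I" "1 \<in> J" using cases[of 0] cases[of 1] by simp_all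
  then have ends: "pix (\<gamma> 0) = Y" "pix (\<gamma> 1) = Z" using I J by simp_all
  show "two_pieces \<gamma>"
    unfolding two_pieces_def ends
  proof (intro conjI allI impI ne)
    show "pix (\<gamma> t) = Y \<or> pix (\<gamma> t) = Z" if "0 \<le> t \<and> t \<le> 1" for t
      using cases[of t] that I[of t] J[of t] by blast
    show "pix (\<gamma> u) = Y" if "0 \<le> u \<and> u \<le> t \<and> t \<le> 1" "pix (\<gamma> t) = Y" for u t
    proof -
      have "t \<in> I" using cases[of t] that J[of t] ne by auto
      then have "u \<in> I" using cases[of u] that(1) IJ(4)[of t u] by force
      then show ?thesis by (rule I)
    qed
  qed
qed

text \<open>A weakly increasing map whose ends land in different pixels starts in the first piece
  and ends in the second. The hypothesis relates only pixels, so it also covers paths extended at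
  both ends by pixel paths.\<close>

lemma two_pieces_reparam:
  assumes "two_pieces \<gamma>" "reparam \<phi>" "\<And>t. 0 \<le> t \<Longrightarrow> t \<le> 1 \<Longrightarrow> pix (\<delta> t) = pix (\<gamma> (\<phi> t))"
    "pix (\<delta> 0) \<noteq> pix (\<delta> 1)"
  shows "two_pieces \<delta>" "pix (\<delta> 0) = pix (\<gamma> 0)" "pix (\<delta> 1) = pix (\<gamma> 1)"
proof -
  have in01: "0 \<le> \<phi> t" "\<phi> t \<le> 1" if "0 \<le> t" "t \<le> 1" for t using reparam_in[OF assms(2), of t] that by auto
  have down: "pix (\<gamma> u) = pix (\<gamma> 0)" if "0 \<le> u" "u \<le> t" "t \<le> 1" "pix (\<gamma> t) = pix (\<gamma> 0)" for u t
    using assms(1) that unfolding two_pieces_def by blast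
  have or: "pix (\<gamma> t) = pix (\<gamma> 0) \<or> pix (\<gamma> t) = pix (\<gamma> 1)" if "0 \<le> t" "t \<le> 1" for t
    using assms(1) that unfolding two_pieces_def by blast
  have \<delta>: "pix (\<delta> 0) = pix (\<gamma> (\<phi> 0))" "pix (\<delta> 1) = pix (\<gamma> (\<phi> 1))" using assms(3) by simp_all
  have le: "\<phi> 0 \<le> \<phi> 1" using reparam_mono[OF assms(2), of 0 1] by simp
  have "pix (\<gamma> (\<phi> 1)) \<noteq> pix (\<gamma> 0)"
    using down[OF in01(1)[of 0] le in01(2)[of 1]] \<delta> assms(4) by auto
  then have 1: "pix (\<gamma> (\<phi> 1)) = pix (\<gamma> 1)" using or[OF in01[of 1]] by simp
  then have 0: "pix (\<gamma> (\<phi> 0)) = pix (\<gamma> 0)" using or[OF in01[of 0]] \<delta> assms(4) by auto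
  show e: "pix (\<delta> 0) = pix (\<gamma> 0)" "pix (\<delta> 1) = pix (\<gamma> 1)" using 0 1 \<delta> by simp_all
  show "two_pieces \<delta>"
    unfolding two_pieces_def
  proof (intro conjI allI impI assms(4))
    show "pix (\<delta> t) = pix (\<delta> 0) \<or> pix (\<delta> t) = pix (\<delta> 1)" if "0 \<le> t \<and> t \<le> 1" for t
      using or[OF in01[of t]] that assms(3)[of t] unfolding e by auto
    show "pix (\<delta> u) = pix (\<delta> 0)" if "0 \<le> u \<and> u \<le> t \<and> t \<le> 1" "pix (\<delta> t) = pix (\<delta> 0)" for u t
    proof -
      have "pix (\<gamma> (\<phi> u)) = pix (\<gamma> 0)"
        by (rule down[of _ "\<phi> t"]) (use that in01 assms(3)[of t] reparam_mono[OF assms(2), of u t] e in auto)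
      then show ?thesis using assms(3)[of u] that(1) e by simp
    qed
  qed
qed

text \<open>
  A pseudo arrow starts at the chosen point of its source pixel. Precomposing with pixel paths
  gives a set of paths that is closed under reparametrization.
\<close>

definition arrow_paths :: "(real \<Rightarrow> 'a) set" where
  "arrow_paths = {\<gamma> \<in> \<Gamma>. in_pixel \<gamma> \<or>
     two_pieces \<gamma> \<and> (\<exists>\<rho> \<in> \<Gamma>. in_pixel \<rho> \<and> \<rho> 0 = s (pix (\<gamma> 0)) \<and> \<rho> 1 = \<gamma> 0)}"

text \<open>Reparametrization can cut off one of the two pieces, which leaves a path in a pixel.
  Otherwise it can only move the start within the first piece, and the witness \<rho> is extended
  along \<gamma>.\<close>

lemma arrow_paths_reparam:
  assumes "\<gamma> \<in> arrow_paths" "reparam \<phi>"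
  shows "compose {0..1} \<gamma> \<phi> \<in> arrow_paths"
proof -
  let ?\<delta> = "compose {0..1} \<gamma> \<phi>"
  have \<gamma>: "\<gamma> \<in> \<Gamma>" using assms by (simp add: arrow_paths_def)
  have \<delta>: "?\<delta> \<in> \<Gamma>" using reparam \<gamma> assms(2) .
  have \<delta>_eq: "?\<delta> t = \<gamma> (\<phi> t)" if "0 \<le> t" "t \<le> 1" for t using that by (simp add: compose_def)
  have in01: "0 \<le> \<phi> t" "\<phi> t \<le> 1" if "0 \<le> t" "t \<le> 1" for t using reparam_in[OF assms(2), of t] that by auto
  have mono: "\<phi> 0 \<le> \<phi> t" "\<phi> t \<le> \<phi> 1" if "0 \<le> t" "t \<le> 1" for t
    using reparam_mono[OF assms(2)] that by simp_all
  consider "in_pixel \<gamma>" | \<rho> where "two_pieces \<gamma>" "\<rho> \<in> \<Gamma>" "in_pixel \<rho>" "\<rho> 0 = s (pix (\<gamma> 0))" "\<rho> 1 = \<gamma> 0"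
    using assms by (auto simp: arrow_paths_def)
  then show ?thesis
  proof cases
    case 1
    have "in_pixel ?\<delta>"
    proof (rule in_pixelI[OF \<delta>])
      fix t :: real assume "0 \<le> t" "t \<le> 1"
      then show "pix (?\<delta> t) = pix (?\<delta> 0)"
        using in_pixel_pix[OF \<gamma> 1 in01[of t]] in_pixel_pix[OF \<gamma> 1 in01[of 0]] \<delta>_eq[of t] \<delta>_eq[of 0] by simp
    qed
    then show ?thesis using \<delta> by (simp add: arrow_paths_def)
  next
    case 2
    have down: "pix (\<gamma> u) = pix (\<gamma> 0)" if "0 \<le> u" "u \<le> t" "t \<le> 1" "pix (\<gamma> t) = pix (\<gamma> 0)" for u t
      using 2(1) that unfolding two_pieces_def by blast
    have or: "pix (\<gamma> t) = pix (\<gamma> 0) \<or> pix (\<gamma> t) = pix (\<gamma> 1)" if "0 \<le> t" "t \<le> 1" for t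
      using 2(1) that unfolding two_pieces_def by blast
    show ?thesis
    proof (cases "pix (?\<delta> 0) = pix (?\<delta> 1)")
      case True
      have const: "pix (\<gamma> (\<phi> t)) = pix (\<gamma> (\<phi> 0))" if t: "0 \<le> t" "t \<le> 1" for t
      proof (cases "pix (\<gamma> (\<phi> t)) = pix (\<gamma> 0)")
        case True
        then show ?thesis using down[OF in01(1)[of 0] mono(1)[OF t] in01(2)[OF t]] by simp
      next
        case False
        then have "pix (\<gamma> (\<phi> 1)) \<noteq> pix (\<gamma> 0)"
          using down[OF in01(1)[OF t] mono(2)[OF t] in01(2)[of 1]] by auto
        then show ?thesis
          using False or[OF in01[OF t]] or[OF in01[of 1]] \<open>pix (?\<delta> 0) = pix (?\<delta> 1)\<close> \<delta>_eq[of 0] \<delta>_eq[of 1]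
          by simp
      qed
      have "in_pixel ?\<delta>"
      proof (rule in_pixelI[OF \<delta>])
        fix t :: real assume t: "0 \<le> t" "t \<le> 1"
        then show "pix (?\<delta> t) = pix (?\<delta> 0)" using const[OF t] \<delta>_eq[of t] \<delta>_eq[of 0] by simp
      qed
      then show ?thesis using \<delta> by (simp add: arrow_paths_def)
    next
      case False
      have two: "two_pieces ?\<delta>" "pix (?\<delta> 0) = pix (\<gamma> 0)"
        by (rule two_pieces_reparam[OF 2(1) assms(2) _ False]; simp add: \<delta>_eq)+
      \<comment> \<open>The skipped beginning of \<gamma> lies in its first pixel and leads from the
        end of \<rho> to the new start.\<close>
      let ?\<sigma> = "sub_path \<gamma> 0 (\<phi> 0)"
      have \<sigma>: "?\<sigma> \<in> \<Gamma>" using sub_path_in[OF \<gamma>] in01[of 0] by simp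
      have "in_pixel ?\<sigma>"
      proof (rule in_pixelI[OF \<sigma>])
        fix t :: real assume t: "0 \<le> t" "t \<le> 1"
        have "pix (\<gamma> (\<phi> 0 * t)) = pix (\<gamma> 0)"
          by (rule down[of _ "\<phi> 0"]) (use t in01[of 0] two(2) \<delta>_eq[of 0] in \<open>simp_all add: mult_left_le\<close>)
        then show "pix (?\<sigma> t) = pix (?\<sigma> 0)" using t by simp
      qed
      then have "in_pixel (\<rho> \<cdot> ?\<sigma>)"
        using in_pixel_join[OF 2(2) \<sigma>] 2 by simp
      then have "two_pieces ?\<delta> \<and> (\<exists>\<rho> \<in> \<Gamma>. in_pixel \<rho> \<and> \<rho> 0 = s (pix (?\<delta> 0)) \<and> \<rho> 1 = ?\<delta> 0)"
        using two 2 join[OF 2(2) \<sigma>] \<delta>_eq[of 0] by (intro conjI bexI[of _ "\<rho> \<cdot> ?\<sigma>"]) simp_all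
      then show ?thesis using \<delta> unfolding arrow_paths_def by blast
    qed
  qed
qed

abbreviation "Q \<equiv> pixel_quiver X \<Gamma> R P s"

lemma quiver_simps:
  "Verts Q = P" "Src Q (Y, m, Z) = Y" "Tgt Q (Y, m, Z) = Z"
  "(Y, m, Z) \<in> Arrs Q \<longleftrightarrow> Y \<in> P \<and> Z \<in> P \<and> m \<in> pseudo_arrows X \<Gamma> R P \<and> m \<in> Hom D (s Y) (s Z)"
  by (simp_all add: pixel_quiver_def pixelation_def)

lemma NP_fraction:
  assumes "\<gamma> \<in> \<Gamma>" "\<rho> \<in> \<Gamma>" "in_pixel \<rho>" "\<gamma> 1 = \<rho> 1" "\<gamma> 0 = s (pix (\<gamma> 0))" "\<rho> 0 = s (pix (\<rho> 0))"
  shows "NP \<gamma> = Comp D (V (R `` {\<rho>})) (L (R `` {\<gamma>}))"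
  unfolding NP_def by (rule N_fraction) (use assms in \<open>simp_all add: path_cat_simps pixel_mors_iff\<close>)

lemma arrow_pathE:
  assumes "(Y, m, Z) \<in> Arrs Q"
  obtains \<gamma> where "\<gamma> \<in> arrow_paths" "pix (\<gamma> 0) = Y" "pix (\<gamma> 1) = Z" "NP \<gamma> = m"
proof -
  have YZ: "Y \<in> P" "Z \<in> P" and m: "m \<in> pseudo_arrows X \<Gamma> R P" "m \<in> Hom D (s Y) (s Z)"
    using assms by (simp_all add: quiver_simps)
  then obtain \<rho> \<gamma> where *: "m = Comp D (V (R `` {\<rho>})) (L (R `` {\<gamma>}))" "\<rho> \<in> \<Gamma>" "\<gamma> \<in> \<Gamma>" "\<rho> 1 = \<gamma> 1"
    "R `` {\<rho>} \<in> \<Sigma>" "\<exists>Is Xs. pixel_partition P \<gamma> Is Xs \<and> length Is = 2"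
    unfolding pseudo_arrows_def pixelation_def by blast
  have in_pixel: "in_pixel \<rho>" using *(5) pixel_mors_iff[OF *(2)] by simp
  have two: "two_pieces \<gamma>" using *(6) two_pieces_iff[OF *(3)] by blast
  have "Dom D m = \<gamma> 0" "Cod D m = \<rho> 0"
    unfolding *(1) using *(2-5) by (simp_all add: path_cat_simps D.Dom_Comp D.Cod_Comp)
  then have ends: "\<gamma> 0 = s Y" "\<rho> 0 = s Z" using m(2) by (auto simp: Hom_def)
  show ?thesis
  proof (rule that)
    \<comment> \<open>The numerator of a pseudo arrow starts at the chosen point itself, so a
      constant path is the required connection.\<close>
    have "in_pixel (const_path (s Y)) \<and> const_path (s Y) \<in> \<Gamma>"
      using YZ s_X const in_pixel_const by simp
    then show "\<gamma> \<in> arrow_paths"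
      using *(3) two ends pix_s[OF YZ(1)] unfolding arrow_paths_def
      by (auto intro!: bexI[of _ "const_path (s Y)"])
    show "pix (\<gamma> 0) = Y" using ends pix_s YZ by simp
    show "pix (\<gamma> 1) = Z"
      using in_pixel_pix[OF *(2) in_pixel, of 1] *(4) ends pix_s YZ by simp
    show "NP \<gamma> = m"
      unfolding *(1) by (rule NP_fraction) (use * in_pixel ends pix_s YZ in simp_all)
  qed
qed

text \<open>Prepending the witness \<rho> moves the start to the chosen point, and a cospan
  \<sigma>, \<tau> supplies a denominator at the chosen point of the target pixel. Joining pixel
  paths leaves the value unchanged.\<close>

lemma two_pieces_arrow:
  assumes "\<gamma> \<in> arrow_paths" "\<not> in_pixel \<gamma>"
  shows "(pix (\<gamma> 0), NP \<gamma>, pix (\<gamma> 1)) \<in> Arrs Q"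
proof -
  obtain \<rho> where \<gamma>: "\<gamma> \<in> \<Gamma>" "two_pieces \<gamma>" and \<rho>: "\<rho> \<in> \<Gamma>" "in_pixel \<rho>" "\<rho> 0 = s (pix (\<gamma> 0))" "\<rho> 1 = \<gamma> 0"
    using assms by (auto simp: arrow_paths_def)
  have pixP: "pix (\<gamma> 0) \<in> P" "pix (\<gamma> 1) \<in> P" using pix_in path_in[OF \<gamma>(1)] by simp_all
  obtain \<sigma> \<tau> where st: "\<sigma> \<in> \<Gamma>" "\<tau> \<in> \<Gamma>" "in_pixel \<sigma>" "in_pixel \<tau>" "\<sigma> 0 = \<gamma> 1" "\<tau> 0 = s (pix (\<gamma> 1))" "\<sigma> 1 = \<tau> 1"
    using pixel_directed_up[of "\<gamma> 1" "s (pix (\<gamma> 1))"] path_in[OF \<gamma>(1)] s_X[OF pixP(2)] pix_s[OF pixP(2)] by auto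
  let ?\<delta> = "\<rho> \<cdot> \<gamma> \<cdot> \<sigma>"
  have \<delta>: "?\<delta> \<in> \<Gamma>" using \<gamma> \<rho> st by (auto intro!: join)
  have ne: "pix (\<gamma> 0) \<noteq> pix (\<gamma> 1)" using \<gamma>(2) unfolding two_pieces_def by blast
  have "two_pieces ?\<delta>"
  \<comment> \<open>In \<open>\<rho> \<cdot> \<gamma> \<cdot> \<sigma>\<close> the path \<gamma>
    runs from time 1/4 to time 1/2, at fourfold speed; the clamping sends the pixel paths around it
    to its ends.\<close>
  proof (rule two_pieces_reparam[OF \<gamma>(2), where \<phi> = "\<lambda>t. max 0 (min 1 (4 * t - 1))"])
    show "reparam (\<lambda>t. max 0 (min 1 (4 * t - 1)))"
      by (rule reparamI) (auto intro!: continuous_intros mono_onI max.mono min.mono)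
    show "pix (?\<delta> 0) \<noteq> pix (?\<delta> 1)"
      using ne \<rho> st pix_s[OF pixP(1)] in_pixel_pix[OF st(1,3), of 1] by simp
    fix t :: real assume t: "0 \<le> t" "t \<le> 1"
    consider "t \<le> 1/4" | "1/4 < t" "t \<le> 1/2" | "1/2 < t" by linarith
    then show "pix (?\<delta> t) = pix (\<gamma> (max 0 (min 1 (4 * t - 1))))"
    proof cases
      case 1
      then have "max 0 (min 1 (4 * t - 1)) = 0" by auto
      moreover have "?\<delta> t = \<rho> (4 * t)" using 1 t by (simp add: path_join_def)
      ultimately show ?thesis
        using in_pixel_pix[OF \<rho>(1,2), of "4 * t"] 1 t \<rho> pix_s[OF pixP(1)] by simp
    next
      case 2
      then have "max 0 (min 1 (4 * t - 1)) = 4 * t - 1" by auto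
      moreover have "?\<delta> t = \<gamma> (4 * t - 1)" using 2 t by (simp add: path_join_def)
      ultimately show ?thesis by simp
    next
      case 3
      then have "max 0 (min 1 (4 * t - 1)) = 1" by auto
      moreover have "?\<delta> t = \<sigma> (2 * t - 1)" using 3 t by (simp add: path_join_def)
      ultimately show ?thesis
        using in_pixel_pix[OF st(1,3), of "2 * t - 1"] 3 t st by simp
    qed
  qed
  then have part: "\<exists>Is Xs. pixel_partition P ?\<delta> Is Xs \<and> length Is = 2"
    using two_pieces_iff[OF \<delta>] by blast
  have NP: "NP \<gamma> = NP ?\<delta>" using NP_join_pixel_paths[of \<gamma> \<rho> \<sigma>] \<gamma> \<rho> st by simp
  also have "\<dots> = Comp D (V (R `` {\<tau>})) (L (R `` {?\<delta>}))"
    by (rule NP_fraction) (use \<delta> \<rho> st pix_s[OF pixP(1)] pix_s[OF pixP(2)] in simp_all)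
  finally have "NP \<gamma> \<in> pseudo_arrows X \<Gamma> R P"
    unfolding pseudo_arrows_def pixelation_def
    using \<delta> st part pixel_mors_iff[OF st(2)] by (intro CollectI exI[of _ \<tau>] exI[of _ ?\<delta>]) simp
  then show ?thesis using pixP NP_in[OF \<gamma>(1)] by (simp add: quiver_simps)
qed

lemma evaluation_Psi: "evaluation (free_cat Q) D s (Psi X \<Gamma> R P s)"
  unfolding Psi_def pixelation_def
proof (rule evaluation_free_extension[OF D.category_axioms])
  show "s Y \<in> Obj D" if "Y \<in> Verts Q" for Y
    using that s_X by (simp add: quiver_simps path_cat_simps)
  show "(case e of (Y, m, Z) \<Rightarrow> m) \<in> Hom D (s (Src Q e)) (s (Tgt Q e))" if "e \<in> Arrs Q" for e
    using that by (cases e) (simp add: quiver_simps)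
qed

sublocale Psi: evaluation "free_cat Q" D s "Psi X \<Gamma> R P s"
  by (rule evaluation_Psi)

lemma Q_bar_eq: "Q_bar X \<Gamma> R P s = quot_cat (free_cat Q) Psi.kernel"
  by (simp add: Q_bar_def Psi_kernel_def Psi.kernel_def Let_def)

lemma Psi_single:
  assumes "(Y, m, Z) \<in> Arrs Q"
  shows "Psi X \<Gamma> R P s (Y, [(Y, m, Z)], Z) = m"
proof -
  have "m \<in> Mor D" "Cod D m = s Z" using assms by (simp_all add: quiver_simps Hom_def)
  then show ?thesis
    using D.Comp_Ident_left[of m] by (simp add: Psi_def pixelation_def quiver_simps)
qed

text \<open>Both sides are quotients by the kernel of an evaluation in the same localization, with
  the same objects. So it suffices that walks in the quiver and step functions take the same values
  between the same pixels.\<close>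

lemma Q_bar_isomorphic_path_cat:
  "\<exists>(X' :: 'a set set) \<Gamma>' R'. triple X' \<Gamma>' R' \<and> isomorphic_cats (Q_bar X \<Gamma> R P s) (path_cat X' \<Gamma>' R')"
proof -
  interpret T: step_paths D P s "proj_step arrow_paths"
  proof (rule step_paths_proj_step)
    show "arrow_paths \<subseteq> \<Gamma>" by (auto simp: arrow_paths_def)
    show "const_path (s Y) \<in> arrow_paths" if "Y \<in> P" for Y
      using that s_X const in_pixel_const by (simp add: arrow_paths_def)
  qed (rule arrow_paths_reparam)
  let ?S = "path_structure P T.ev_paths"
  \<comment> \<open>Each arrow contributes the projection of the path from
    \<open>arrow_pathE\<close>; joining these follows the walk.\<close>
  have to_path: "\<exists>f. f \<in> T.ev_paths \<and> f 0 = x \<and> f 1 = y \<and> T.val f = Psi X \<Gamma> R P s (x, es, y)"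
    if "is_walk Q x es y" for x es y
    using that
  proof (induction es arbitrary: x)
    case Nil
    then have x: "x = y" "x \<in> P" by (auto simp: quiver_simps)
    then show ?case
      using T.const_ev_paths[of x] T.val_eqI[OF T.Ev_const_path[of x]]
      by (intro exI[of _ "const_path x"]) (simp add: Psi_def pixelation_def)
  next
    case (Cons e es)
    obtain Y m Z where e: "e = (Y, m, Z)" by (cases e)
    have arr: "(Y, m, Z) \<in> Arrs Q" "Y = x" and w: "is_walk Q Z es y"
      using Cons.prems unfolding e by (auto simp: quiver_simps)
    obtain f where f: "f \<in> T.ev_paths" "f 0 = Z" "f 1 = y" "T.val f = Psi X \<Gamma> R P s (Z, es, y)"
      using Cons.IH[OF w] by blast
    obtain \<gamma> where \<gamma>: "\<gamma> \<in> arrow_paths" "pix (\<gamma> 0) = Y" "pix (\<gamma> 1) = Z" "NP \<gamma> = m"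
      using arr(1) by (rule arrow_pathE)
    define g where "g = (\<lambda>t \<in> {0..1}. pix (\<gamma> t))"
    have "proj_step arrow_paths g 0 1 m"
      by (rule proj_stepI[where \<gamma> = \<gamma>]) (use \<gamma> in \<open>simp_all add: g_def\<close>)
    then have Ev: "T.Ev g 0 1 m" by (rule T.Ev_J)
    have "g \<in> {0..1} \<rightarrow>\<^sub>E P"
      using path_in[of \<gamma>] \<gamma>(1) pix_in by (auto simp: g_def arrow_paths_def)
    then have g: "g \<in> T.ev_paths" "g 0 = x" "g 1 = Z" "T.val g = m"
      using Ev T.val_eqI[OF Ev] \<gamma>(2,3) arr(2) unfolding T.ev_paths_def by (auto simp: g_def)
    have "T.val (g \<cdot> f) = Psi X \<Gamma> R P s (x, e # es, y)"
      using T.val_eqI[OF T.Ev_join[OF g(1) f(1)]] g f arr(2)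
      by (simp add: e Psi_def pixelation_def quiver_simps)
    then show ?case
      using g f T.join_ev_paths[OF g(1) f(1)] by (intro exI[of _ "g \<cdot> f"]) simp
  qed
  \<comment> \<open>A piece inside a pixel becomes the empty walk, any other piece a single
    arrow.\<close>
  have step_walk: "\<exists>es. is_walk Q (f a) es (f b) \<and> Psi X \<Gamma> R P s (f a, es, f b) = m"
    if step: "proj_step arrow_paths f a b m" for f a b m
  proof -
    obtain \<gamma> where \<gamma>: "\<gamma> \<in> arrow_paths" "m = NP \<gamma>" "f a = pix (\<gamma> 0)" "f b = pix (\<gamma> 1)"
      using step by (rule proj_stepE) (rule that)
    have \<Gamma>: "\<gamma> \<in> \<Gamma>" using \<gamma>(1) by (simp add: arrow_paths_def)
    show ?thesis
    proof (cases "in_pixel \<gamma>")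
      case True
      have "f b = f a" "m = Ident D (s (f a))"
        using in_pixel_pix[OF \<Gamma> True, of 1] NP_in_pixel[OF \<Gamma> True] \<gamma> by simp_all
      moreover have "f a \<in> P" using \<gamma>(3) pix_in path_in[OF \<Gamma>, of 0] by simp
      ultimately show ?thesis
        by (intro exI[of _ "[]"]) (simp add: Psi_def pixelation_def quiver_simps)
    next
      case False
      have arr: "(f a, m, f b) \<in> Arrs Q" using two_pieces_arrow[OF \<gamma>(1) False] \<gamma> by simp
      moreover from arr have "f a \<in> P" "f b \<in> P" by (simp_all add: quiver_simps)
      ultimately show ?thesis
        using Psi_single[OF arr] by (intro exI[of _ "[(f a, m, f b)]"]) (simp add: quiver_simps)
    qed
  qed
  have to_walk: "\<exists>es. is_walk Q (f a) es (f b) \<and> Psi X \<Gamma> R P s (f a, es, f b) = m"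
    if "T.Ev f a b m" for f a b m
    using that
  proof (induction rule: T.Ev.induct)
    case (Ev_J a b m)
    then show ?case by (rule step_walk)
  next
    case (Ev_step a b m c n)
    obtain es where es: "is_walk Q (f a) es (f b)" "Psi X \<Gamma> R P s (f a, es, f b) = m"
      using step_walk[OF Ev_step.hyps(1)] by blast
    obtain fs where fs: "is_walk Q (f b) fs (f c)" "Psi X \<Gamma> R P s (f b, fs, f c) = n"
      using Ev_step.IH by blast
    show ?case
      using Psi.ev_Comp[of "(f a, es, f b)" "(f b, fs, f c)"] es fs is_walk_append[OF es(1) fs(1)]
      by (intro exI[of _ "es @ fs"]) simp
  qed
  have "isomorphic_cats (quot_cat (free_cat Q) Psi.kernel) (quot_cat ?S T.E.kernel)"
  proof (rule isomorphic_kernel_quotients[OF evaluation_Psi T.evaluation_val])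
    show "Obj (free_cat Q) = Obj ?S" by (simp add: quiver_simps T.ev_structure_simps)
    show "\<forall>w\<in>Mor (free_cat Q). \<exists>f. f \<in> Mor ?S \<and> Dom ?S f = Dom (free_cat Q) w \<and>
        Cod ?S f = Cod (free_cat Q) w \<and> T.val f = Psi X \<Gamma> R P s w"
      using to_path by (auto simp: T.ev_structure_simps)
    show "\<forall>f\<in>Mor ?S. \<exists>w. w \<in> Mor (free_cat Q) \<and> Dom (free_cat Q) w = Dom ?S f \<and>
        Cod (free_cat Q) w = Cod ?S f \<and> Psi X \<Gamma> R P s w = T.val f"
    proof
      fix f assume "f \<in> Mor ?S"
      then obtain es where "is_walk Q (f 0) es (f 1)" "Psi X \<Gamma> R P s (f 0, es, f 1) = T.val f"
        using to_walk[OF T.Ev_val] by (auto simp: T.ev_structure_simps)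
      then show "\<exists>w. w \<in> Mor (free_cat Q) \<and> Dom (free_cat Q) w = Dom ?S f \<and>
          Cod (free_cat Q) w = Cod ?S f \<and> Psi X \<Gamma> R P s w = T.val f"
        by (intro exI[of _ "(f 0, es, f 1)"]) (simp add: T.ev_structure_simps)
    qed
  qed
  then show ?thesis
    using T.triple_ev_paths unfolding Q_bar_eq T.path_cat_ev_paths[symmetric] by blast
qed

end

theorem theorem1:
  fixes X :: "'a set"
    and \<Gamma> :: "(real \<Rightarrow> 'a) set"
    and R :: "((real \<Rightarrow> 'a) \<times> (real \<Rightarrow> 'a)) set"
    and P :: "'a set set"
    and s :: "'a set \<Rightarrow> 'a"
  assumes "triple X \<Gamma> R"
    and "screen X \<Gamma> R P"
    and "\<And>Y. Y \<in> P \<Longrightarrow> s Y \<in> Y"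
  shows "(\<exists>(X' :: 'a set set) \<Gamma>' R'. triple X' \<Gamma>' R' \<and>
            isomorphic_cats (Q_bar X \<Gamma> R P s) (path_cat X' \<Gamma>' R')) \<and>
         (\<exists>(X' :: 'a set set) \<Gamma>' R'. triple X' \<Gamma>' R' \<and>
            equivalent_cats (pixelation X \<Gamma> R P) (path_cat X' \<Gamma>' R'))"
proof -
  interpret pointed_screen X \<Gamma> R P s
    using assms(2,3) by (intro pointed_screen.intro pointed_screen_axioms.intro)
  show ?thesis
    using Q_bar_isomorphic_path_cat pixelation_equivalent_path_cat unfolding pixelation_def by blast
qed

end
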